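(* Let $\Sigma_1,\Sigma_2$ be $0$-asymptotically stable systems and let $\gamma,\delta>0$. Then $\Sigma_2$ is $(\gamma,\delta)$-similar to $\Sigma_1$ if and only if there exist constants $\eta,\mu>0$ such that, for $$Q=\begin{bmatrix}(\gamma+\delta)I&-\gamma I&0 \\ -\gamma I&(\gamma+\delta)I&0 \\ 0&0&\mu I\end{bmatrix},\qquad R=\begin{bmatrix}I&0 \\ 0&\eta I\end{bmatrix},$$ the algebraic Riccati equation $$0=A^TP+PA+C^TRC+PEQ^{-1}E^TP-PB(D^TRD)^{-1}B^TP$$ admits a (symmetric) positive semi-definite solution $P$ such that $$\operatorname{spec}\bigl(A-B(D^TRD)^{-1}B^TP+EQ^{-1}E^TP\bigr)\subseteq\mathbb{C}_-,$$ where $$A=\begin{bmatrix}A_1&0 \\ 0&A_2\end{bmatrix},\ B=\begin{bmatrix}0 \\ E_2\end{bmatrix},\ E=\begin{bmatrix}B_1&0&E_1 \\ 0&B_2&0\end{bmatrix},\ C=\begin{bmatrix}C_1&-C_2 \\ 0&0\end{bmatrix},\ D=\begin{bmatrix}0 \\ I\end{bmatrix}.$$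
   Context: For $i=1,2$, $\Sigma_i$ is the continuous-time linear system $\dot x_i=A_ix_i+B_iu_i+E_id_i$, $y_i=C_ix_i$ with real constant matrices, state $x_i\in\mathbb{R}^{n_i}$, input $u_i\in\mathbb{R}^{m}$, disturbance $d_i\in\mathbb{R}^{q_i}$ and output $y_i\in\mathbb{R}^{p}$ (same $m$ and $p$ for both systems). It is $0$-asymptotically stable if $A_i$ is Hurwitz. $\mathcal{L}_2$ is the space of measurable (vector-valued) functions $u$ on $[0,\infty)$ with $\|u\|^2=\int_0^\infty|u(t)|^2\,dt<\infty$. $y_i(t;t_0,x_{i,0},u_i,d_i)$ denotes the output at time $t$ for $x_i(t_0)=x_{i,0}$, input $u_i$, disturbance $d_i$. Definition. For $\gamma,\delta>0$, $\Sigma_2$ is $(\gamma,\delta)$-similar to $\Sigma_1$ ($\Sigma_1\preccurlyeq_{\gamma,\delta}\Sigma_2$) if there exist constants $\varepsilon,\eta,\mu>0$ such that for all $u_1,u_2\in\mathcal{L}_2$ and all $d_1\in\mathcal{L}_2$ there exists $d_2\in\mathcal{L}_2$ with $$\|y_1-y_2\|^2\le\gamma\|u_1-u_2\|^2+(\delta-\varepsilon)\left\|\begin{bmatrix}u_1 \\ u_2\end{bmatrix}\right\|^2+(\mu-\varepsilon)\|d_1\|^2-\eta\|d_2\|^2,$$ where $y_i(t)=y_i(t;0,0,u_i,d_i)$. Block sizes: in $Q$ the diagonal blocks have sizes $m,m,q_1$; in $R$ they have sizes $p,q_2$; in $C$ and $D$ the row blocks have sizes $p,q_2$, and the identity in $D$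 is $q_2\times q_2$. $\operatorname{spec}$ denotes the spectrum and $\mathbb{C}_-$ the open left half plane. *)

theory Defs
  imports "HOL-Analysis.Analysis"
begin

section \<open>Block vectors and block matrices\<close>

text \<open>
  Vectors and matrices made of blocks are indexed by sum types: \<^typ>\<open>real^('a::finite + 'b::finite)\<close>
  stands for the product of the Euclidean spaces indexed by the two summands.
\<close>

definition stack :: "'x^'a \<Rightarrow> 'x^'b \<Rightarrow> 'x^('a + 'b)" where
  "stack u v = (\<chi> i. case i of Inl a \<Rightarrow> u $ a | Inr b \<Rightarrow> v $ b)"

text \<open>\<open>hcat M N\<close> is the block row \<open>[M, N]\<close>, and \<open>vcat M N\<close> the block column with \<open>M\<close> above \<open>N\<close>.\<close>

definition hcat :: "'x^'a^'r \<Rightarrow> 'x^'b^'r \<Rightarrow> 'x^('a + 'b)^'r" where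
  "hcat M N = (\<chi> i. stack (M $ i) (N $ i))"

definition vcat :: "'x^'c^'a \<Rightarrow> 'x^'c^'b \<Rightarrow> 'x^'c^('a + 'b)" where
  "vcat M N = stack M N"


section \<open>Spectrum and definiteness of real square matrices\<close>

definition spec :: "real^'n^'n \<Rightarrow> complex set" where
  "spec M = {z. \<exists>v :: complex^'n. v \<noteq> 0 \<and> map_matrix complex_of_real M *v v = z *s v}"

definition open_left_half_plane :: "complex set" where
  "open_left_half_plane = {z. Re z < 0}"

definition Hurwitz :: "real^'n^'n \<Rightarrow> bool" where
  "Hurwitz M \<longleftrightarrow> spec M \<subseteq> open_left_half_plane"

definition sym_pos_semidef :: "real^'n^'n \<Rightarrow> bool" where
  "sym_pos_semidef P \<longleftrightarrow> transpose P = P \<and> (\<forall>x. 0 \<le> x \<bullet> (P *v x))"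


section \<open>Square-integrable signals on the half-line\<close>

text \<open>
  Signals are functions on \<^typ>\<open>real\<close> of which only the values on \<open>[0,\<infinity>)\<close> matter.
  Measurability and integrals are those of Lebesgue measure.
\<close>

definition L2 :: "(real \<Rightarrow> 'a::euclidean_space) set" where
  "L2 = {u. set_borel_measurable lebesgue {0..} u \<and>
            set_integrable lebesgue {0..} (\<lambda>t. (norm (u t))\<^sup>2)}"

text \<open>The squared norm; as a real number it is meaningful for members of \<^const>\<open>L2\<close> only.\<close>

definition L2_norm_sq :: "(real \<Rightarrow> 'a::euclidean_space) \<Rightarrow> real" where
  "L2_norm_sq u = (LINT t:{0..}|lebesgue. (norm (u t))\<^sup>2)"


section \<open>Linear systems with disturbances\<close>

record ('n::finite, 'm::finite, 'q::finite, 'p::finite) lti_system =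
  mat_A :: "real^'n^'n"
  mat_B :: "real^'m^'n"
  mat_E :: "real^'q^'n"
  mat_C :: "real^'n^'p"

definition zero_asymp_stable :: "('n::finite, 'm::finite, 'q::finite, 'p::finite) lti_system \<Rightarrow> bool" where
  "zero_asymp_stable S \<longleftrightarrow> Hurwitz (mat_A S)"

text \<open>
  Inputs are only square integrable, so solutions of the differential equation are understood in the
  sense of Caratheodory (absolutely continuous, equation valid almost everywhere), that is, as
  solutions of the integral equation.
\<close>

definition is_state_trajectory ::
  "('n::finite, 'm::finite, 'q::finite, 'p::finite) lti_system \<Rightarrow> real \<Rightarrow> real^'n \<Rightarrow>
    (real \<Rightarrow> real^'m) \<Rightarrow> (real \<Rightarrow> real^'q) \<Rightarrow> (real \<Rightarrow> real^'n) \<Rightarrow> bool" where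
  "is_state_trajectory S t0 x0 u d x \<longleftrightarrow>
     (\<forall>t\<ge>t0.
        set_integrable lebesgue {t0..t} (\<lambda>s. mat_A S *v x s + mat_B S *v u s + mat_E S *v d s) \<and>
        x t = x0 + (LINT s:{t0..t}|lebesgue. mat_A S *v x s + mat_B S *v u s + mat_E S *v d s))"

text \<open>
  For locally integrable \<open>u\<close> and \<open>d\<close> a trajectory exists and is unique on \<open>[t0,\<infinity>)\<close>, so the description
  below is proper for \<open>t \<ge> t0\<close>. It picks the value at \<open>t\<close>, not the trajectory, since the
  latter is arbitrary before \<open>t0\<close>.
\<close>

definition state_at ::
  "('n::finite, 'm::finite, 'q::finite, 'p::finite) lti_system \<Rightarrow> real \<Rightarrow> real^'n \<Rightarrow>
    (real \<Rightarrow> real^'m) \<Rightarrow> (real \<Rightarrow> real^'q) \<Rightarrow> real \<Rightarrow> real^'n" where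
  "state_at S t0 x0 u d t = (THE v. \<exists>x. is_state_trajectory S t0 x0 u d x \<and> v = x t)"

definition output_at ::
  "('n::finite, 'm::finite, 'q::finite, 'p::finite) lti_system \<Rightarrow> real \<Rightarrow> real^'n \<Rightarrow>
    (real \<Rightarrow> real^'m) \<Rightarrow> (real \<Rightarrow> real^'q) \<Rightarrow> real \<Rightarrow> real^'p" where
  "output_at S t0 x0 u d t = mat_C S *v state_at S t0 x0 u d t"


section \<open>Similarity\<close>

text \<open>
  \<open>similar \<gamma> \<delta> S1 S2\<close> says that \<open>S2\<close> is \<open>(\<gamma>,\<delta>)\<close>-similar to \<open>S1\<close>. The conjunct \<open>e \<in> L2\<close> expresses
  that the left-hand side of the inequality is finite, as an inequality between extended reals
  would imply.
\<close>

definition similar ::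
  "real \<Rightarrow> real \<Rightarrow> ('n1::finite, 'm::finite, 'q1::finite, 'p::finite) lti_system \<Rightarrow>
    ('n2::finite, 'm, 'q2::finite, 'p) lti_system \<Rightarrow> bool" where
  "similar \<gamma> \<delta> S1 S2 \<longleftrightarrow>
     (\<exists>\<epsilon>>0. \<exists>\<eta>>0. \<exists>\<mu>>0.
        \<forall>u1\<in>L2. \<forall>u2\<in>L2. \<forall>d1\<in>L2. \<exists>d2\<in>L2.
          let e = (\<lambda>t. output_at S1 0 0 u1 d1 t - output_at S2 0 0 u2 d2 t)
          in e \<in> L2 \<and>
             L2_norm_sq e \<le>
               \<gamma> * L2_norm_sq (\<lambda>t. u1 t - u2 t)
               + (\<delta> - \<epsilon>) * L2_norm_sq (\<lambda>t. stack (u1 t) (u2 t))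
               + (\<mu> - \<epsilon>) * L2_norm_sq d1
               - \<eta> * L2_norm_sq d2)"


section \<open>Data of the Riccati equation\<close>

definition joint_A ::
  "('n1::finite, 'm::finite, 'q1::finite, 'p::finite) lti_system \<Rightarrow>
    ('n2::finite, 'm, 'q2::finite, 'p) lti_system \<Rightarrow> real^('n1 + 'n2)^('n1 + 'n2)" where
  "joint_A S1 S2 = vcat (hcat (mat_A S1) 0)
                        (hcat 0 (mat_A S2))"

definition joint_B ::
  "('n1::finite, 'm::finite, 'q1::finite, 'p::finite) lti_system \<Rightarrow>
    ('n2::finite, 'm, 'q2::finite, 'p) lti_system \<Rightarrow> real^'q2^('n1 + 'n2)" where
  "joint_B S1 S2 = vcat 0
                        (mat_E S2)"

definition joint_E ::
  "('n1::finite, 'm::finite, 'q1::finite, 'p::finite) lti_system \<Rightarrow>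
    ('n2::finite, 'm, 'q2::finite, 'p) lti_system \<Rightarrow> real^('m + 'm + 'q1)^('n1 + 'n2)" where
  "joint_E S1 S2 = vcat (hcat (mat_B S1) (hcat 0 (mat_E S1)))
                        (hcat 0 (hcat (mat_B S2) 0))"

definition joint_C ::
  "('n1::finite, 'm::finite, 'q1::finite, 'p::finite) lti_system \<Rightarrow>
    ('n2::finite, 'm, 'q2::finite, 'p) lti_system \<Rightarrow> real^('n1 + 'n2)^('p + 'q2)" where
  "joint_C S1 S2 = vcat (hcat (mat_C S1) (- mat_C S2))
                        (hcat 0 0)"

text \<open>\<open>D\<close>, \<open>Q\<close> and \<open>R\<close> depend on the systems only through their dimensions; recall that
  \<^term>\<open>mat k\<close> is \<open>k\<close> times the identity.\<close>

definition joint_D :: "real^'q2^('p::finite + 'q2::finite)" where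
  "joint_D = vcat 0
                  (mat 1)"

definition weight_Q :: "real \<Rightarrow> real \<Rightarrow> real \<Rightarrow>
    real^('m::finite + 'm + 'q1::finite)^('m + 'm + 'q1)" where
  "weight_Q \<gamma> \<delta> \<mu> = vcat (hcat (mat (\<gamma> + \<delta>)) (hcat (mat (- \<gamma>)) 0))
                   (vcat (hcat (mat (- \<gamma>)) (hcat (mat (\<gamma> + \<delta>)) 0))
                         (hcat 0 (hcat 0 (mat \<mu>))))"

definition weight_R :: "real \<Rightarrow> real^('p::finite + 'q2::finite)^('p + 'q2)" where
  "weight_R \<eta> = vcat (hcat (mat 1) 0)
                     (hcat 0 (mat \<eta>))"

end

theory Submission
  imports Defs "HOL-Computational_Algebra.Fundamental_Theorem_Algebra"
begin

text \<open>
  With \<open>x = [x\<^sub>1; x\<^sub>2]\<close> and \<open>w = [u\<^sub>1; u\<^sub>2; d\<^sub>1]\<close>, similarity says that against every disturbance \<open>w\<close> there is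
  a control \<open>d = d\<^sub>2\<close> making the quadratic cost \<open>J(w,d) = \<integral> |Hx|\<^sup>2 + \<eta>|d|\<^sup>2 - w\<^sup>TQw\<close> of
  \<open>x' = Ax + Bd + Ew\<close>, \<open>x(0) = 0\<close>, at most \<open>- \<epsilon> \<integral> |w|\<^sup>2\<close>.

  If \<open>P\<close> is a stabilizing solution, completion of squares with the feedback
  \<open>d = - \<eta>\<inverse> B\<^sup>TPx\<close> leaves \<open>- \<integral> v\<^sup>TQv\<close> with \<open>v = w - Q\<inverse>E\<^sup>TPx\<close>; the closed loop driven by \<open>v\<close> is
  Hurwitz, so \<open>\<integral> |w|\<^sup>2\<close> is bounded by a multiple of \<open>\<integral> |v|\<^sup>2\<close>.

  Conversely, restrict the game to \<open>[0,T]\<close>. Its critical points are the solutions of the Hamiltonian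
  system in \<open>(x,p)\<close> with \<open>p(T) = 0\<close>. Playing the control supplied by the hypothesis against the critical
  disturbance shows that such a solution vanishes when \<open>x(0) = 0\<close>, hence \<open>p(0) = P\<^sub>T x(0)\<close> for a symmetric
  matrix \<open>P\<^sub>T\<close>, and that \<open>x(0)\<^sup>TP\<^sub>Tx(0)\<close> and the critical \<open>w\<close>, \<open>d\<close>, \<open>x\<close> are bounded uniformly in \<open>T\<close>. The value
  \<open>x(0)\<^sup>TP\<^sub>Tx(0)\<close> is nondecreasing in \<open>T\<close>, so \<open>P\<^sub>T\<close> converges to some \<open>P\<close>. Since \<open>p(t) = P\<^sub>T\<^sub>-\<^sub>t x(t)\<close>, the graph
  of \<open>P\<close> is invariant under the Hamiltonian flow, which is the Riccati equation, and the uniform bound on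
  \<open>x\<close> makes the closed loop square integrable, hence Hurwitz.
\<close>

text \<open>The hypothesis offers no saddle point: the answering control may anticipate the
  disturbance, and it is available from the initial state 0 only. Two facts replace a minimax
  argument. If two processes start in the same state and face the same disturbance, the second-order
  term of the cost has no negative part; so a critical control is optimal against its own critical
  disturbance. And any other initial state \<open>x\<close> is reached by adding a free response
  \<open>mexp A t *v x\<close>, whose square integral is bounded independently of the horizon
  because \<open>A\<close> is Hurwitz; the margin \<epsilon> pays for the cross terms this creates.
  Existence for the boundary problem with \<open>x(0)\<close> and \<open>p(T) = 0\<close> prescribed
  follows from uniqueness by dimension, so the Riccati differential equation, whose solutions might
  blow up, is never integrated. Since inputs are merely locally square integrable, trajectories are
  absolutely continuous only, and every energy identity rests on a product rule for primitives of
  integrable functions.\<close>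

section \<open>Linear differential equations\<close>

text \<open>The exponential series applied to \<open>v\<close>, taken coordinate by coordinate so
  that termwise differentiation of real power series applies.\<close>

lemma linear_ode_exists:
  fixes L :: "'a::euclidean_space \<Rightarrow> 'a" and v :: 'a
  assumes "linear L"
  shows "\<exists>y. y 0 = v \<and> (\<forall>t::real. (y has_vector_derivative L (y t)) (at t))"
proof -
  define c where "c b k = ((L ^^ k) v \<bullet> b) / fact k" for b :: 'a and k
  define y where "y t = (\<Sum>b\<in>Basis. (\<Sum>k. c b k * t ^ k) *\<^sub>R b)" for t
  obtain K where K: "K > 0" "\<And>x. norm (L x) \<le> norm x * K"
    using bounded_linear.pos_bounded[of L] assms linear_conv_bounded_linear by blast
  have pw: "norm ((L ^^ k) v) \<le> norm v * K ^ k" for k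
  proof (induction k)
    case (Suc k)
    have "norm ((L ^^ Suc k) v) \<le> norm ((L ^^ k) v) * K" using K(2) by simp
    also have "\<dots> \<le> norm v * K ^ k * K" using Suc K(1) by (simp add: mult_right_mono)
    finally show ?case by (simp add: mult_ac)
  qed simp
  have sm: "summable (\<lambda>k. c b k * t ^ k)" if "b \<in> Basis" for b t
  proof (rule summable_comparison_test')
    show "summable (\<lambda>k. norm v * (inverse (fact k) * (K * \<bar>t\<bar>) ^ k))"
      by (intro summable_mult summable_exp)
    show "norm (c b k * t ^ k) \<le> norm v * (inverse (fact k) * (K * \<bar>t\<bar>) ^ k)" for k
    proof -
      have "\<bar>(L ^^ k) v \<bullet> b\<bar> \<le> norm v * K ^ k"
        using Basis_le_norm[OF that, of "(L ^^ k) v"] pw[of k] by linarith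
      then have "\<bar>(L ^^ k) v \<bullet> b\<bar> * (\<bar>t\<bar> ^ k / fact k) \<le> norm v * K ^ k * (\<bar>t\<bar> ^ k / fact k)"
        by (rule mult_right_mono) simp
      then show ?thesis
        by (simp add: c_def abs_mult power_abs power_mult_distrib field_simps)
    qed
  qed
  have der: "((\<lambda>t. \<Sum>k. c b k * t ^ k) has_real_derivative (\<Sum>k. diffs (c b) k * t ^ k)) (at t)"
    if "b \<in> Basis" for b t
    by (rule termdiffs_strong_converges_everywhere) (rule sm[OF that])
  have dc: "diffs (c b) k = (\<Sum>b'\<in>Basis. c b' k * (L b' \<bullet> b))" for b k
  proof -
    have "L ((L ^^ k) v) = (\<Sum>b'\<in>Basis. ((L ^^ k) v \<bullet> b') *\<^sub>R L b')"
      using euclidean_representation[of "(L ^^ k) v"] assms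
      by (metis (no_types, lifting) linear_sum linear_cmul sum.cong)
    then have "L ((L ^^ k) v) \<bullet> b = (\<Sum>b'\<in>Basis. ((L ^^ k) v \<bullet> b') * (L b' \<bullet> b))"
      by (simp add: inner_sum_left)
    moreover have "diffs (c b) k = (L ((L ^^ k) v) \<bullet> b) / fact k"
      by (simp add: diffs_def c_def del: of_nat_Suc)
    ultimately show ?thesis by (simp add: c_def sum_divide_distrib)
  qed
  have eq: "(\<Sum>b\<in>Basis. (\<Sum>k. diffs (c b) k * t ^ k) *\<^sub>R b) = L (y t)" for t
  proof (rule euclidean_eqI)
    fix b :: 'a assume b: "b \<in> Basis"
    have "(\<Sum>b'\<in>Basis. (\<Sum>k. diffs (c b') k * t ^ k) *\<^sub>R b') \<bullet> b = (\<Sum>k. diffs (c b) k * t ^ k)"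
      using b by (simp add: inner_sum_left inner_Basis if_distrib cong: if_cong)
    also have "\<dots> = (\<Sum>k. \<Sum>b'\<in>Basis. (c b' k * t ^ k) * (L b' \<bullet> b))"
      by (simp add: dc sum_distrib_left sum_distrib_right mult_ac)
    also have "\<dots> = (\<Sum>b'\<in>Basis. \<Sum>k. (c b' k * t ^ k) * (L b' \<bullet> b))"
      by (rule suminf_sum) (intro summable_mult2 sm)
    also have "\<dots> = (\<Sum>b'\<in>Basis. (\<Sum>k. c b' k * t ^ k) * (L b' \<bullet> b))"
      by (rule sum.cong) (simp_all add: suminf_mult2[OF sm])
    also have "\<dots> = L (y t) \<bullet> b"
      using assms by (simp add: y_def linear_sum linear_cmul inner_sum_left)
    finally show "(\<Sum>b'\<in>Basis. (\<Sum>k. diffs (c b') k * t ^ k) *\<^sub>R b') \<bullet> b = L (y t) \<bullet> b" .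
  qed
  have "(y has_vector_derivative L (y t)) (at t)" for t
    unfolding y_def[abs_def]
    apply (subst eq[unfolded y_def, symmetric])
    apply (rule has_vector_derivative_sum)
    using der by (auto intro!: has_vector_derivative_scaleR derivative_eq_intros
        simp: has_real_derivative_iff_has_vector_derivative[symmetric])
  moreover have "y 0 = v"
    unfolding y_def by (simp only: powser_zero) (simp add: c_def euclidean_representation)
  ultimately show ?thesis by blast
qed

text \<open>Gronwall: \<open>exp (- (2 * K * t)) * (y t \<bullet> y t)\<close> cannot increase when
  \<open>K\<close> bounds \<open>L\<close>. Derivatives are taken within the interval, so that
  solutions known only on \<open>{0..T}\<close>, such as indefinite integrals, are covered.\<close>

lemma linear_ode_unique_right:
  fixes L :: "'a::euclidean_space \<Rightarrow> 'a"
  assumes "linear L" and "0 \<le> T"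
    and "\<And>t. t \<in> {0..T} \<Longrightarrow> (y has_vector_derivative L (y t)) (at t within {0..T})"
    and "y 0 = 0"
  shows "y T = 0"
proof -
  obtain K where K: "K > 0" "\<And>x. norm (L x) \<le> norm x * K"
    using bounded_linear.pos_bounded[of L] assms linear_conv_bounded_linear by blast
  define q where "q t = exp (- (2 * K * t)) * (y t \<bullet> y t)" for t
  have "q T \<le> q 0"
  proof (rule DERIV_nonpos_imp_decreasing_open[OF assms(2)])
    fix t assume t: "0 < t" "t < T"
    have "(y has_vector_derivative L (y t)) (at t)"
      using assms(3)[of t] t at_within_Icc_at[of 0 t T] by simp
    then have "(q has_real_derivative
        exp (- (2 * K * t)) * (2 * (y t \<bullet> L (y t)) - 2 * K * (y t \<bullet> y t))) (at t)"
      unfolding q_def[abs_def] has_vector_derivative_def has_field_derivative_def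
      by (auto intro!: derivative_eq_intros simp: fun_eq_iff algebra_simps inner_commute)
    moreover have "y t \<bullet> L (y t) \<le> K * (y t \<bullet> y t)"
    proof -
      have "y t \<bullet> L (y t) \<le> norm (y t) * norm (L (y t))" by (rule norm_cauchy_schwarz)
      also have "\<dots> \<le> norm (y t) * (norm (y t) * K)" using K by (simp add: mult_left_mono)
      finally show ?thesis by (simp add: dot_square_norm power2_eq_square mult_ac)
    qed
    moreover from this have "exp (- (2 * K * t)) * (2 * (y t \<bullet> L (y t)) - 2 * K * (y t \<bullet> y t)) \<le> 0"
      by (intro mult_nonneg_nonpos) auto
    ultimately show "\<exists>z. DERIV q t :> z \<and> z \<le> 0" by blast
  next
    have "continuous_on {0..T} y"
      using assms(3) has_vector_derivative_continuous by (fastforce simp: continuous_on_eq_continuous_within)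
    then show "continuous_on {0..T} q" unfolding q_def[abs_def] by (intro continuous_intros)
  qed
  then have "y T \<bullet> y T \<le> 0" using assms(4) by (simp add: q_def mult_le_0_iff)
  then have "y T \<bullet> y T = 0" using inner_ge_zero[of "y T"] by linarith
  then show ?thesis by simp
qed

lemma has_vector_derivative_shift:
  assumes "(y has_vector_derivative d) (at (s + r))"
  shows "((\<lambda>r::real. y (s + r)) has_vector_derivative d) (at r)"
proof -
  have "((\<lambda>r. s + r) has_vector_derivative 1) (at r)"
    unfolding has_real_derivative_iff_has_vector_derivative[symmetric]
    by (auto intro!: derivative_eq_intros)
  from vector_diff_chain_at[OF this assms] show ?thesis by (simp add: o_def)
qed

lemma has_vector_derivative_reflect:
  assumes "(y has_vector_derivative d) (at (s - r))"
  shows "((\<lambda>r::real. y (s - r)) has_vector_derivative - d) (at r)"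
proof -
  have "((\<lambda>r. s - r) has_vector_derivative -1) (at r)"
    unfolding has_real_derivative_iff_has_vector_derivative[symmetric]
    by (auto intro!: derivative_eq_intros)
  from vector_diff_chain_at[OF this assms] show ?thesis by (simp add: o_def)
qed

lemma linear_ode_unique:
  fixes L :: "'a::euclidean_space \<Rightarrow> 'a"
  assumes L: "linear L"
    and y: "\<And>t::real. (y has_vector_derivative L (y t)) (at t)"
    and z: "\<And>t. (z has_vector_derivative L (z t)) (at t)"
    and "y s = z s"
  shows "y t = z t"
proof (cases "s \<le> t")
  case True
  have "y (s + (t - s)) - z (s + (t - s)) = 0"
  proof (rule linear_ode_unique_right[OF L, where y = "\<lambda>r. y (s + r) - z (s + r)"])
    fix r
    have "((\<lambda>r. y (s + r)) has_vector_derivative L (y (s + r))) (at r)"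
      by (rule has_vector_derivative_shift[OF y])
    moreover have "((\<lambda>r. z (s + r)) has_vector_derivative L (z (s + r))) (at r)"
      by (rule has_vector_derivative_shift[OF z])
    ultimately show "((\<lambda>r. y (s + r) - z (s + r)) has_vector_derivative L (y (s + r) - z (s + r)))
        (at r within {0..t - s})"
      unfolding linear_diff[OF L] by (rule has_vector_derivative_at_within[OF has_vector_derivative_diff])
  qed (use True assms in auto)
  then show ?thesis by simp
next
  case False
  \<comment> \<open>Times before \<open>s\<close> are reached by reversing time, which replaces
    \<open>L\<close> by its negative.\<close>
  have L': "linear (\<lambda>v. - L v)" using L by (rule linear_compose_neg)
  have "y (s - (s - t)) - z (s - (s - t)) = 0"
  proof (rule linear_ode_unique_right[OF L', where y = "\<lambda>r. y (s - r) - z (s - r)"])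
    fix r
    have "((\<lambda>r. y (s - r) - z (s - r)) has_vector_derivative - L (y (s - r)) - - L (z (s - r))) (at r)"
      by (intro has_vector_derivative_diff has_vector_derivative_reflect y z)
    then show "((\<lambda>r. y (s - r) - z (s - r)) has_vector_derivative - L (y (s - r) - z (s - r)))
        (at r within {0..s - t})"
      by (simp add: linear_diff[OF L] has_vector_derivative_at_within)
  qed (use False assms in auto)
  then show ?thesis by simp
qed

text \<open>Kept on an arbitrary Euclidean space because it serves for matrices
  (\<open>mexp\<close>), for vectors and for pairs of state and costate
  (\<open>Ham\<close>).\<close>

definition flow :: "('a::euclidean_space \<Rightarrow> 'a) \<Rightarrow> 'a \<Rightarrow> real \<Rightarrow> 'a" where
  "flow L v = (SOME y. y 0 = v \<and> (\<forall>t. (y has_vector_derivative L (y t)) (at t)))"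

context
  fixes L :: "'a::euclidean_space \<Rightarrow> 'a"
  assumes L: "linear L"
begin

lemma flow_0: "flow L v 0 = v"
  and flow_deriv: "(flow L v has_vector_derivative L (flow L v t)) (at t)"
  using someI_ex[OF linear_ode_exists[OF L, of v]] by (auto simp: flow_def)

lemma flow_unique:
  assumes "\<And>t::real. (y has_vector_derivative L (y t)) (at t)"
  shows "y t = flow L (y 0) t"
  by (rule linear_ode_unique[OF L assms flow_deriv, where s = 0]) (simp_all add: flow_0)

lemma flow_linear: "linear (\<lambda>v. flow L v t)"
proof
  show "flow L (u + v) t = flow L u t + flow L v t" for u v
  proof (rule linear_ode_unique[OF L flow_deriv, where s = 0 and z = "\<lambda>t. flow L u t + flow L v t"])
    show "((\<lambda>t. flow L u t + flow L v t) has_vector_derivative L (flow L u t + flow L v t)) (at t)" for t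
      unfolding linear_add[OF L] by (intro has_vector_derivative_add flow_deriv)
  qed (simp add: flow_0)
  show "flow L (r *\<^sub>R v) t = r *\<^sub>R flow L v t" for r v
  proof (rule linear_ode_unique[OF L flow_deriv, where s = 0 and z = "\<lambda>t. r *\<^sub>R flow L v t"])
    show "((\<lambda>t. r *\<^sub>R flow L v t) has_vector_derivative L (r *\<^sub>R flow L v t)) (at t)" for t
      unfolding linear_cmul[OF L]
      by (rule bounded_linear.has_vector_derivative[OF bounded_linear_scaleR_right flow_deriv])
  qed (simp add: flow_0)
qed

lemma flow_flow: "flow L (flow L v s) t = flow L v (s + t)"
proof -
  have "((\<lambda>r. flow L v (s + r)) has_vector_derivative L (flow L v (s + r))) (at r)" for r
    by (rule has_vector_derivative_shift[OF flow_deriv])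
  from linear_ode_unique[OF L flow_deriv this, of "flow L v s" 0] show ?thesis
    by (simp add: flow_0)
qed

lemma flow_continuous_on: "continuous_on S (flow L v)"
  by (intro continuous_at_imp_continuous_on ballI has_vector_derivative_continuous[OF flow_deriv])

end

section \<open>The matrix exponential and variation of constants\<close>

lemma linear_matrix_mult_left: "linear (\<lambda>X. M ** X)" for M :: "real^'n^'m"
  by (intro linearI)
     (simp_all add: matrix_matrix_mult_def vec_eq_iff sum_distrib_left sum.distrib algebra_simps)

lemma bounded_bilinear_matrix_vector_mult:
  "bounded_bilinear ((*v) :: real^'n^'m \<Rightarrow> real^'n \<Rightarrow> real^'m)"
  by (rule bilinear_conv_bounded_bilinear[THEN iffD1])
     (auto simp: bilinear_def intro!: linearI matrix_vector_mult_add_rdistrib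
        matrix_vector_right_distrib scaleR_matrix_vector_assoc[symmetric] matrix_vector_mult_scaleR)

definition mexp :: "real^'n^'n \<Rightarrow> real \<Rightarrow> real^'n^'n" where
  "mexp M = flow (\<lambda>X. M ** X) (mat 1)"

lemma mexp_deriv: "(mexp M has_vector_derivative M ** mexp M t) (at t)"
  unfolding mexp_def by (rule flow_deriv[OF linear_matrix_mult_left])

lemma mexp_0: "mexp M 0 = mat 1"
  unfolding mexp_def by (rule flow_0[OF linear_matrix_mult_left])

lemma mexp_apply_deriv: "((\<lambda>t. mexp M t *v v) has_vector_derivative M *v (mexp M t *v v)) (at t)"
proof -
  have "bounded_linear (\<lambda>X. X *v v)"
    by (rule bounded_bilinear.bounded_linear_left[OF bounded_bilinear_matrix_vector_mult])
  from bounded_linear.has_vector_derivative[OF this mexp_deriv, of M t] show ?thesis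
    by (simp add: matrix_vector_mul_assoc)
qed

lemma mexp_continuous_on: "continuous_on S (mexp M)"
  unfolding mexp_def by (rule flow_continuous_on[OF linear_matrix_mult_left])

lemma flow_eq_mexp: "flow ((*v) M) v t = mexp M t *v v"
  using flow_unique[OF matrix_vector_mul_linear, where y = "\<lambda>t. mexp M t *v v" and t = t,
      OF mexp_apply_deriv] by (simp add: mexp_0)

lemma mexp_minus: "mexp M t *v (mexp M (- t) *v v) = v"
  unfolding flow_eq_mexp[symmetric] flow_flow[OF matrix_vector_mul_linear]
  by (simp add: flow_0[OF matrix_vector_mul_linear])

text \<open>Variation of constants. The forcing is continuous here, so the equation holds at every
  point; integrable forcing is reduced to this case in
  \<open>linear_ode_primitive_exists\<close>.\<close>

lemma forced_ode_exists:
  fixes M :: "real^'n^'n" and F :: "real \<Rightarrow> real^'n"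
  assumes F: "\<And>T. continuous_on {0..T} F"
  obtains z where "z 0 = 0"
    "\<And>t T. t \<in> {0..T} \<Longrightarrow> (z has_vector_derivative M *v z t + F t) (at t within {0..T})"
proof -
  define g where "g s = mexp M (- s) *v F s" for s
  define z where "z t = mexp M t *v integral {0..t} g" for t
  have g: "continuous_on {0..T} g" for T
  proof -
    have "continuous_on {0..T} (\<lambda>s. mexp M (- s))"
      by (rule continuous_on_compose2[OF mexp_continuous_on[of UNIV]]) (auto intro!: continuous_intros)
    then show ?thesis unfolding g_def[abs_def]
      by (intro bounded_bilinear.continuous_on[OF bounded_bilinear_matrix_vector_mult] F)
  qed
  have "(z has_vector_derivative M *v z t + F t) (at t within {0..T})" if t: "t \<in> {0..T}" for t T
  proof -
    have "(z has_vector_derivative mexp M t *v g t + (M ** mexp M t) *v integral {0..t} g) (at t within {0..T})"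
      unfolding z_def[abs_def]
      by (intro bounded_bilinear.has_vector_derivative[OF bounded_bilinear_matrix_vector_mult]
          has_vector_derivative_at_within[OF mexp_deriv] integral_has_vector_derivative g t)
    moreover have "mexp M t *v g t = F t" by (simp add: g_def mexp_minus)
    moreover have "(M ** mexp M t) *v integral {0..t} g = M *v z t"
      by (simp add: z_def matrix_vector_mul_assoc)
    ultimately show ?thesis by (simp add: add.commute)
  qed
  moreover have "z 0 = 0" by (simp add: z_def)
  ultimately show ?thesis using that by blast
qed

section \<open>Hurwitz matrices\<close>

text \<open>The powers of \<open>M\<close> lie in a finite-dimensional space, so they are linearly
  dependent. Any annihilating polynomial will do for the decay estimate; neither minimality nor the
  characteristic polynomial matters.\<close>

lemma matrix_annihilating_poly:
  fixes M :: "real^'n^'n"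
  shows "\<exists>p :: real poly. p \<noteq> 0 \<and> (\<Sum>i\<le>degree p. coeff p i *\<^sub>R ((\<lambda>X. M ** X) ^^ i) (mat 1)) = 0"
proof -
  define f where "f i = ((\<lambda>X. M ** X) ^^ i) (mat 1)" for i
  have "\<exists>c N. (\<exists>i\<le>N. c i \<noteq> (0::real)) \<and> (\<Sum>i\<le>N. c i *\<^sub>R f i) = 0"
  \<comment> \<open>Linear dependence is a property of sets, in which coinciding powers would be
    counted once; two equal powers give the relation directly.\<close>
  proof (cases "inj f")
    case True
    then have "infinite (range f)" by (simp add: finite_image_iff)
    then have "dependent (range f)" using independent_imp_finite by blast
    then obtain S u where S: "finite S" "S \<subseteq> range f" "\<exists>v\<in>S. u v \<noteq> 0" "(\<Sum>v\<in>S. u v *\<^sub>R v) = 0"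
      unfolding dependent_explicit by blast
    obtain I where I: "finite I" "S = f ` I"
      using finite_subset_image[OF S(1,2)] by blast
    define N where "N = Max I"
    have IN: "I \<subseteq> {..N}" using I unfolding N_def by auto
    define c where "c i = (if i \<in> I then u (f i) else 0)" for i
    have "(\<Sum>i\<le>N. c i *\<^sub>R f i) = (\<Sum>i\<in>I. u (f i) *\<^sub>R f i)"
      using IN by (intro sum.mono_neutral_cong_right) (auto simp: c_def)
    also have "\<dots> = (\<Sum>v\<in>S. u v *\<^sub>R v)"
      unfolding I(2) using True by (subst sum.reindex) (auto simp: inj_on_def inj_def)
    finally have "(\<Sum>i\<le>N. c i *\<^sub>R f i) = 0" using S by simp
    moreover have "\<exists>i\<le>N. c i \<noteq> 0" using S(3) I IN unfolding c_def by fastforce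
    ultimately show ?thesis by blast
  next
    case False
    then obtain i j where ij: "f i = f j" "i \<noteq> j" unfolding inj_def by blast
    define c where "c k = (if k = i then 1 else if k = j then -1 else (0::real))" for k
    have "(\<Sum>k\<le>max i j. c k *\<^sub>R f k) = (\<Sum>k\<in>{i, j}. c k *\<^sub>R f k)"
      by (intro sum.mono_neutral_right) (auto simp: c_def)
    also have "\<dots> = 0" using ij by (simp add: c_def)
    finally have "(\<Sum>k\<le>max i j. c k *\<^sub>R f k) = 0" .
    moreover have "c i \<noteq> 0" "i \<le> max i j" by (auto simp: c_def)
    ultimately show ?thesis by blast
  qed
  then obtain c N i where c: "i \<le> N" "c i \<noteq> (0::real)" "(\<Sum>i\<le>N. c i *\<^sub>R f i) = 0" by blast
  define p where "p = Abs_poly (\<lambda>i. if i \<le> N then c i else 0)"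
  have cp: "coeff p i = (if i \<le> N then c i else 0)" for i
    unfolding p_def coeff_Abs_poly_If_le ..
  have dp: "degree p \<le> N" by (rule degree_le) (simp add: cp)
  have "(\<Sum>i\<le>degree p. coeff p i *\<^sub>R f i) = (\<Sum>i\<le>N. c i *\<^sub>R f i)"
  proof (rule sum.mono_neutral_cong_left)
    show "\<forall>i\<in>{..N} - {..degree p}. c i *\<^sub>R f i = 0"
    proof
      fix i assume i: "i \<in> {..N} - {..degree p}"
      then have "coeff p i = 0" by (intro coeff_eq_0) auto
      then show "c i *\<^sub>R f i = 0" using i cp[of i] by simp
    qed
  qed (use dp in \<open>auto simp: cp\<close>)
  moreover have "p \<noteq> 0" using cp[of i] c by auto
  ultimately show ?thesis using c(3) unfolding f_def[symmetric] by (intro exI[of _ p]) simp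
qed

lemma linear_vec_smult: "linear (\<lambda>v. c *s v)" for c :: complex and v :: "complex^'n"
  by (intro linearI) (simp_all add: vector_add_ldistrib vec_eq_iff)

lemma linear_cmatrix_vector_mult: "linear ((*v) M)" for M :: "complex^'n^'m"
  by (intro linearI) (simp_all add: vec_eq_iff matrix_vector_mult_def
      scaleR_sum_right sum.distrib distrib_left)

text \<open>The roots of \<open>p\<close> in the closed right half plane are harmless because \<open>M - \<lambda>\<close> is then injective.\<close>

lemma Hurwitz_killed_solution_decays:
  fixes M :: "real^'n^'n" and y :: "real \<Rightarrow> complex^'n" and p :: "complex poly"
  defines "L \<equiv> (*v) (map_matrix complex_of_real M)"
  assumes "Hurwitz M" "p \<noteq> 0"
    and "\<And>t. (y has_vector_derivative L (y t)) (at t)"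
    and "\<And>t. (\<Sum>i\<le>degree p. coeff p i *s (L ^^ i) (y t)) = 0"
  shows "\<exists>K a. a > 0 \<and> (\<forall>t\<ge>0. norm (y t) \<le> K * exp (- (a * t)))"
  using assms(3-)
proof (induction "degree p" arbitrary: p y)
  case 0
  then have "coeff p 0 \<noteq> 0" by (metis leading_coeff_0_iff)
  then have "y t = 0" for t using 0(4)[of t] 0(1) by (simp add: vec_eq_iff)
  then show ?case by (intro exI[of _ 0] exI[of _ 1]) auto
next
  case (Suc n)
  have linL: "linear L" unfolding L_def by (rule linear_cmatrix_vector_mult)
  have linLi: "linear (L ^^ i)" for i
  proof (induction i)
    case 0 show ?case by (simp add: linear_ident id_def)
  next
    case (Suc i)
    show ?case using linear_compose[OF Suc linL] by (simp add: o_def)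
  qed
  have Ls: "L (c *s v) = c *s L v" for c v
    by (simp add: L_def vec_eq_iff matrix_vector_mult_def sum_distrib_left mult_ac)
  have Lis: "(L ^^ i) (c *s v) = c *s (L ^^ i) v" for i c v
    by (induction i) (simp_all add: Ls)
  obtain z where z: "poly p z = 0"
    using fundamental_theorem_of_algebra[of p] Suc(2) constant_degree by (metis nat.distinct(1))
  then obtain q where q: "p = [:-z, 1:] * q" by (auto simp: poly_eq_0_iff_dvd elim: dvdE)
  have q0: "q \<noteq> 0" using Suc(3) q by auto
  have dq: "degree q = n" using Suc(2) q0 unfolding q by (subst (asm) degree_mult_eq) auto
  have c0: "coeff p 0 = - z * coeff q 0" and cS: "coeff p (Suc i) = coeff q i - z * coeff q (Suc i)" for i
    unfolding q by simp_all
  \<comment> \<open>Splitting off the factor \<open>[:-z, 1:]\<close> of \<open>p\<close>: the new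
    solution \<open>u\<close> is killed by the quotient \<open>q\<close>, so the induction
    hypothesis bounds it, and \<open>y\<close> solves the scalar-type equation
    \<open>y' = z y + u\<close>.\<close>
  define u where "u t = L (y t) - z *s y t" for t
  have du: "(u has_vector_derivative L (u t)) (at t)" for t
  proof -
    have "((\<lambda>t. L (y t)) has_vector_derivative L (L (y t))) (at t)"
      by (rule bounded_linear.has_vector_derivative[OF linL[unfolded linear_conv_bounded_linear] Suc(4)])
    moreover have "((\<lambda>t. z *s y t) has_vector_derivative z *s L (y t)) (at t)"
      by (rule bounded_linear.has_vector_derivative[OF
            linear_vec_smult[unfolded linear_conv_bounded_linear] Suc(4)])
    ultimately have "(u has_vector_derivative L (L (y t)) - z *s L (y t)) (at t)"
      unfolding u_def[abs_def] by (rule has_vector_derivative_diff)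
    then show ?thesis by (simp add: u_def linear_diff[OF linL] Ls)
  qed
  have "(\<Sum>i\<le>degree q. coeff q i *s (L ^^ i) (u t)) = 0" for t
  proof -
    let ?v = "y t"
    have qN: "coeff q (Suc n) = 0" using dq by (simp add: coeff_eq_0)
    have "(\<Sum>i\<le>Suc n. coeff p i *s (L ^^ i) ?v)
        = coeff p 0 *s ?v + (\<Sum>i\<le>n. coeff p (Suc i) *s (L ^^ Suc i) ?v)"
      by (subst sum.atMost_Suc_shift) simp
    also have "\<dots> = (\<Sum>i\<le>n. coeff q i *s (L ^^ Suc i) ?v)
        - z *s (coeff q 0 *s ?v + (\<Sum>i\<le>n. coeff q (Suc i) *s (L ^^ Suc i) ?v))"
      by (simp add: c0 cS vec_eq_iff sum_subtractf sum_distrib_left algebra_simps)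
    also have "coeff q 0 *s ?v + (\<Sum>i\<le>n. coeff q (Suc i) *s (L ^^ Suc i) ?v)
        = (\<Sum>i\<le>Suc n. coeff q i *s (L ^^ i) ?v)"
      by (subst sum.atMost_Suc_shift) simp
    also have "\<dots> = (\<Sum>i\<le>n. coeff q i *s (L ^^ i) ?v)" by (simp add: qN)
    also have "(\<Sum>i\<le>n. coeff q i *s (L ^^ Suc i) ?v) - z *s (\<Sum>i\<le>n. coeff q i *s (L ^^ i) ?v)
        = (\<Sum>i\<le>n. coeff q i *s (L ^^ i) (u t))"
      by (simp add: u_def linear_diff[OF linLi] Lis funpow_swap1 vec_eq_iff sum_subtractf
          sum_distrib_left algebra_simps)
    finally show ?thesis using Suc(5)[of t] Suc(2) dq by simp
  qed
  from Suc(1)[OF dq[symmetric] q0 du this] obtain K a where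
    Ka: "a > 0" "\<And>t. t \<ge> 0 \<Longrightarrow> norm (u t) \<le> K * exp (- (a * t))" by blast
  have K0: "K \<ge> 0" using order_trans[OF norm_ge_zero Ka(2)[of 0]] by simp
  show ?case
  proof (cases "Re z < 0")
    case False
    then have "z \<notin> spec M" using assms(2) unfolding Hurwitz_def open_left_half_plane_def by auto
    then have inj: "v = 0" if "L v - z *s v = 0" for v
      using that unfolding spec_def L_def by auto
    have lin: "linear (\<lambda>v. L v - z *s v)"
      using linear_compose_sub[OF linL linear_vec_smult] by simp
    then have "inj (\<lambda>v. L v - z *s v)" using inj linear_injective_0 by blast
    from linear_inj_bounded_below_pos[OF lin this] obtain k where
      k: "k > 0" "\<And>v. k * norm v \<le> norm (L v - z *s v)" by blast
    have "norm (y t) \<le> K / k * exp (- (a * t))" if "t \<ge> 0" for t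
      using k(1) k(2)[of "y t"] Ka(2)[OF that] by (simp add: u_def field_simps)
    then show ?thesis using Ka(1) by blast
  next
    case True
    \<comment> \<open>A rate strictly below \<open>- Re z\<close> keeps \<open>e\<close> positive
      even in the resonant case \<open>a = - Re z\<close>, where the true solution has a polynomial
      factor. After removing the homogeneous part, the derivative of \<open>w\<close> is at most
      \<open>K * exp (e * s)\<close>, whose primitive is explicit.\<close>
    define b where "b = min a (- Re z / 2)"
    define e where "e = - Re z - b"
    have b: "b > 0" "b \<le> a" "e > 0" using Ka(1) True by (auto simp: b_def e_def min_def)
    define w where "w t = exp (- (z * of_real t)) *s y t" for t
    have dw: "(w has_vector_derivative exp (- (z * of_real t)) *s u t) (at t)" for t
    proof -
      have bb: "bounded_bilinear (\<lambda>c (v :: complex^'n). c *s v)"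
      proof (rule bilinear_conv_bounded_bilinear[THEN iffD1])
        show "bilinear (\<lambda>c (v :: complex^'n). c *s v)"
          unfolding bilinear_def
          by (auto intro!: linearI simp: vec_eq_iff algebra_simps)
      qed
      have "((\<lambda>t. exp (- (z * of_real t))) has_vector_derivative - z * exp (- (z * of_real t))) (at t)"
        by (auto intro!: derivative_eq_intros has_vector_derivative_real_field)
      from bounded_bilinear.has_vector_derivative[OF bb this Suc(4)[of t]]
      have "(w has_vector_derivative exp (- (z * of_real t)) *s L (y t)
          + (- z * exp (- (z * of_real t))) *s y t) (at t)" unfolding w_def[abs_def] .
      then show ?thesis by (simp add: u_def vec_eq_iff algebra_simps)
    qed
    have ns: "norm (c *s v) = norm c * norm v" for c and v :: "complex^'n"
      by (simp add: norm_vec_def L2_set_def norm_mult power_mult_distrib sum_distrib_left[symmetric]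
          real_sqrt_mult)
    have bound: "norm (w t - w 0) \<le> K / e * exp (e * t) - K / e * exp (e * 0)" if "t > 0" for t
    proof (rule differentiable_bound_general[OF that])
      show "continuous_on {0..t} w"
        by (intro continuous_at_imp_continuous_on ballI has_vector_derivative_continuous[OF dw])
      show "continuous_on {0..t} (\<lambda>t. K / e * exp (e * t))" by (intro continuous_intros)
      fix s assume s: "0 < s" "s < t"
      show "(w has_vector_derivative exp (- (z * of_real s)) *s u s) (at s)" by (rule dw)
      show "((\<lambda>t. K / e * exp (e * t)) has_vector_derivative K * exp (e * s)) (at s)"
        using b(3) unfolding has_real_derivative_iff_has_vector_derivative[symmetric]
        by (auto intro!: derivative_eq_intros)
      have "norm (exp (- (z * of_real s)) *s u s) \<le> exp (- (Re z * s)) * (K * exp (- (a * s)))"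
        unfolding ns using Ka(2)[of s] s by (simp add: norm_exp_eq_Re mult_left_mono)
      also have "\<dots> = K * exp (- Re z * s - a * s)" by (simp add: exp_diff exp_minus field_simps)
      also have "\<dots> \<le> K * exp (e * s)"
        using b s K0 by (intro mult_left_mono) (auto simp: e_def algebra_simps)
      finally show "norm (exp (- (z * of_real s)) *s u s) \<le> K * exp (e * s)" .
    qed
    have "norm (y t) \<le> (norm (y 0) + K / e) * exp (- (b * t))" if "t \<ge> 0" for t
    proof -
      have "norm (w t) \<le> norm (w 0) + K / e * exp (e * t)"
      proof (cases "t = 0")
        case False
        have "K / e * exp (e * 0) \<ge> 0" using K0 b by simp
        then show ?thesis using bound[of t] that False norm_triangle_ineq2[of "w t" "w 0"] by linarith
      qed (use K0 b in auto)
      moreover have "y t = exp (z * of_real t) *s w t"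
        by (simp add: w_def vec_eq_iff exp_minus)
      ultimately have "norm (y t) \<le> exp (Re z * t) * (norm (w 0) + K / e * exp (e * t))"
        by (simp add: ns norm_exp_eq_Re mult_left_mono)
      also have "\<dots> = norm (y 0) * exp (Re z * t) + K / e * exp (- (b * t))"
      proof -
        have "exp (Re z * t) * exp (e * t) = exp (- (b * t))"
          by (simp add: e_def algebra_simps flip: exp_add)
        moreover have "w 0 = y 0" by (simp add: w_def vec_eq_iff)
        ultimately show ?thesis by (simp add: algebra_simps)
      qed
      also have "\<dots> \<le> norm (y 0) * exp (- (b * t)) + K / e * exp (- (b * t))"
      proof -
        have "Re z * t \<le> - b * t" using b that unfolding e_def by (intro mult_right_mono) auto
        then show ?thesis by (simp add: mult_left_mono)
      qed
      finally show ?thesis by (simp add: algebra_simps)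
    qed
    then show ?thesis using b(1) by blast
  qed
qed


text \<open>The embedding of real into complex vectors preserves norms and intertwines
  \<open>M\<close> with its complexification. The image of the solution is killed by the
  annihilating polynomial of \<open>M\<close>, which has roots over the complex numbers.\<close>

lemma Hurwitz_mexp_decays:
  fixes M :: "real^'n^'n"
  assumes "Hurwitz M"
  shows "((\<lambda>t. mexp M t *v v) \<longlongrightarrow> 0) at_top"
proof -
  let ?c = "\<lambda>x :: real^'n. \<chi> i. complex_of_real (x $ i)"
  let ?L = "(*v) (map_matrix complex_of_real M)"
  have lc: "bounded_linear ?c"
    unfolding linear_conv_bounded_linear[symmetric]
    by (intro linearI) (simp_all add: vec_eq_iff complex_eq_iff)
  have Lc: "?L (?c x) = ?c (M *v x)" for x
    by (simp add: vec_eq_iff matrix_vector_mult_def map_matrix_def)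
  have nc: "norm (?c x) = norm x" for x by (simp add: norm_vec_def)
  obtain p :: "real poly" where p: "p \<noteq> 0"
    "(\<Sum>i\<le>degree p. coeff p i *\<^sub>R ((\<lambda>X. M ** X) ^^ i) (mat 1)) = 0"
    using matrix_annihilating_poly[of M] by blast
  define y where "y t = ?c (mexp M t *v v)" for t
  have Lci: "(?L ^^ i) (?c x) = ?c (((\<lambda>X. M ** X) ^^ i) (mat 1) *v x)" for i x
    by (induction i) (simp_all add: Lc matrix_vector_mul_assoc)
  have "(\<Sum>i\<le>degree p. coeff (map_poly complex_of_real p) i *s (?L ^^ i) (y t)) = 0" for t
  proof -
    have "(\<Sum>i\<le>degree p. coeff p i *\<^sub>R ((\<lambda>X. M ** X) ^^ i) (mat 1)) *v x
        = (\<Sum>i\<le>degree p. coeff p i *\<^sub>R (((\<lambda>X. M ** X) ^^ i) (mat 1) *v x))" for x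
      by (simp add: vec_eq_iff matrix_vector_mult_def sum_distrib_right sum_distrib_left mult_ac)
         (subst sum.swap, rule allI, simp)
    then have "?c (\<Sum>i\<le>degree p. coeff p i *\<^sub>R (((\<lambda>X. M ** X) ^^ i) (mat 1) *v x)) = 0" for x
      using p(2) by (simp add: vec_eq_iff)
    then show ?thesis
      unfolding y_def Lci by (simp add: vec_eq_iff coeff_map_poly)
  qed
  then have "\<exists>K a. a > 0 \<and> (\<forall>t\<ge>0. norm (y t) \<le> K * exp (- (a * t)))"
    using p(1) bounded_linear.has_vector_derivative[OF lc mexp_apply_deriv[of M v]]
    by (intro Hurwitz_killed_solution_decays[OF assms, of "map_poly complex_of_real p"])
       (auto simp: map_poly_eq_0_iff y_def[abs_def] Lc degree_map_poly)
  then obtain K a where Ka: "a > 0" "\<And>t. t \<ge> 0 \<Longrightarrow> norm (y t) \<le> K * exp (- (a * t))" by blast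
  show ?thesis
  proof (rule Lim_null_comparison)
    show "\<forall>\<^sub>F t in at_top. norm (mexp M t *v v) \<le> K * exp (- (a * t))"
      using eventually_ge_at_top[of 0] by eventually_elim (use Ka(2) in \<open>simp add: y_def nc\<close>)
    have "filterlim (\<lambda>t. a * t) at_top at_top"
      using Ka(1) by (intro filterlim_tendsto_pos_mult_at_top[OF tendsto_const] filterlim_ident) auto
    then have "((\<lambda>t. exp (- (a * t))) \<longlongrightarrow> 0) at_top"
      by (intro filterlim_compose[OF exp_at_bot] filterlim_compose[OF filterlim_uminus_at_bot_at_top])
    then show "((\<lambda>t. K * exp (- (a * t))) \<longlongrightarrow> 0) at_top"
      using tendsto_mult_right_zero by blast
  qed
qed

lemma mexp_commute: "mexp M t *v (M *v v) = M *v (mexp M t *v v)"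
proof -
  have "((\<lambda>t. M *v (mexp M t *v v)) has_vector_derivative M *v (M *v (mexp M t *v v))) (at t)" for t
    by (rule bounded_linear.has_vector_derivative[OF _ mexp_apply_deriv]) simp
  from flow_unique[OF matrix_vector_mul_linear, where y = "\<lambda>t. M *v (mexp M t *v v)" and t = t, OF this]
  show ?thesis by (simp add: flow_eq_mexp mexp_0)
qed

lemma dot_matrix_vector_transpose: "x \<bullet> (A *v y) = (transpose A *v x) \<bullet> y"
  for A :: "real^'n^'m"
  by (metis dot_lmul_matrix transpose_matrix_vector)

text \<open>It suffices to integrate up to a time at which \<open>exp (t M)\<close> has norm at most \<open>1 / sqrt 2\<close>.\<close>

lemma Hurwitz_lyapunov:
  fixes M :: "real^'n^'n"
  assumes "Hurwitz M"
  obtains X where "sym_pos_semidef X" "\<And>v. 2 * (v \<bullet> (X *v (M *v v))) \<le> - (v \<bullet> v)"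
proof -
  \<comment> \<open>Decay is known for each vector separately; summing over a basis yields one time
    \<open>T\<close> that contracts all vectors.\<close>
  have "((\<lambda>t. \<Sum>b\<in>Basis. norm (mexp M t *v b)) \<longlongrightarrow> (\<Sum>b\<in>(Basis :: (real^'n) set). 0)) at_top"
    by (intro tendsto_sum tendsto_norm_zero Hurwitz_mexp_decays[OF assms])
  then have "\<forall>\<^sub>F t in at_top. (\<Sum>b\<in>Basis. norm (mexp M t *v b)) < 1 / 2"
    by (rule order_tendstoD) simp
  from eventually_conj[OF this eventually_ge_at_top[of 0]]
  obtain T where T: "T \<ge> 0" "(\<Sum>b\<in>Basis. norm (mexp M T *v b)) < 1 / 2"
    using eventually_happens'[OF trivial_limit_at_top_linorder] by blast
  have small: "(norm (mexp M T *v v))\<^sup>2 \<le> (norm v)\<^sup>2 / 2" for v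
  proof -
    have "mexp M T *v v = (\<Sum>b\<in>Basis. (v \<bullet> b) *\<^sub>R (mexp M T *v b))"
      using euclidean_representation[of v]
      by (metis (no_types, lifting) linear_sum linear_cmul matrix_vector_mul_linear sum.cong)
    also have "norm \<dots> \<le> (\<Sum>b\<in>Basis. norm v * norm (mexp M T *v b))"
      by (intro sum_norm_le) (auto intro!: mult_right_mono Basis_le_norm)
    also have "\<dots> \<le> norm v * (1 / 2)"
      unfolding sum_distrib_left[symmetric] using T by (intro mult_left_mono) auto
    finally have "(norm (mexp M T *v v))\<^sup>2 \<le> (norm v * (1 / 2))\<^sup>2" by (intro power_mono) auto
    also have "\<dots> \<le> (norm v)\<^sup>2 / 2" by (simp add: power2_eq_square)
    finally show ?thesis .
  qed
  define g where "g t = transpose (mexp M t) ** mexp M t" for t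
  have ct: "continuous_on S (\<lambda>t. mexp M t $ i $ j)" for S i j
    by (intro continuous_on_component mexp_continuous_on)
  have cg: "continuous_on S g" for S
    unfolding g_def[abs_def] matrix_matrix_mult_def transpose_def
    by (intro continuous_on_vec_lambda continuous_on_sum continuous_on_mult)
       (simp_all add: ct)
  have ig: "g integrable_on {0..T}" by (intro integrable_continuous_real cg)
  \<comment> \<open>The truncated integral alone would give \<open>norm (mexp M T *v v)\<close>
    squared minus \<open>v \<bullet> v\<close>, which by \<open>small\<close> is at most half of
    \<open>- (v \<bullet> v)\<close>; the factor 2 makes up for it.\<close>
  define X where "X = 2 *\<^sub>R integral {0..T} g"
  have Xv: "u \<bullet> (X *v v) = 2 * integral {0..T} (\<lambda>t. (mexp M t *v u) \<bullet> (mexp M t *v v))" for u v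
  proof -
    have "bounded_linear (\<lambda>Y :: real^'n^'n. u \<bullet> (Y *v v))"
      by (intro bounded_linear_compose[OF bounded_linear_inner_right]
            bounded_bilinear.bounded_linear_left[OF bounded_bilinear_matrix_vector_mult])
    from integral_linear[OF ig this] have "u \<bullet> (integral {0..T} g *v v)
        = integral {0..T} (\<lambda>t. u \<bullet> (g t *v v))" by (simp add: o_def)
    moreover have "u \<bullet> (g t *v v) = (mexp M t *v u) \<bullet> (mexp M t *v v)" for t
      using dot_matrix_vector_transpose[of u "transpose (mexp M t)" "mexp M t *v v"]
      by (simp add: g_def matrix_vector_mul_assoc[symmetric] del: transpose_matrix_vector)
    ultimately show ?thesis by (simp add: X_def scaleR_matrix_vector_assoc[symmetric])
  qed
  have "sym_pos_semidef X"
  proof -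
    have "u \<bullet> (transpose X *v v) = u \<bullet> (X *v v)" for u v
    proof -
      have "u \<bullet> (transpose X *v v) = v \<bullet> (X *v u)"
        using dot_matrix_vector_transpose[of u "transpose X" v] by (simp add: inner_commute)
      then show ?thesis unfolding Xv by (simp add: inner_commute)
    qed
    then have "transpose X *v v = X *v v" for v
      using vector_eq_ldot[of "transpose X *v v" "X *v v"] by blast
    then have "transpose X = X" by (simp add: matrix_eq)
    moreover have "0 \<le> x \<bullet> (X *v x)" for x
      unfolding Xv by (intro mult_nonneg_nonneg integral_nonneg integrable_continuous_real
        continuous_intros continuous_at_imp_continuous_on ballI
        has_vector_derivative_continuous[OF mexp_apply_deriv]) auto
    ultimately show ?thesis by (simp add: sym_pos_semidef_def)
  qed
  moreover have "2 * (v \<bullet> (X *v (M *v v))) \<le> - (v \<bullet> v)" for v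
  proof -
    let ?y = "\<lambda>t. mexp M t *v v"
    have "((\<lambda>t. 2 * (?y t \<bullet> (M *v ?y t))) has_integral (?y T \<bullet> ?y T - ?y 0 \<bullet> ?y 0)) {0..T}"
    proof (rule fundamental_theorem_of_calculus[OF T(1)])
      fix t
      from bounded_bilinear.has_vector_derivative[OF bounded_bilinear_inner
          has_vector_derivative_at_within[OF mexp_apply_deriv]
          has_vector_derivative_at_within[OF mexp_apply_deriv], of M v M v t "{0..T}"]
      show "((\<lambda>t. ?y t \<bullet> ?y t) has_vector_derivative 2 * (?y t \<bullet> (M *v ?y t))) (at t within {0..T})"
        by (simp add: inner_commute)
    qed
    from integral_unique[OF this]
    have "2 * integral {0..T} (\<lambda>t. ?y t \<bullet> (M *v ?y t)) = ?y T \<bullet> ?y T - v \<bullet> v"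
      by (simp add: mexp_0)
    then have "2 * (v \<bullet> (X *v (M *v v))) = 2 * (?y T \<bullet> ?y T - v \<bullet> v)"
      by (simp add: Xv mexp_commute)
    then show ?thesis using small[of v] by (simp add: dot_square_norm)
  qed
  ultimately show ?thesis using that by blast
qed

text \<open>An eigenvalue \<open>z\<close> with \<open>Re z \<ge> 0\<close> and eigenvector
  \<open>w\<close> gives the solution \<open>exp (z t) w\<close>, whose norm never falls below that
  of \<open>w\<close>. Its real and imaginary parts are real solutions, so the square integral over
  \<open>{0..T}\<close> is at least \<open>T\<close> times a positive constant, against a bound that
  does not depend on \<open>T\<close>.\<close>

lemma Hurwitz_if_square_integrable:
  fixes M :: "real^'n^'n"
  assumes "\<And>v T. 0 \<le> T \<Longrightarrow> integral {0..T} (\<lambda>t. (norm (mexp M t *v v))\<^sup>2) \<le> K * (norm v)\<^sup>2"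
  shows "Hurwitz M"
  unfolding Hurwitz_def open_left_half_plane_def
proof (intro subsetI CollectI, rule ccontr)
  fix z assume "z \<in> spec M" and "\<not> Re z < 0"
  then obtain w where w: "w \<noteq> 0" "map_matrix complex_of_real M *v w = z *s w" and z: "Re z \<ge> 0"
    by (auto simp: spec_def)
  define y where "y t = exp (z * of_real t) *s w" for t
  define re :: "complex^'n \<Rightarrow> real^'n" where "re v = (\<chi> i. Re (v $ i))" for v
  define im :: "complex^'n \<Rightarrow> real^'n" where "im v = (\<chi> i. Im (v $ i))" for v
  have lre: "bounded_linear re" and lim: "bounded_linear im"
    unfolding linear_conv_bounded_linear[symmetric] re_def[abs_def] im_def[abs_def]
    by (auto intro!: linearI simp: vec_eq_iff)
  have dy: "(y has_vector_derivative map_matrix complex_of_real M *v y t) (at t)" for t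
  proof -
    have "bounded_linear (\<lambda>c. c *s w)"
      unfolding linear_conv_bounded_linear[symmetric]
      by (intro linearI) (simp_all add: vec_eq_iff algebra_simps)
    moreover have "((\<lambda>t. exp (z * of_real t)) has_vector_derivative z * exp (z * of_real t)) (at t)"
      by (auto intro!: derivative_eq_intros has_vector_derivative_real_field)
    ultimately have "(y has_vector_derivative (z * exp (z * of_real t)) *s w) (at t)"
      unfolding y_def[abs_def] by (rule bounded_linear.has_vector_derivative)
    moreover have "map_matrix complex_of_real M *v y t = exp (z * of_real t) *s (z *s w)"
      unfolding w(2)[symmetric] y_def by (simp add: vec_eq_iff matrix_vector_mult_def sum_distrib_left mult_ac)
    moreover have "exp (z * of_real t) *s (z *s w) = (z * exp (z * of_real t)) *s w"
      by (simp add: vec_eq_iff)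
    ultimately show ?thesis by metis
  qed
  have reM: "re (map_matrix complex_of_real M *v v) = M *v re v"
   and imM: "im (map_matrix complex_of_real M *v v) = M *v im v" for v
    by (simp_all add: re_def im_def vec_eq_iff matrix_vector_mult_def map_matrix_def)
  have y0: "y 0 = w" by (simp add: y_def vec_eq_iff)
  have "re (y t) = flow ((*v) M) (re (y 0)) t" for t
    using bounded_linear.has_vector_derivative[OF lre dy] unfolding reM
    by (rule flow_unique[OF matrix_vector_mul_linear])
  then have ry: "re (y t) = mexp M t *v re w" for t by (simp add: flow_eq_mexp y0)
  have "im (y t) = flow ((*v) M) (im (y 0)) t" for t
    using bounded_linear.has_vector_derivative[OF lim dy] unfolding imM
    by (rule flow_unique[OF matrix_vector_mul_linear])
  then have iy: "im (y t) = mexp M t *v im w" for t by (simp add: flow_eq_mexp y0)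
  have nrm: "(norm v)\<^sup>2 = (norm (re v))\<^sup>2 + (norm (im v))\<^sup>2" for v
    by (simp add: norm_vec_def L2_set_def real_sqrt_pow2[OF sum_nonneg] cmod_power2 re_def im_def sum.distrib
        add_nonneg_nonneg sum_nonneg)
  have ny: "(norm (y t))\<^sup>2 \<ge> (norm w)\<^sup>2" if "t \<ge> 0" for t
  proof -
    have "norm (y t) = exp (Re z * t) * norm w"
      by (simp add: y_def norm_vec_def L2_set_def norm_mult power_mult_distrib sum_distrib_left[symmetric]
          real_sqrt_mult norm_exp_eq_Re)
    moreover have "exp (Re z * t) \<ge> 1" using z that by simp
    ultimately have "norm w \<le> norm (y t)" by (simp add: mult_le_cancel_right1)
    then show ?thesis by (simp add: power_mono)
  qed
  have bound: "T * (norm w)\<^sup>2 \<le> K * (norm w)\<^sup>2" if T: "T \<ge> 0" for T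
  proof -
    have int: "(\<lambda>t. (norm (mexp M t *v v))\<^sup>2) integrable_on {0..T}" for v
      by (intro integrable_continuous_real continuous_intros continuous_at_imp_continuous_on ballI
        has_vector_derivative_continuous[OF mexp_apply_deriv])
    have "T * (norm w)\<^sup>2 = integral {0..T} (\<lambda>t. (norm w)\<^sup>2)" using T by simp
    also have "\<dots> \<le> integral {0..T} (\<lambda>t. (norm (mexp M t *v re w))\<^sup>2 + (norm (mexp M t *v im w))\<^sup>2)"
      using ny by (intro integral_le integrable_add int) (auto simp: nrm[of "y _"] ry iy)
    also have "\<dots> \<le> K * (norm (re w))\<^sup>2 + K * (norm (im w))\<^sup>2"
      by (subst integral_add) (auto intro!: int add_mono assms T)
    finally show ?thesis by (simp add: nrm[of w] distrib_left)
  qed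
  have "max 0 K + 1 \<le> K" using bound[of "max 0 K + 1"] w(1) by simp
  then show False by simp
qed

section \<open>Primitives of locally integrable functions\<close>

text \<open>Fubini on the plane cut along the diagonal. This is integration by parts for merely
  integrable functions, whose primitives need not be differentiable everywhere.\<close>

lemma integral_lower_triangle_add_upper_triangle:
  fixes f g :: "real \<Rightarrow> real"
  assumes f: "integrable lborel f" and g: "integrable lborel g"
  shows "(\<integral>t. f t * (\<integral>s. (if s \<le> t then g s else 0) \<partial>lborel)
              + (\<integral>s. (if s \<le> t then f s else 0) \<partial>lborel) * g t \<partial>lborel)
       = integral\<^sup>L lborel f * integral\<^sup>L lborel g"
proof -
  have fm[measurable]: "f \<in> borel_measurable borel" and gm[measurable]: "g \<in> borel_measurable borel"
    using f g borel_measurable_integrable by auto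
  define k where "k = (\<lambda>(t, s). f t * g s)"
  define k1 where "k1 t s = (if s \<le> t then f t * g s else 0)" for t s
  define k2 where "k2 t s = (if t < s then f t * g s else 0)" for t s
  have ik: "integrable (lborel \<Otimes>\<^sub>M lborel) k"
    unfolding k_def
    by (rule lborel_pair.Fubini_integrable) (auto simp: abs_mult intro!: integrable_mult_left f g integrable_abs)
  have ik1: "integrable (lborel \<Otimes>\<^sub>M lborel) (case_prod k1)"
  proof (rule Bochner_Integration.integrable_bound[OF ik])
    show "case_prod k1 \<in> borel_measurable (lborel \<Otimes>\<^sub>M lborel)"
      unfolding k1_def[abs_def] by measurable
  qed (auto simp: k_def k1_def)
  have ik2: "integrable (lborel \<Otimes>\<^sub>M lborel) (case_prod k2)"
  proof (rule Bochner_Integration.integrable_bound[OF ik])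
    show "case_prod k2 \<in> borel_measurable (lborel \<Otimes>\<^sub>M lborel)"
      unfolding k2_def[abs_def] by measurable
  qed (auto simp: k_def k2_def)
  have e1: "(\<integral>s. k1 t s \<partial>lborel) = f t * (\<integral>s. (if s \<le> t then g s else 0) \<partial>lborel)" for t
  proof -
    have "k1 t = (\<lambda>s. f t * (if s \<le> t then g s else 0))" by (auto simp: k1_def)
    then show ?thesis by simp
  qed
  have e2: "(\<integral>t. k2 t s \<partial>lborel) = (\<integral>t. (if t \<le> s then f t else 0) \<partial>lborel) * g s" for s
  proof -
    \<comment> \<open>The two half planes must be disjoint, so \<open>k2\<close> uses a strict
      inequality; the difference is a single point.\<close>
    have "(\<integral>t. k2 t s \<partial>lborel) = (\<integral>t. (if t \<le> s then f t else 0) * g s \<partial>lborel)"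
      unfolding k2_def
      by (intro integral_cong_AE eventually_mono[OF AE_lborel_singleton[of s]]) auto
    then show ?thesis by simp
  qed
  have "(\<integral>t. f t * (\<integral>s. (if s \<le> t then g s else 0) \<partial>lborel)
              + (\<integral>s. (if s \<le> t then f s else 0) \<partial>lborel) * g t \<partial>lborel)
      = (\<integral>t. (\<integral>s. k1 t s \<partial>lborel) \<partial>lborel) + (\<integral>s. (\<integral>t. k2 t s \<partial>lborel) \<partial>lborel)"
    unfolding e1[symmetric] e2[symmetric]
    by (rule Bochner_Integration.integral_add[OF lborel_pair.integrable_fst[OF ik1] lborel_pair.integrable_snd[OF ik2]])
  also have "\<dots> = integral\<^sup>L (lborel \<Otimes>\<^sub>M lborel) (case_prod k1) + integral\<^sup>L (lborel \<Otimes>\<^sub>M lborel) (case_prod k2)"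
    by (simp add: lborel_pair.integral_fst[OF ik1] lborel_pair.integral_snd[OF ik2])
  also have "\<dots> = integral\<^sup>L (lborel \<Otimes>\<^sub>M lborel) k"
    by (subst Bochner_Integration.integral_add[OF ik1 ik2, symmetric])
       (auto intro!: Bochner_Integration.integral_cong simp: k_def k1_def k2_def)
  also have "\<dots> = (\<integral>t. (\<integral>s. k (t, s) \<partial>lborel) \<partial>lborel)"
    by (rule lborel_pair.integral_fst'[OF ik, symmetric])
  also have "\<dots> = integral\<^sup>L lborel f * integral\<^sup>L lborel g" by (simp add: k_def)
  finally show ?thesis .
qed

lemma absolutely_integrable_lborel_representative:
  fixes f :: "real \<Rightarrow> real"
  assumes f: "f absolutely_integrable_on {0..T}"
  obtains f' where "integrable lborel f'" "AE x in lebesgue. indicator {0..T} x *\<^sub>R f x = f' x"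
    "\<And>t. t \<le> T \<Longrightarrow> integral {0..t} f = (\<integral>s. (if s \<le> t then f' s else 0) \<partial>lborel)"
proof -
  let ?f = "\<lambda>x. indicator {0..T} x *\<^sub>R f x"
  have i: "integrable lebesgue ?f" using f unfolding set_integrable_def .
  then obtain f' where f'[measurable]: "f' \<in> borel_measurable lborel" and ae: "AE x in lborel. ?f x = f' x"
    using completion_ex_borel_measurable_real[of ?f lborel] borel_measurable_integrable by blast
  have ae': "AE x in lebesgue. ?f x = f' x" by (rule AE_completion[OF ae])
  have "integrable lebesgue f'"
    using i measurable_completion[OF f'] ae'
    by (rule integrable_cong_AE_imp)
  then have "integrable lborel f'" using integrable_completion[OF f'] by blast
  moreover have "integral {0..t} f = (\<integral>s. (if s \<le> t then f' s else 0) \<partial>lborel)" if "t \<le> T" for t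
  proof -
    have "f absolutely_integrable_on {0..t}" using f that by (auto intro: absolutely_integrable_on_subinterval)
    then have "integral {0..t} f = (\<integral>s. indicator {0..t} s *\<^sub>R f s \<partial>lebesgue)"
      using set_lebesgue_integral_eq_integral(2) unfolding set_lebesgue_integral_def by metis
    also have "\<dots> = (\<integral>s. (if s \<le> t then f' s else 0) \<partial>lebesgue)"
    proof (rule integral_cong_AE)
      show "AE s in lebesgue. indicator {0..t} s *\<^sub>R f s = (if s \<le> t then f' s else 0)"
        using ae' by eventually_elim (use that in \<open>auto simp: indicator_def split: if_splits\<close>)
      show "(\<lambda>s. indicator {0..t} s *\<^sub>R f s) \<in> borel_measurable lebesgue"
        using \<open>f absolutely_integrable_on {0..t}\<close> unfolding set_integrable_def by (rule borel_measurable_integrable)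
      have "(\<lambda>s. if s \<le> t then f' s else 0) \<in> borel_measurable lborel" by measurable
      then show "(\<lambda>s. if s \<le> t then f' s else 0) \<in> borel_measurable lebesgue" by (rule measurable_completion)
    qed
    also have "\<dots> = (\<integral>s. (if s \<le> t then f' s else 0) \<partial>lborel)"
      by (rule integral_completion) measurable
    finally show ?thesis .
  qed
  ultimately show ?thesis using that ae' by blast
qed

lemma absolutely_integrable_bilinear_continuous:
  fixes h :: "'a::euclidean_space \<Rightarrow> 'b::euclidean_space \<Rightarrow> 'c::euclidean_space"
  assumes "bilinear h" "f absolutely_integrable_on {0..T::real}" "continuous_on {0..T} x"
  shows "(\<lambda>t. h (x t) (f t)) absolutely_integrable_on {0..T}"
proof (rule absolutely_integrable_bounded_measurable_product[OF assms(1) _ _ _ assms(2)])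
  show "x \<in> borel_measurable (lebesgue_on {0..T})"
    by (rule continuous_imp_measurable_on_sets_lebesgue[OF assms(3)]) simp
  show "bounded (x ` {0..T})"
    by (rule compact_imp_bounded[OF compact_continuous_image[OF assms(3) compact_Icc]])
qed simp

lemma continuous_on_primitive_integral:
  fixes f :: "real \<Rightarrow> 'a::euclidean_space"
  assumes "f absolutely_integrable_on {0..T}"
  shows "continuous_on {0..T} (\<lambda>t. integral {0..t} f)"
  using assms by (intro indefinite_integral_continuous_1 set_lebesgue_integral_eq_integral)

lemma integral_product_rule_real:
  fixes f g :: "real \<Rightarrow> real"
  assumes f: "f absolutely_integrable_on {0..T}" and g: "g absolutely_integrable_on {0..T}"
  shows "integral {0..T} (\<lambda>t. f t * integral {0..t} g + integral {0..t} f * g t)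
     = integral {0..T} f * integral {0..T} g"
proof -
  obtain f' where f': "integrable lborel f'" "AE x in lebesgue. indicator {0..T} x *\<^sub>R f x = f' x"
    "\<And>t. t \<le> T \<Longrightarrow> integral {0..t} f = (\<integral>s. (if s \<le> t then f' s else 0) \<partial>lborel)"
    using absolutely_integrable_lborel_representative[OF f] by blast
  obtain g' where g': "integrable lborel g'" "AE x in lebesgue. indicator {0..T} x *\<^sub>R g x = g' x"
    "\<And>t. t \<le> T \<Longrightarrow> integral {0..t} g = (\<integral>s. (if s \<le> t then g' s else 0) \<partial>lborel)"
    using absolutely_integrable_lborel_representative[OF g] by blast
  have [measurable]: "f' \<in> borel_measurable borel" "g' \<in> borel_measurable borel"
    using f'(1) g'(1) borel_measurable_integrable by auto
  let ?h = "\<lambda>t. f t * integral {0..t} g + integral {0..t} f * g t"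
  let ?k = "\<lambda>t. f' t * (\<integral>s. (if s \<le> t then g' s else 0) \<partial>lborel)
      + (\<integral>s. (if s \<le> t then f' s else 0) \<partial>lborel) * g' t"
  have h: "?h absolutely_integrable_on {0..T}"
    using absolutely_integrable_bilinear_continuous[OF bilinear_times f continuous_on_primitive_integral[OF g]]
      absolutely_integrable_bilinear_continuous[OF bilinear_times g continuous_on_primitive_integral[OF f]]
    by (intro set_integral_add) (simp_all add: mult.commute)
  have ih: "integral {0..T} ?h = (\<integral>t. indicator {0..T} t *\<^sub>R ?h t \<partial>lebesgue)"
    and mh: "(\<lambda>t. indicator {0..T} t *\<^sub>R ?h t) \<in> borel_measurable lebesgue"
    using set_lebesgue_integral_eq_integral(2)[OF h] borel_measurable_integrable[OF h[unfolded set_integrable_def]]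
    by (simp_all add: set_lebesgue_integral_def)
  note ih
  also have "(\<integral>t. indicator {0..T} t *\<^sub>R ?h t \<partial>lebesgue) = (\<integral>t. ?k t \<partial>lebesgue)"
  proof (rule integral_cong_AE[OF mh])
    show "?k \<in> borel_measurable lebesgue" by (rule measurable_completion) measurable
    show "AE t in lebesgue. indicator {0..T} t *\<^sub>R ?h t = ?k t"
      using f'(2) g'(2)
    proof eventually_elim
      case (elim t)
      show ?case
      proof (cases "t \<in> {0..T}")
        case True
        then show ?thesis using elim f'(3)[of t] g'(3)[of t] by simp
      next
        case False
        then show ?thesis using elim by simp
      qed
    qed
  qed
  also have "\<dots> = (\<integral>t. ?k t \<partial>lborel)" by (rule integral_completion) measurable
  also have "\<dots> = integral\<^sup>L lborel f' * integral\<^sup>L lborel g'"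
    by (rule integral_lower_triangle_add_upper_triangle[OF f'(1) g'(1)])
  also have "integral\<^sup>L lborel f' = integral {0..T} f"
  proof -
    have "AE x in lebesgue. (if x \<le> T then f' x else 0) = f' x"
      using f'(2) by eventually_elim (auto simp: not_le)
    then have "AE x in lborel. (if x \<le> T then f' x else 0) = f' x" by (simp add: AE_completion_iff)
    then have "(\<integral>s. (if s \<le> T then f' s else 0) \<partial>lborel) = integral\<^sup>L lborel f'"
      by (intro integral_cong_AE) auto
    then show ?thesis using f'(3)[of T] by simp
  qed
  also have "integral\<^sup>L lborel g' = integral {0..T} g"
  proof -
    have "AE x in lebesgue. (if x \<le> T then g' x else 0) = g' x"
      using g'(2) by eventually_elim (auto simp: not_le)
    then have "AE x in lborel. (if x \<le> T then g' x else 0) = g' x" by (simp add: AE_completion_iff)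
    then have "(\<integral>s. (if s \<le> T then g' s else 0) \<partial>lborel) = integral\<^sup>L lborel g'"
      by (intro integral_cong_AE) auto
    then show ?thesis using g'(3)[of T] by simp
  qed
  finally show ?thesis .
qed

text \<open>Local absolute continuity on the half-line with derivative \<open>f\<close> almost
  everywhere. The differential equations of controlled trajectories are stated in this form.\<close>

definition primitive :: "(real \<Rightarrow> 'a::euclidean_space) \<Rightarrow> (real \<Rightarrow> 'a) \<Rightarrow> bool" where
  "primitive f x \<longleftrightarrow>
     (\<forall>T\<ge>0. f absolutely_integrable_on {0..T} \<and> x T = x 0 + integral {0..T} f)"

lemma primitiveD:
  assumes "primitive f x"
  shows "f absolutely_integrable_on {0..T}" "T \<ge> 0 \<Longrightarrow> x T = x 0 + integral {0..T} f"
proof -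
  show "f absolutely_integrable_on {0..T}"
  proof (cases "T \<ge> 0")
    case False
    then show ?thesis by (simp add: set_integrable_def)
  qed (use assms primitive_def in blast)
  show "T \<ge> 0 \<Longrightarrow> x T = x 0 + integral {0..T} f"
    using assms primitive_def by blast
qed

lemma primitive_continuous_on:
  assumes "primitive f x"
  shows "continuous_on {0..T} x"
proof -
  have "continuous_on {0..T} (\<lambda>t. x 0 + integral {0..t} f)"
    using primitiveD(1)[OF assms] by (intro continuous_intros continuous_on_primitive_integral)
  then show ?thesis
    by (rule continuous_on_eq) (simp add: primitiveD(2)[OF assms, symmetric])
qed

lemma primitive_linear:
  assumes "primitive f x" and h: "bounded_linear h"
  shows "primitive (\<lambda>t. h (f t)) (\<lambda>t. h (x t))"
  unfolding primitive_def
proof (intro allI impI conjI)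
  fix T :: real assume T: "T \<ge> 0"
  note D = primitiveD[OF assms(1), of T]
  show "(\<lambda>t. h (f t)) absolutely_integrable_on {0..T}"
    using absolutely_integrable_linear[OF D(1) h] by (simp add: o_def)
  have "integral {0..T} (\<lambda>t. h (f t)) = h (integral {0..T} f)"
    using integral_linear[OF set_lebesgue_integral_eq_integral(1)[OF D(1)] h] by (simp add: o_def)
  then show "h (x T) = h (x 0) + integral {0..T} (\<lambda>t. h (f t))"
    using D(2)[OF T] by (simp add: linear_simps[OF h])
qed

lemma primitive_add:
  assumes "primitive f x" "primitive g y"
  shows "primitive (\<lambda>t. f t + g t) (\<lambda>t. x t + y t)"
  unfolding primitive_def
proof (intro allI impI conjI set_integral_add primitiveD(1)[OF assms(1)] primitiveD(1)[OF assms(2)])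
  fix T :: real assume T: "T \<ge> 0"
  have "integral {0..T} (\<lambda>t. f t + g t) = integral {0..T} f + integral {0..T} g"
    by (intro integral_add set_lebesgue_integral_eq_integral(1)
        primitiveD(1)[OF assms(1)] primitiveD(1)[OF assms(2)])
  then show "x T + y T = x 0 + y 0 + integral {0..T} (\<lambda>t. f t + g t)"
    using primitiveD(2)[OF assms(1) T] primitiveD(2)[OF assms(2) T] by simp
qed

lemma primitive_diff:
  assumes "primitive f x" "primitive g y"
  shows "primitive (\<lambda>t. f t - g t) (\<lambda>t. x t - y t)"
  using primitive_add[OF assms(1) primitive_linear[OF assms(2) bounded_linear_minus[OF bounded_linear_ident]]]
  by simp

lemma primitive_has_vector_derivative:
  assumes "\<And>t. (x has_vector_derivative f t) (at t)" "\<And>T. continuous_on {0..T} f"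
  shows "primitive f x"
  unfolding primitive_def
proof (intro allI impI conjI absolutely_integrable_continuous_real assms(2))
  fix T :: real assume "T \<ge> 0"
  then have "(f has_integral (x T - x 0)) {0..T}"
    by (rule fundamental_theorem_of_calculus[OF _ has_vector_derivative_at_within[OF assms(1)]])
  then show "x T = x 0 + integral {0..T} f" by (simp add: integral_unique)
qed

lemma primitive_mult:
  fixes x y :: "real \<Rightarrow> real"
  assumes x: "primitive f x" and y: "primitive g y"
  shows "primitive (\<lambda>t. f t * y t + x t * g t) (\<lambda>t. x t * y t)"
  unfolding primitive_def
proof (intro allI impI conjI)
  fix T :: real assume T: "T \<ge> 0"
  note f = primitiveD(1)[OF x, of T] and g = primitiveD(1)[OF y, of T]
  show "(\<lambda>t. f t * y t + x t * g t) absolutely_integrable_on {0..T}"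
    using absolutely_integrable_bilinear_continuous[OF bilinear_times f primitive_continuous_on[OF y]]
      absolutely_integrable_bilinear_continuous[OF bilinear_times g primitive_continuous_on[OF x]]
    by (intro set_integral_add) (simp_all add: mult.commute)
  let ?F = "\<lambda>t. integral {0..t} f" and ?G = "\<lambda>t. integral {0..t} g"
  have i: "(\<lambda>t. f t * ?G t + ?F t * g t) integrable_on {0..T}"
    using absolutely_integrable_bilinear_continuous[OF bilinear_times f continuous_on_primitive_integral[OF g]]
      absolutely_integrable_bilinear_continuous[OF bilinear_times g continuous_on_primitive_integral[OF f]]
    by (intro set_lebesgue_integral_eq_integral set_integral_add) (simp_all add: mult.commute)
  have fi: "f integrable_on {0..T}" and gi: "g integrable_on {0..T}"
    using f g set_lebesgue_integral_eq_integral(1) by auto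
  \<comment> \<open>The product rule for integrals concerns primitives that start at 0; the initial
    values of \<open>x\<close> and \<open>y\<close> contribute the terms without an inner
    integral.\<close>
  have "integral {0..T} (\<lambda>t. f t * y t + x t * g t)
      = integral {0..T} (\<lambda>t. (f t * ?G t + ?F t * g t) + (f t * y 0 + x 0 * g t))"
  proof (rule integral_cong)
    fix t assume "t \<in> {0..T}"
    then show "f t * y t + x t * g t = (f t * ?G t + ?F t * g t) + (f t * y 0 + x 0 * g t)"
      using primitiveD(2)[OF x, of t] primitiveD(2)[OF y, of t] by (simp add: algebra_simps)
  qed
  also have "\<dots> = ?F T * ?G T + (?F T * y 0 + x 0 * ?G T)"
    using fi gi
    by (subst integral_add[OF i], intro integrable_add integrable_on_mult_left integrable_on_mult_right)
       (simp_all add: integral_product_rule_real[OF f g] integral_add integrable_on_mult_left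
         integrable_on_mult_right)
  finally show "x T * y T = x 0 * y 0 + integral {0..T} (\<lambda>t. f t * y t + x t * g t)"
    using primitiveD(2)[OF x T] primitiveD(2)[OF y T] by (simp add: algebra_simps)
qed

lemma primitive_sum:
  assumes "finite I" "\<And>i. i \<in> I \<Longrightarrow> primitive (f i) (x i)"
  shows "primitive (\<lambda>t. \<Sum>i\<in>I. f i t) (\<lambda>t. \<Sum>i\<in>I. x i t)"
  using assms by (induction I rule: finite_induct) (auto intro: primitive_add, simp add: primitive_def)

lemma primitive_inner:
  assumes x: "primitive f x" and y: "primitive g y"
  shows "primitive (\<lambda>t. f t \<bullet> y t + x t \<bullet> g t) (\<lambda>t. x t \<bullet> y t)"
proof -
  have "primitive (\<lambda>t. \<Sum>b\<in>Basis. (f t \<bullet> b) * (y t \<bullet> b) + (x t \<bullet> b) * (g t \<bullet> b))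
      (\<lambda>t. \<Sum>b\<in>Basis. (x t \<bullet> b) * (y t \<bullet> b))"
    by (intro primitive_sum primitive_mult primitive_linear[OF x] primitive_linear[OF y]
        bounded_linear_inner_left) auto
  then show ?thesis
    by (simp add: sum.distrib euclidean_inner[symmetric])
qed

text \<open>Integrating the equation once makes the forcing continuous: with \<open>F\<close> the
  primitive of \<open>f\<close> starting at \<open>x0\<close>, the wanted \<open>x\<close> is the
  derivative of the classical solution of \<open>z' = M z + F\<close>.\<close>

lemma linear_ode_primitive_exists:
  fixes M :: "real^'n^'n" and f :: "real \<Rightarrow> real^'n"
  assumes f: "\<And>T. f absolutely_integrable_on {0..T}"
  obtains x where "x 0 = x0" "primitive (\<lambda>t. M *v x t + f t) x"
proof -
  define F where "F t = x0 + integral {0..t} f" for t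
  have "continuous_on {0..T} F" for T
    unfolding F_def[abs_def] by (intro continuous_intros continuous_on_primitive_integral f)
  then obtain z where z: "z 0 = 0"
    "\<And>t T. t \<in> {0..T} \<Longrightarrow> (z has_vector_derivative M *v z t + F t) (at t within {0..T})"
    using forced_ode_exists[of F M] by blast
  define x where "x t = M *v z t + F t" for t
  have cF: "continuous_on {0..T} F" for T by fact
  have cz: "continuous_on {0..T} z" for T
    using z(2) has_vector_derivative_continuous by (fastforce simp: continuous_on_eq_continuous_within)
  have cMx: "continuous_on {0..T} (\<lambda>t. M *v x t)" for T
    unfolding x_def by (intro continuous_intros cz cF bounded_linear.continuous_on[OF matrix_vector_mul_bounded_linear])
  have ix: "integral {0..T} x = z T" if "T \<ge> 0" for T
    using fundamental_theorem_of_calculus[OF that, of z x] z by (simp add: x_def integral_unique)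
  have cx: "continuous_on {0..T} x" for T
    unfolding x_def[abs_def] by (intro continuous_intros cz cF bounded_linear.continuous_on[OF matrix_vector_mul_bounded_linear])
  have "primitive (\<lambda>t. M *v x t + f t) x"
    unfolding primitive_def
  proof (intro allI impI conjI)
    fix T :: real assume T: "T \<ge> 0"
    show "(\<lambda>t. M *v x t + f t) absolutely_integrable_on {0..T}"
      by (intro set_integral_add absolutely_integrable_continuous_real cMx f)
    have "integral {0..T} (\<lambda>t. M *v x t) = M *v integral {0..T} x"
      using integral_linear[OF integrable_continuous_real[OF cx] matrix_vector_mul_bounded_linear] by (simp add: o_def)
    then show "x T = x 0 + integral {0..T} (\<lambda>t. M *v x t + f t)"
      using f[of T, THEN set_lebesgue_integral_eq_integral(1)] integrable_continuous_real[OF cMx, of T]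
      by (simp add: integral_add ix[OF T]) (simp add: x_def F_def z(1))
  qed
  moreover have "x 0 = x0" by (simp add: x_def F_def z(1))
  ultimately show ?thesis using that by blast
qed

text \<open>The forcing cancels in the difference, whose integrand is then continuous, so classical
  uniqueness applies.\<close>

lemma linear_ode_primitive_unique:
  fixes M :: "real^'n^'n"
  assumes "primitive (\<lambda>t. M *v x t + f t) x" "primitive (\<lambda>t. M *v y t + f t) y" "x 0 = y 0" "0 \<le> T"
  shows "x T = y T"
proof -
  let ?z = "\<lambda>t. x t - y t"
  have p: "primitive (\<lambda>t. M *v ?z t) ?z"
    using primitive_diff[OF assms(1,2)] by (simp add: matrix_vector_mult_diff_distrib)
  have c: "continuous_on {0..T} (\<lambda>t. M *v ?z t)"
    by (intro bounded_linear.continuous_on[OF matrix_vector_mul_bounded_linear] primitive_continuous_on[OF p])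
  have "(?z has_vector_derivative M *v ?z t) (at t within {0..T})" if t: "t \<in> {0..T}" for t
  proof (rule has_vector_derivative_transform[OF t _ integral_has_vector_derivative[OF c t]])
    fix s assume "s \<in> {0..T}"
    then show "?z s = integral {0..s} (\<lambda>t. M *v ?z t)" using primitiveD(2)[OF p, of s] assms(3) by simp
  qed
  from linear_ode_unique_right[OF matrix_vector_mul_linear assms(4), where y = ?z, OF this]
  show ?thesis using assms(3) by simp
qed

section \<open>Square-integrable signals\<close>

text \<open>The common class for everything done on finite horizons: it contains \<open>L2\<close>
  as well as all continuous signals, such as solutions of the Hamiltonian system, which may
  grow.\<close>

definition loc_square_integrable :: "(real \<Rightarrow> 'a::euclidean_space) \<Rightarrow> bool" where
  "loc_square_integrable u \<longleftrightarrow>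
     (\<forall>T. u \<in> borel_measurable (lebesgue_on {0..T}) \<and> (\<lambda>t. (norm (u t))\<^sup>2) integrable_on {0..T})"

lemma L2_iff:
  "u \<in> L2 \<longleftrightarrow> u \<in> borel_measurable (lebesgue_on {0..}) \<and> (\<lambda>t. (norm (u t))\<^sup>2) integrable_on {0..}"
proof -
  have "set_borel_measurable lebesgue {0..} u \<longleftrightarrow> u \<in> borel_measurable (lebesgue_on {0..})"
    unfolding set_borel_measurable_def by (subst borel_measurable_restrict_space_iff) auto
  moreover have "set_integrable lebesgue {0..} (\<lambda>t. (norm (u t))\<^sup>2) \<longleftrightarrow> (\<lambda>t. (norm (u t))\<^sup>2) integrable_on {0..}"
    using nonnegative_absolutely_integrable_1[of "\<lambda>t. (norm (u t))\<^sup>2" "{0..}"]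
      set_lebesgue_integral_eq_integral(1)[of "{0..}" "\<lambda>t. (norm (u t))\<^sup>2"] by auto
  ultimately show ?thesis by (simp add: L2_def)
qed

lemma L2_norm_sq_eq_integral:
  "u \<in> L2 \<Longrightarrow> L2_norm_sq u = integral {0..} (\<lambda>t. (norm (u t))\<^sup>2)"
  unfolding L2_def L2_norm_sq_def by (auto intro: set_lebesgue_integral_eq_integral(2))

lemma L2_imp_loc_square_integrable:
  assumes "u \<in> L2"
  shows "loc_square_integrable u"
  unfolding loc_square_integrable_def
proof (intro allI conjI)
  fix T
  show "u \<in> borel_measurable (lebesgue_on {0..T})"
    using assms unfolding L2_iff by (auto intro: measurable_restrict_mono)
  show "(\<lambda>t. (norm (u t))\<^sup>2) integrable_on {0..T}"
    using assms unfolding L2_iff by (auto intro: integrable_on_subinterval)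
qed

lemma loc_square_integrable_continuous:
  assumes "\<And>T. continuous_on {0..T} u"
  shows "loc_square_integrable u"
  unfolding loc_square_integrable_def
proof (intro allI conjI)
  show "u \<in> borel_measurable (lebesgue_on {0..T})" for T
    by (rule continuous_imp_measurable_on_sets_lebesgue[OF assms]) simp
  show "(\<lambda>t. (norm (u t))\<^sup>2) integrable_on {0..T}" for T
    by (intro integrable_continuous_real continuous_intros assms)
qed

lemma loc_square_integrable_if_le:
  assumes m: "\<And>T. v \<in> borel_measurable (lebesgue_on {0..T})"
    and g: "\<And>T. g integrable_on {0..T}" "\<And>t. (norm (v t))\<^sup>2 \<le> g t"
  shows "loc_square_integrable v"
  unfolding loc_square_integrable_def
proof (intro allI conjI m)
  fix T
  have [measurable]: "v \<in> borel_measurable (lebesgue_on {0..T})" by (rule m)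
  show "(\<lambda>t. (norm (v t))\<^sup>2) integrable_on {0..T}"
    by (rule measurable_bounded_by_integrable_imp_integrable[OF _ g(1)]) (use g(2) in auto)
qed

lemma loc_square_integrable_linear:
  assumes u: "loc_square_integrable u" and h: "bounded_linear h"
  shows "loc_square_integrable (\<lambda>t. h (u t))"
proof -
  obtain K where K: "\<And>x. norm (h x) \<le> norm x * K"
    using bounded_linear.bounded[OF h] by blast
  show ?thesis
  proof (rule loc_square_integrable_if_le)
    show "(\<lambda>t. h (u t)) \<in> borel_measurable (lebesgue_on {0..T})" for T
      using u unfolding loc_square_integrable_def
      by (intro measurable_compose[OF _ borel_measurable_continuous_onI[OF linear_continuous_on[OF h]]]) auto
    show "(\<lambda>t. K\<^sup>2 * (norm (u t))\<^sup>2) integrable_on {0..T}" for T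
      using u unfolding loc_square_integrable_def by (intro integrable_on_mult_right) auto
    show "(norm (h (u t)))\<^sup>2 \<le> K\<^sup>2 * (norm (u t))\<^sup>2" for t
      using power_mono[OF K[of "u t"] norm_ge_zero, of 2] by (simp add: power_mult_distrib mult.commute)
  qed
qed

lemma norm_add_sq_le: "(norm (a + b))\<^sup>2 \<le> 2 * (norm a)\<^sup>2 + 2 * (norm b)\<^sup>2" for a b :: "'a::real_inner"
proof -
  have "0 \<le> (norm (a - b))\<^sup>2" by simp
  then show ?thesis by (simp add: power2_norm_eq_inner algebra_simps inner_commute)
qed

lemma loc_square_integrable_add:
  assumes u: "loc_square_integrable u" and v: "loc_square_integrable v"
  shows "loc_square_integrable (\<lambda>t. u t + v t)"
proof (rule loc_square_integrable_if_le)
  show "(\<lambda>t. u t + v t) \<in> borel_measurable (lebesgue_on {0..T})" for T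
    using assms unfolding loc_square_integrable_def by (intro borel_measurable_add) auto
  show "(\<lambda>t. 2 * (norm (u t))\<^sup>2 + 2 * (norm (v t))\<^sup>2) integrable_on {0..T}" for T
    using assms unfolding loc_square_integrable_def
    by (intro integrable_add integrable_on_mult_right) auto
qed (rule norm_add_sq_le)

lemma loc_square_integrable_diff:
  assumes "loc_square_integrable u" "loc_square_integrable v"
  shows "loc_square_integrable (\<lambda>t. u t - v t)"
  using loc_square_integrable_add[OF assms(1) loc_square_integrable_linear[OF assms(2)
        bounded_linear_minus[OF bounded_linear_ident]]] by simp

lemma loc_square_integrable_inner:
  assumes u: "loc_square_integrable u" and v: "loc_square_integrable v"
  shows "(\<lambda>t. u t \<bullet> v t) integrable_on {0..T}"
proof (rule measurable_bounded_by_integrable_imp_integrable)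
  have [measurable]: "u \<in> borel_measurable (lebesgue_on {0..T})" "v \<in> borel_measurable (lebesgue_on {0..T})"
    using assms unfolding loc_square_integrable_def by auto
  show "(\<lambda>t. u t \<bullet> v t) \<in> borel_measurable (lebesgue_on {0..T})" by measurable
  show "(\<lambda>t. (norm (u t))\<^sup>2 + (norm (v t))\<^sup>2) integrable_on {0..T}"
    using assms unfolding loc_square_integrable_def by (intro integrable_add) auto
  fix t
  have "norm (u t \<bullet> v t) \<le> norm (u t) * norm (v t)" by (simp add: Cauchy_Schwarz_ineq2)
  also have "\<dots> \<le> (norm (u t))\<^sup>2 + (norm (v t))\<^sup>2"
    using sum_squares_bound[of "norm (u t)" "norm (v t)"]
      mult_nonneg_nonneg[OF norm_ge_zero[of "u t"] norm_ge_zero[of "v t"]] by linarith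
  finally show "norm (u t \<bullet> v t) \<le> (norm (u t))\<^sup>2 + (norm (v t))\<^sup>2" .
qed simp

lemma loc_square_integrable_norm:
  "loc_square_integrable u \<Longrightarrow> (\<lambda>t. (norm (u t))\<^sup>2) integrable_on {0..T}"
  unfolding loc_square_integrable_def by blast

lemma loc_square_integrable_imp_absolutely_integrable:
  assumes "loc_square_integrable u"
  shows "u absolutely_integrable_on {0..T}"
proof (rule measurable_bounded_by_integrable_imp_absolutely_integrable)
  show "u \<in> borel_measurable (lebesgue_on {0..T})"
    using assms unfolding loc_square_integrable_def by blast
  show "(\<lambda>t. 1 + (norm (u t))\<^sup>2) integrable_on {0..T}"
    using assms by (intro integrable_add loc_square_integrable_norm) auto
  show "norm (u t) \<le> 1 + (norm (u t))\<^sup>2" for t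
    using sum_squares_bound[of "norm (u t)" 1] norm_ge_zero[of "u t"]
    unfolding power2_eq_square by linarith
qed simp

lemma primitive_loc_square_integrable: "primitive f x \<Longrightarrow> loc_square_integrable x"
  by (intro loc_square_integrable_continuous primitive_continuous_on)

lemma halfline_integrable_if_bounded:
  fixes g :: "real \<Rightarrow> real"
  assumes "\<And>t. 0 \<le> g t" "\<And>T. T \<ge> 0 \<Longrightarrow> g integrable_on {0..T}" "\<And>T. T \<ge> 0 \<Longrightarrow> integral {0..T} g \<le> C"
  shows "g integrable_on {0..}" "integral {0..} g \<le> C"
proof -
  let ?f = "\<lambda>k t. if t \<in> {0..real k} then g t else 0"
  have inf: "integral {0..} (?f k) = integral {0..real k} g" for k
    by (subst integral_restrict_Int) (auto simp: Int_absorb1)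
  have "g integrable_on {0..} \<and> (\<lambda>k. integral {0..} (?f k)) \<longlonglongrightarrow> integral {0..} g"
  proof (rule monotone_convergence_increasing)
    show "?f k integrable_on {0..}" for k
      by (subst integrable_restrict_Int) (use assms(2)[of "real k"] in \<open>auto simp: Int_absorb1\<close>)
    show "?f k t \<le> ?f (Suc k) t" for k t using assms(1)[of t] by auto
    fix t :: real assume t: "t \<in> {0..}"
    have "\<forall>\<^sub>F k in sequentially. ?f k t = g t"
      using eventually_ge_at_top[of "nat \<lceil>t\<rceil>"]
    proof eventually_elim
      case (elim k)
      then have "t \<in> {0..real k}" using t by auto
      then show ?case by simp
    qed
    then show "(\<lambda>k. ?f k t) \<longlonglongrightarrow> g t" by (rule tendsto_eventually)
  next
    have "0 \<le> integral {0..} (?f k) \<and> integral {0..} (?f k) \<le> C" for k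
      unfolding inf using assms by (auto intro: integral_nonneg)
    then show "bounded (range (\<lambda>k. integral {0..} (?f k)))"
      by (intro boundedI[of _ C]) auto
  qed
  then have "(\<lambda>k. integral {0..real k} g) \<longlonglongrightarrow> integral {0..} g" and "g integrable_on {0..}"
    unfolding inf by auto
  then show "g integrable_on {0..}" "integral {0..} g \<le> C"
    using assms(3) by (auto intro: LIMSEQ_le_const2)
qed

lemma integral_Icc_le_halfline:
  fixes g :: "real \<Rightarrow> real"
  assumes "\<And>t. t \<ge> 0 \<Longrightarrow> 0 \<le> g t" "g integrable_on {0..}"
  shows "integral {0..T} g \<le> integral {0..} g"
  using assms by (intro integral_subset_le) (auto intro: integrable_on_subinterval)

lemma matrix_vector_norm_le:
  fixes M :: "real^'n^'m"
  obtains k where "k \<ge> 0" "\<And>v. (norm (M *v v))\<^sup>2 \<le> k * (norm v)\<^sup>2"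
proof -
  obtain K where K: "\<And>v. norm (M *v v) \<le> norm v * K"
    using bounded_linear.bounded[OF matrix_vector_mul_bounded_linear] by blast
  have "(norm (M *v v))\<^sup>2 \<le> K\<^sup>2 * (norm v)\<^sup>2" for v
    using power_mono[OF K[of v] norm_ge_zero, of 2] by (simp add: power_mult_distrib mult.commute)
  then show ?thesis using that[of "K\<^sup>2"] by simp
qed

text \<open>The Lyapunov form \<open>x \<bullet> (X *v x)\<close> serves as a storage function:
  along a trajectory it loses \<open>(norm x)\<close> squared and gains a cross term with
  \<open>f\<close>, which Young's inequality splits so that half of the loss survives. The constant
  depends on \<open>M\<close> alone; independence of the horizon is what later limits need.\<close>

lemma Hurwitz_L2_gain:
  fixes M :: "real^'n^'n"
  assumes "Hurwitz M"
  obtains K where "K \<ge> 0"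
    "\<And>x f T. T \<ge> 0 \<Longrightarrow> loc_square_integrable f \<Longrightarrow> primitive (\<lambda>t. M *v x t + f t) x \<Longrightarrow>
       integral {0..T} (\<lambda>t. (norm (x t))\<^sup>2) \<le> K * ((norm (x 0))\<^sup>2 + integral {0..T} (\<lambda>t. (norm (f t))\<^sup>2))"
proof -
  obtain X where X: "sym_pos_semidef X" "\<And>v. 2 * (v \<bullet> (X *v (M *v v))) \<le> - (v \<bullet> v)"
    using Hurwitz_lyapunov[OF assms] by blast
  obtain k where k: "k \<ge> 0" "\<And>v. (norm (X *v v))\<^sup>2 \<le> k * (norm v)\<^sup>2"
    using matrix_vector_norm_le by blast
  have Xs: "u \<bullet> (X *v v) = (X *v u) \<bullet> v" for u v
    using X(1) dot_matrix_vector_transpose[of u X v] by (simp add: sym_pos_semidef_def)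
  \<comment> \<open>After doubling the dissipation inequality, the forcing carries the factor
    \<open>4 * k\<close> and the initial value \<open>k + 1\<close>; \<open>K\<close> dominates
    both.\<close>
  define K where "K = 4 * k + k + 1"
  have "integral {0..T} (\<lambda>t. (norm (x t))\<^sup>2) \<le> K * ((norm (x 0))\<^sup>2 + integral {0..T} (\<lambda>t. (norm (f t))\<^sup>2))"
    if T: "T \<ge> 0" and f: "loc_square_integrable f" and x: "primitive (\<lambda>t. M *v x t + f t) x" for x f T
  proof -
    let ?g = "\<lambda>t. (M *v x t + f t) \<bullet> (X *v x t) + x t \<bullet> (X *v (M *v x t + f t))"
    have p: "primitive ?g (\<lambda>t. x t \<bullet> (X *v x t))"
      by (rule primitive_inner[OF x primitive_linear[OF x matrix_vector_mul_bounded_linear]])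
    have ig: "?g integrable_on {0..T}"
      using primitiveD(1)[OF p] set_lebesgue_integral_eq_integral(1) by blast
    have ix: "(\<lambda>t. (norm (x t))\<^sup>2) integrable_on {0..T}" and if': "(\<lambda>t. (norm (f t))\<^sup>2) integrable_on {0..T}"
      using loc_square_integrable_norm[OF primitive_loc_square_integrable[OF x]]
        loc_square_integrable_norm[OF f] by auto
    have pw: "?g t \<le> - (1 / 2) * (norm (x t))\<^sup>2 + 2 * k * (norm (f t))\<^sup>2" for t
    proof -
      have "?g t = 2 * (x t \<bullet> (X *v (M *v x t))) + 2 * (x t \<bullet> (X *v f t))"
        using Xs[of "M *v x t" "x t"] Xs[of "f t" "x t"]
        by (simp add: matrix_vector_right_distrib inner_add_left inner_add_right inner_commute)
      also have "\<dots> \<le> - (norm (x t))\<^sup>2 + 2 * (x t \<bullet> (X *v f t))"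
        using X(2)[of "x t"] by (simp add: dot_square_norm)
      also have "2 * (x t \<bullet> (X *v f t)) \<le> (1 / 2) * (norm (x t))\<^sup>2 + 2 * (norm (X *v f t))\<^sup>2"
      proof -
        have "0 \<le> (norm ((1 / 2) *\<^sub>R x t - X *v f t))\<^sup>2" by simp
        then show ?thesis unfolding power2_norm_eq_inner by (simp add: algebra_simps inner_commute)
      qed
      also have "2 * (norm (X *v f t))\<^sup>2 \<le> 2 * k * (norm (f t))\<^sup>2" using k(2)[of "f t"] by simp
      finally show ?thesis by simp
    qed
    have "integral {0..T} ?g \<le> integral {0..T} (\<lambda>t. - (1 / 2) * (norm (x t))\<^sup>2 + 2 * k * (norm (f t))\<^sup>2)"
      by (rule integral_le[OF ig _ pw]) (intro integrable_add integrable_on_mult_right ix if')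
    also have "\<dots> = - (1 / 2) * integral {0..T} (\<lambda>t. (norm (x t))\<^sup>2) + 2 * k * integral {0..T} (\<lambda>t. (norm (f t))\<^sup>2)"
      by (subst integral_add; (intro integrable_on_mult_right ix if')?) simp
    finally have "x T \<bullet> (X *v x T) - x 0 \<bullet> (X *v x 0)
        \<le> - (1 / 2) * integral {0..T} (\<lambda>t. (norm (x t))\<^sup>2) + 2 * k * integral {0..T} (\<lambda>t. (norm (f t))\<^sup>2)"
      using primitiveD(2)[OF p T] by linarith
    moreover have "x T \<bullet> (X *v x T) \<ge> 0" using X(1) by (simp add: sym_pos_semidef_def)
    moreover have "2 * (x 0 \<bullet> (X *v x 0)) \<le> (k + 1) * (norm (x 0))\<^sup>2"
    proof -
      have "0 \<le> (norm (x 0 - X *v x 0))\<^sup>2" by simp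
      then have "2 * (x 0 \<bullet> (X *v x 0)) \<le> (norm (x 0))\<^sup>2 + (norm (X *v x 0))\<^sup>2"
        unfolding power2_norm_eq_inner by (simp add: algebra_simps inner_commute)
      then show ?thesis using k(2)[of "x 0"] by (simp add: algebra_simps)
    qed
    moreover have "(k + 1) * (norm (x 0))\<^sup>2 \<le> K * (norm (x 0))\<^sup>2"
      using k(1) by (intro mult_right_mono) (auto simp: K_def)
    moreover have "4 * k * integral {0..T} (\<lambda>t. (norm (f t))\<^sup>2) \<le> K * integral {0..T} (\<lambda>t. (norm (f t))\<^sup>2)"
      using k(1) by (intro mult_right_mono integral_nonneg if') (auto simp: K_def)
    ultimately show ?thesis unfolding distrib_left by linarith
  qed
  moreover have "K \<ge> 0" using k(1) by (simp add: K_def)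
  ultimately show ?thesis using that by blast
qed

section \<open>The full information problem\<close>

definition trajectory :: "real^'n^'n \<Rightarrow> real^'d^'n \<Rightarrow> real^'w^'n \<Rightarrow>
    (real \<Rightarrow> real^'w) \<Rightarrow> (real \<Rightarrow> real^'d) \<Rightarrow> (real \<Rightarrow> real^'n) \<Rightarrow> bool" where
  "trajectory A B E w d x \<longleftrightarrow> x 0 = 0 \<and> primitive (\<lambda>t. A *v x t + B *v d t + E *v w t) x"

text \<open>The control \<open>d\<close> may depend on the whole disturbance \<open>w\<close>, its future included.\<close>

definition solvable :: "real^'n^'n \<Rightarrow> real^'d^'n \<Rightarrow> real^'w^'n \<Rightarrow> real^'n^'p \<Rightarrow> real^'w^'w \<Rightarrow> real \<Rightarrow> bool" where
  "solvable A B E H Q \<eta> \<longleftrightarrow>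
     (\<exists>\<epsilon>>0. \<forall>w\<in>L2. \<exists>d\<in>L2. \<exists>x. trajectory A B E w d x \<and> (\<lambda>t. H *v x t) \<in> L2 \<and>
       L2_norm_sq (\<lambda>t. H *v x t) + \<eta> * L2_norm_sq d
         \<le> integral {0..} (\<lambda>t. w t \<bullet> (Q *v w t)) - \<epsilon> * L2_norm_sq w)"

locale full_information =
  fixes A :: "real^'n^'n" and B :: "real^'d^'n" and E :: "real^'w^'n" and H :: "real^'n^'p"
    and Q Qi :: "real^'w^'w" and \<eta> q0 :: real
  assumes Q_sym: "transpose Q = Q" and Q_Qi: "Q ** Qi = mat 1" and Qi_sym: "transpose Qi = Qi"
    and q0: "q0 > 0" and Q_ge: "\<And>w. q0 * (norm w)\<^sup>2 \<le> w \<bullet> (Q *v w)"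
    and eta: "\<eta> > 0"
begin

text \<open>The indefinite quadratic coefficient of the Riccati equation: the maximizing disturbance
  contributes the positive part, the minimizing control the negative one.\<close>

definition G :: "real^'n^'n" where
  "G = E ** Qi ** transpose E - (1 / \<eta>) *\<^sub>R (B ** transpose B)"

definition riccati :: "real^'n^'n \<Rightarrow> bool" where
  "riccati P \<longleftrightarrow> transpose A ** P + P ** A + transpose H ** H + P ** G ** P = 0"

lemma G_apply: "G *v v = E *v (Qi *v (transpose E *v v)) - (1 / \<eta>) *\<^sub>R (B *v (transpose B *v v))"
  by (simp add: G_def matrix_vector_mult_diff_rdistrib scaleR_matrix_vector_assoc[symmetric]
      matrix_vector_mul_assoc[symmetric] del: transpose_matrix_vector)

lemma riccati_iff:
  "riccati P \<longleftrightarrow> (\<forall>v. transpose A *v (P *v v) + P *v (A *v v) + transpose H *v (H *v v) + P *v (G *v (P *v v)) = 0)"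
proof -
  have "(transpose A ** P + P ** A + transpose H ** H + P ** G ** P) *v v
     = transpose A *v (P *v v) + P *v (A *v v) + transpose H *v (H *v v) + P *v (G *v (P *v v))" for v
    by (simp add: matrix_vector_mult_add_rdistrib matrix_vector_mul_assoc[symmetric] del: transpose_matrix_vector)
  then show ?thesis unfolding riccati_def matrix_eq by (simp del: transpose_matrix_vector)
qed

lemma Q_inner_commute: "u \<bullet> (Q *v v) = v \<bullet> (Q *v u)"
  using dot_matrix_vector_transpose[of u Q v] by (simp add: Q_sym inner_commute)

lemma Q_Qi_apply: "Q *v (Qi *v v) = v"
  by (simp add: matrix_vector_mul_assoc Q_Qi)

lemma Q_le: obtains q1 where "q1 \<ge> 0" "\<And>w. w \<bullet> (Q *v w) \<le> q1 * (norm w)\<^sup>2"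
proof -
  obtain k where k: "k \<ge> 0" "\<And>v. (norm (Q *v v))\<^sup>2 \<le> k * (norm v)\<^sup>2" using matrix_vector_norm_le by blast
  have "w \<bullet> (Q *v w) \<le> (1 + k) * (norm w)\<^sup>2" for w
  proof -
    have "w \<bullet> (Q *v w) \<le> norm w * norm (Q *v w)" by (rule norm_cauchy_schwarz)
    also have "\<dots> \<le> (norm w)\<^sup>2 + (norm (Q *v w))\<^sup>2"
      using sum_squares_bound[of "norm w" "norm (Q *v w)"] mult_nonneg_nonneg[OF norm_ge_zero norm_ge_zero, of w "Q *v w"]
      by linarith
    finally show ?thesis using k(2)[of w] by (simp add: algebra_simps)
  qed
  then show ?thesis using that[of "1 + k"] k(1) by simp
qed

text \<open>The bracket added to the cost density is the derivative of
  \<open>x \<bullet> (P *v x)\<close> along the dynamics. The Riccati equation paired with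
  \<open>x\<close> cancels what is quadratic in \<open>x\<close> alone, leaving the squares of the
  deviations from the feedback control and from the worst disturbance.\<close>

lemma completion_of_squares:
  assumes P: "transpose P = P" "riccati P"
  shows "(norm (H *v x))\<^sup>2 + \<eta> * (norm d)\<^sup>2 - w \<bullet> (Q *v w)
      + ((A *v x + B *v d + E *v w) \<bullet> (P *v x) + x \<bullet> (P *v (A *v x + B *v d + E *v w)))
    = \<eta> * (norm (d + (1 / \<eta>) *\<^sub>R (transpose B *v (P *v x))))\<^sup>2
      - (w - Qi *v (transpose E *v (P *v x))) \<bullet> (Q *v (w - Qi *v (transpose E *v (P *v x))))"
proof -
  define p where "p = P *v x"
  define b where "b = transpose B *v p"
  define e where "e = transpose E *v p"
  have Ps: "u \<bullet> (P *v v) = (P *v u) \<bullet> v" for u v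
    using dot_matrix_vector_transpose[of u P v] P(1) by simp
  have Bd: "(B *v d) \<bullet> p = d \<bullet> b" and Ew: "(E *v w) \<bullet> p = w \<bullet> e"
    using dot_matrix_vector_transpose[of p B d] dot_matrix_vector_transpose[of p E w]
    by (simp_all add: b_def e_def inner_commute)
  have eq: "transpose A *v p + P *v (A *v x) + transpose H *v (H *v x) + P *v (G *v p) = 0"
    using P(2) unfolding riccati_iff p_def by blast
  have "x \<bullet> (transpose A *v p) = (A *v x) \<bullet> p" "x \<bullet> (transpose H *v (H *v x)) = (H *v x) \<bullet> (H *v x)"
    using dot_matrix_vector_transpose[of x "transpose A" p] dot_matrix_vector_transpose[of x "transpose H" "H *v x"]
    by (simp_all del: transpose_matrix_vector)
  moreover have "x \<bullet> (P *v (A *v x)) = (A *v x) \<bullet> p" "x \<bullet> (P *v (G *v p)) = p \<bullet> (G *v p)"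
    using Ps[of x "A *v x"] Ps[of x "G *v p"] by (simp_all add: p_def inner_commute)
  ultimately have 1: "2 * ((A *v x) \<bullet> p) + (norm (H *v x))\<^sup>2 + p \<bullet> (G *v p) = 0"
    using arg_cong[OF eq, of "\<lambda>v. x \<bullet> v"]
    by (simp add: inner_add_right power2_norm_eq_inner del: transpose_matrix_vector)
  have "p \<bullet> (E *v (Qi *v e)) = e \<bullet> (Qi *v e)" "p \<bullet> (B *v b) = b \<bullet> b"
    using dot_matrix_vector_transpose[of p E "Qi *v e"] dot_matrix_vector_transpose[of p B b]
    by (simp_all add: e_def b_def)
  then have 2: "p \<bullet> (G *v p) = e \<bullet> (Qi *v e) - (1 / \<eta>) * (b \<bullet> b)"
    by (simp add: G_apply e_def[symmetric] b_def[symmetric] inner_diff_right del: transpose_matrix_vector)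
  have 3: "\<eta> * (norm (d + (1 / \<eta>) *\<^sub>R b))\<^sup>2 = \<eta> * (norm d)\<^sup>2 + 2 * (d \<bullet> b) + (1 / \<eta>) * (b \<bullet> b)"
    using eta by (simp add: power2_norm_eq_inner inner_add_left inner_add_right inner_commute field_simps)
  have 4: "(w - Qi *v e) \<bullet> (Q *v (w - Qi *v e)) = w \<bullet> (Q *v w) - 2 * (w \<bullet> e) + e \<bullet> (Qi *v e)"
    using Q_inner_commute[of "Qi *v e" w]
    by (simp add: matrix_vector_mult_diff_distrib inner_diff_left inner_diff_right Q_Qi_apply inner_commute)
  have 5: "(A *v x + B *v d + E *v w) \<bullet> (P *v x) + x \<bullet> (P *v (A *v x + B *v d + E *v w))
     = 2 * ((A *v x) \<bullet> p) + 2 * (d \<bullet> b) + 2 * (w \<bullet> e)"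
  proof -
    have "x \<bullet> (P *v y) = y \<bullet> p" for y using Ps[of x y] by (simp add: p_def inner_commute)
    then show ?thesis
      unfolding p_def[symmetric] by (simp add: inner_add_left Bd Ew)
  qed
  show ?thesis
    unfolding 5 unfolding p_def[symmetric] b_def[symmetric] e_def[symmetric] 3 4 using 1 2 by linarith
qed

lemma solvable_if_riccati:
  assumes P: "sym_pos_semidef P" "riccati P" and stab: "Hurwitz (A + G ** P)"
  shows "solvable A B E H Q \<eta>"
proof -
  obtain K where K: "K \<ge> 0"
    "\<And>x f T. T \<ge> 0 \<Longrightarrow> loc_square_integrable f \<Longrightarrow> primitive (\<lambda>t. (A + G ** P) *v x t + f t) x \<Longrightarrow>
       integral {0..T} (\<lambda>t. (norm (x t))\<^sup>2) \<le> K * ((norm (x 0))\<^sup>2 + integral {0..T} (\<lambda>t. (norm (f t))\<^sup>2))"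
    using Hurwitz_L2_gain[OF stab] by blast
  define F where "F = Qi ** transpose E ** P"
  obtain c where c: "c \<ge> 0" "\<And>v. (norm (F *v v))\<^sup>2 \<le> c * (norm v)\<^sup>2" using matrix_vector_norm_le by blast
  obtain k where k: "k \<ge> 0" "\<And>v. (norm (E *v v))\<^sup>2 \<le> k * (norm v)\<^sup>2" using matrix_vector_norm_le by blast
  \<comment> \<open>From \<open>w = v + F x\<close>, the square of \<open>w\<close> is at most twice
    that of \<open>v\<close> plus \<open>2 * c\<close> times that of \<open>x\<close>, and the
    closed loop bounds the integral of the latter by \<open>K * k\<close> times that of
    \<open>v\<close>. So \<open>c'\<close> compares \<open>w\<close> with \<open>v\<close>, and
    \<epsilon> converts the dissipation \<open>q0\<close> in \<open>v\<close> into a margin in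
    \<open>w\<close>. That \<open>c'\<close> is at least 2 gives \<open>\<epsilon> \<le> q0\<close>,
    hence a nonnegative density \<open>?r\<close>.\<close>
  define c' where "c' = 2 + 2 * c * K * k"
  define \<epsilon> where "\<epsilon> = q0 / c'"
  have c': "c' \<ge> 2" using c(1) K(1) k(1) by (simp add: c'_def)
  then have eps: "\<epsilon> > 0" "\<epsilon> * c' = q0" "\<epsilon> \<le> q0" using q0 by (auto simp: \<epsilon>_def field_simps)
  have Psym: "transpose P = P" using P(1) by (simp add: sym_pos_semidef_def)
  show ?thesis unfolding solvable_def
  proof (intro exI[of _ \<epsilon>] conjI ballI eps(1))
    fix w :: "real \<Rightarrow> real^'w" assume w: "w \<in> L2"
    have lw: "loc_square_integrable w" by (rule L2_imp_loc_square_integrable[OF w])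
    define AF where "AF = A - (1 / \<eta>) *\<^sub>R (B ** transpose B ** P)"
    have "(\<lambda>t. E *v w t) absolutely_integrable_on {0..T}" for T
      by (intro loc_square_integrable_imp_absolutely_integrable loc_square_integrable_linear[OF lw]) simp
    then obtain x where x: "x 0 = 0" "primitive (\<lambda>t. AF *v x t + E *v w t) x"
      using linear_ode_primitive_exists[of "\<lambda>t. E *v w t" 0 AF] by blast
    define d where "d t = - (1 / \<eta>) *\<^sub>R (transpose B *v (P *v x t))" for t
    define v where "v t = w t - F *v x t" for t
    have x1: "AF *v x t + E *v w t = A *v x t + B *v d t + E *v w t" for t
      by (simp add: AF_def d_def matrix_vector_mult_diff_rdistrib scaleR_matrix_vector_assoc[symmetric]
          matrix_vector_mul_assoc[symmetric] matrix_vector_mult_scaleR linear_neg[OF matrix_vector_mul_linear]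
          del: transpose_matrix_vector)
    \<comment> \<open>The same trajectory expressed through \<open>v\<close> is governed by the
      matrix assumed Hurwitz, and this is the form to which the gain estimate applies.\<close>
    have x2: "A *v x t + B *v d t + E *v w t = (A + G ** P) *v x t + E *v v t" for t
      by (simp add: d_def v_def F_def matrix_vector_mult_add_rdistrib matrix_vector_mult_scaleR
          matrix_vector_mul_assoc[symmetric] G_apply matrix_vector_mult_diff_distrib
          linear_neg[OF matrix_vector_mul_linear] del: transpose_matrix_vector)
    have px: "primitive (\<lambda>t. A *v x t + B *v d t + E *v w t) x" using x(2) unfolding x1 .
    have px2: "primitive (\<lambda>t. (A + G ** P) *v x t + E *v v t) x" using px unfolding x2 .
    have cx: "continuous_on {0..T} x" for T by (rule primitive_continuous_on[OF px])
    have lx: "loc_square_integrable x" by (rule primitive_loc_square_integrable[OF px])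
    have lv: "loc_square_integrable v" unfolding v_def[abs_def]
      by (intro loc_square_integrable_diff lw loc_square_integrable_linear[OF lx]) simp
    have cH: "continuous_on {0..T} (\<lambda>t. H *v x t)" and cd: "continuous_on {0..T} d" for T
      unfolding d_def[abs_def]
      by (intro continuous_intros bounded_linear.continuous_on[OF matrix_vector_mul_bounded_linear] cx)+
    let ?g = "\<lambda>t. (norm (H *v x t))\<^sup>2 + \<eta> * (norm (d t))\<^sup>2"
    let ?r = "\<lambda>t. w t \<bullet> (Q *v w t) - \<epsilon> * (norm (w t))\<^sup>2"
    have ig: "?g integrable_on {0..T}" for T
      by (intro integrable_continuous_real continuous_intros cH cd)
    have iQ: "(\<lambda>t. w t \<bullet> (Q *v w t)) integrable_on {0..T}" "(\<lambda>t. v t \<bullet> (Q *v v t)) integrable_on {0..T}" for T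
      by (intro loc_square_integrable_inner lw lv loc_square_integrable_linear[OF lw]
          loc_square_integrable_linear[OF lv]; simp)+
    note inorm = loc_square_integrable_norm[OF lw] loc_square_integrable_norm[OF lv] loc_square_integrable_norm[OF lx]
    have g0: "0 \<le> ?g t" for t using eta by simp
    have r0: "0 \<le> ?r t" for t
      using Q_ge[of "w t"] mult_right_mono[OF eps(3), of "(norm (w t))\<^sup>2"] by simp
    have fin: "integral {0..T} ?g \<le> integral {0..T} ?r" if T: "T \<ge> 0" for T
    proof -
      let ?h = "\<lambda>t. (A *v x t + B *v d t + E *v w t) \<bullet> (P *v x t) + x t \<bullet> (P *v (A *v x t + B *v d t + E *v w t))"
      have p: "primitive ?h (\<lambda>t. x t \<bullet> (P *v x t))"
        by (rule primitive_inner[OF px primitive_linear[OF px matrix_vector_mul_bounded_linear]])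
      have ih: "?h integrable_on {0..T}"
        using primitiveD(1)[OF p] set_lebesgue_integral_eq_integral(1) by blast
      have "?h t = w t \<bullet> (Q *v w t) - v t \<bullet> (Q *v v t) - ?g t" for t
        using completion_of_squares[OF Psym P(2), of "x t" "d t" "w t"]
        by (simp add: d_def v_def F_def matrix_vector_mul_assoc[symmetric] del: transpose_matrix_vector)
      then have "integral {0..T} ?h
          = integral {0..T} (\<lambda>t. w t \<bullet> (Q *v w t)) - integral {0..T} (\<lambda>t. v t \<bullet> (Q *v v t)) - integral {0..T} ?g"
        by (simp add: integral_diff integrable_diff iQ ig)
      moreover have "integral {0..T} ?h \<ge> 0"
      proof -
        have "x T \<bullet> (P *v x T) \<ge> 0" using P(1) by (simp add: sym_pos_semidef_def)
        moreover have "x 0 \<bullet> (P *v x 0) = 0" by (simp add: x(1))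
        ultimately show ?thesis using primitiveD(2)[OF p T] by linarith
      qed
      moreover have "q0 * integral {0..T} (\<lambda>t. (norm (v t))\<^sup>2) \<le> integral {0..T} (\<lambda>t. v t \<bullet> (Q *v v t))"
        unfolding integral_mult_right[symmetric]
        by (intro integral_le integrable_on_mult_right inorm iQ Q_ge)
      moreover have "integral {0..T} (\<lambda>t. (norm (w t))\<^sup>2) \<le> c' * integral {0..T} (\<lambda>t. (norm (v t))\<^sup>2)"
      proof -
        have "(norm (w t))\<^sup>2 \<le> 2 * (norm (v t))\<^sup>2 + 2 * c * (norm (x t))\<^sup>2" for t
          using norm_add_sq_le[of "v t" "F *v x t"] c(2)[of "x t"] by (simp add: v_def)
        then have "integral {0..T} (\<lambda>t. (norm (w t))\<^sup>2)
            \<le> integral {0..T} (\<lambda>t. 2 * (norm (v t))\<^sup>2 + 2 * c * (norm (x t))\<^sup>2)"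
          by (intro integral_le integrable_add integrable_on_mult_right inorm)
        also have "\<dots> = 2 * integral {0..T} (\<lambda>t. (norm (v t))\<^sup>2) + 2 * c * integral {0..T} (\<lambda>t. (norm (x t))\<^sup>2)"
          by (subst integral_add; (intro integrable_on_mult_right inorm)?) simp
        finally have 1: "integral {0..T} (\<lambda>t. (norm (w t))\<^sup>2)
            \<le> 2 * integral {0..T} (\<lambda>t. (norm (v t))\<^sup>2) + 2 * c * integral {0..T} (\<lambda>t. (norm (x t))\<^sup>2)" .
        have 2: "integral {0..T} (\<lambda>t. (norm (x t))\<^sup>2) \<le> K * integral {0..T} (\<lambda>t. (norm (E *v v t))\<^sup>2)"
          using K(2)[OF T loc_square_integrable_linear[OF lv matrix_vector_mul_bounded_linear] px2] x(1) by simp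
        have "integral {0..T} (\<lambda>t. (norm (E *v v t))\<^sup>2) \<le> integral {0..T} (\<lambda>t. k * (norm (v t))\<^sup>2)"
          by (intro integral_le integrable_on_mult_right inorm k(2)
              loc_square_integrable_norm[OF loc_square_integrable_linear[OF lv matrix_vector_mul_bounded_linear]])
        then have "K * integral {0..T} (\<lambda>t. (norm (E *v v t))\<^sup>2) \<le> K * (k * integral {0..T} (\<lambda>t. (norm (v t))\<^sup>2))"
          using K(1) by (intro mult_left_mono) auto
        with 2 have "2 * c * integral {0..T} (\<lambda>t. (norm (x t))\<^sup>2)
            \<le> 2 * c * (K * (k * integral {0..T} (\<lambda>t. (norm (v t))\<^sup>2)))"
          using c(1) by (intro mult_left_mono) auto
        with 1 show ?thesis by (simp add: c'_def algebra_simps)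
      qed
      then have "\<epsilon> * integral {0..T} (\<lambda>t. (norm (w t))\<^sup>2) \<le> q0 * integral {0..T} (\<lambda>t. (norm (v t))\<^sup>2)"
        using mult_left_mono[of _ _ \<epsilon>] eps by (metis less_imp_le mult.assoc)
      moreover have "integral {0..T} ?r = integral {0..T} (\<lambda>t. w t \<bullet> (Q *v w t)) - \<epsilon> * integral {0..T} (\<lambda>t. (norm (w t))\<^sup>2)"
        by (simp add: integral_diff iQ integrable_on_mult_right inorm)
      ultimately show ?thesis by linarith
    qed
    have iw: "(\<lambda>t. (norm (w t))\<^sup>2) integrable_on {0..}" using w L2_iff by blast
    have iQw: "(\<lambda>t. w t \<bullet> (Q *v w t)) integrable_on {0..}"
    proof -
      obtain q1 where q1: "q1 \<ge> 0" "\<And>w. w \<bullet> (Q *v w) \<le> q1 * (norm w)\<^sup>2" using Q_le by blast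
      show ?thesis
      proof (rule halfline_integrable_if_bounded(1))
        show "0 \<le> w t \<bullet> (Q *v w t)" for t using Q_ge[of "w t"] q0 by (meson mult_nonneg_nonneg less_imp_le order_trans zero_le_power2)
        show "integral {0..T} (\<lambda>t. w t \<bullet> (Q *v w t)) \<le> q1 * integral {0..} (\<lambda>t. (norm (w t))\<^sup>2)" if "T \<ge> 0" for T
        proof -
          have "integral {0..T} (\<lambda>t. w t \<bullet> (Q *v w t)) \<le> integral {0..T} (\<lambda>t. q1 * (norm (w t))\<^sup>2)"
            by (intro integral_le integrable_on_mult_right inorm iQ q1)
          also have "\<dots> = q1 * integral {0..T} (\<lambda>t. (norm (w t))\<^sup>2)" by simp
          also have "\<dots> \<le> q1 * integral {0..} (\<lambda>t. (norm (w t))\<^sup>2)"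
            by (intro mult_left_mono integral_Icc_le_halfline iw q1(1)) simp
          finally show ?thesis .
        qed
      qed (rule iQ)
    qed
    have ir: "?r integrable_on {0..}" by (intro integrable_diff iQw integrable_on_mult_right iw)
    have bnd: "integral {0..T} ?g \<le> integral {0..} ?r" if "T \<ge> 0" for T
      using fin[OF that] integral_Icc_le_halfline[of ?r T, OF r0 ir] by linarith
    note g = halfline_integrable_if_bounded[of ?g, OF g0 ig bnd]
    have cH': "continuous_on {0..} (\<lambda>t. H *v x t)" and cd': "continuous_on {0..} d"
    proof -
      have "continuous_on {0..} x"
        unfolding continuous_on_eq_continuous_within
      proof
        fix t :: real assume t: "t \<in> {0..}"
        have "at t within {0..} = at t within {0..t + 1}"
          by (rule at_within_nhd[of _ "{..<t + 1}"]) auto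
        moreover have "continuous (at t within {0..t + 1}) x"
          using cx[of "t + 1"] t unfolding continuous_on_eq_continuous_within by simp
        ultimately show "continuous (at t within {0..}) x" by simp
      qed
      then show "continuous_on {0..} (\<lambda>t. H *v x t)" "continuous_on {0..} d"
        unfolding d_def[abs_def]
        by (intro continuous_intros bounded_linear.continuous_on[OF matrix_vector_mul_bounded_linear]; simp)+
    qed
    have mH: "(\<lambda>t. H *v x t) \<in> borel_measurable (lebesgue_on {0..})" and md: "d \<in> borel_measurable (lebesgue_on {0..})"
      by (rule continuous_imp_measurable_on_sets_lebesgue; (rule cH' cd')?; simp)+
    have iH: "(\<lambda>t. (norm (H *v x t))\<^sup>2) integrable_on {0..}"
    proof (rule measurable_bounded_by_integrable_imp_integrable[OF _ g(1)])
      show "(\<lambda>t. (norm (H *v x t))\<^sup>2) \<in> borel_measurable (lebesgue_on {0..})" using mH by simp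
    qed (use eta in auto)
    have id: "(\<lambda>t. (norm (d t))\<^sup>2) integrable_on {0..}"
    proof (rule measurable_bounded_by_integrable_imp_integrable)
      show "(\<lambda>t. (1 / \<eta>) * ?g t) integrable_on {0..}" by (rule integrable_on_mult_right[OF g(1)])
      show "(\<lambda>t. (norm (d t))\<^sup>2) \<in> borel_measurable (lebesgue_on {0..})" using md by simp
    qed (use eta in \<open>auto simp: field_simps\<close>)
    have HL2: "(\<lambda>t. H *v x t) \<in> L2" and dL2: "d \<in> L2" using L2_iff mH md iH id by blast+
    show "\<exists>d\<in>L2. \<exists>x. trajectory A B E w d x \<and> (\<lambda>t. H *v x t) \<in> L2 \<and>
       L2_norm_sq (\<lambda>t. H *v x t) + \<eta> * L2_norm_sq d
         \<le> integral {0..} (\<lambda>t. w t \<bullet> (Q *v w t)) - \<epsilon> * L2_norm_sq w"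
    proof (intro bexI[OF _ dL2] exI[of _ x] conjI HL2)
      show "trajectory A B E w d x" using x(1) px by (simp add: trajectory_def)
      have "integral {0..} ?g = L2_norm_sq (\<lambda>t. H *v x t) + \<eta> * L2_norm_sq d"
        using iH id by (simp add: L2_norm_sq_eq_integral HL2 dL2 integral_add integrable_on_mult_right)
      moreover have "integral {0..} ?r = integral {0..} (\<lambda>t. w t \<bullet> (Q *v w t)) - \<epsilon> * L2_norm_sq w"
        using iQw iw by (simp add: L2_norm_sq_eq_integral w integral_diff integrable_on_mult_right)
      ultimately show "L2_norm_sq (\<lambda>t. H *v x t) + \<eta> * L2_norm_sq d
         \<le> integral {0..} (\<lambda>t. w t \<bullet> (Q *v w t)) - \<epsilon> * L2_norm_sq w" using g(2) by simp
    qed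
  qed
qed

end

section \<open>The finite-horizon cost and the Hamiltonian flow\<close>

lemma mono_bounded_convergent_at_top:
  fixes f :: "real \<Rightarrow> real"
  assumes mono: "\<And>s t. 0 \<le> s \<Longrightarrow> s \<le> t \<Longrightarrow> f s \<le> f t" and bdd: "\<And>t. 0 \<le> t \<Longrightarrow> f t \<le> C"
  shows "\<exists>l. (f \<longlongrightarrow> l) at_top"
proof (intro exI order_tendstoI)
  have bdd': "bdd_above (f ` {0..})" using bdd by (intro bdd_aboveI[of _ C]) auto
  show "\<forall>\<^sub>F t in at_top. a < f t" if lt: "a < Sup (f ` {0..})" for a
  proof -
    obtain s where "s \<ge> 0" "a < f s" using less_cSupD[OF _ lt] by auto
    then show ?thesis
      using mono by (auto simp: eventually_at_top_linorder intro!: exI[of _ s] intro: less_le_trans)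
  qed
  show "\<forall>\<^sub>F t in at_top. f t < a" if "Sup (f ` {0..}) < a" for a
    using eventually_ge_at_top[of 0] by eventually_elim (use that cSup_upper[OF _ bdd'] in fastforce)
qed

text \<open>Extension by zero makes a signal on \<open>{0..T}\<close> an admissible disturbance in
  \<open>L2\<close>, even if the signal itself grows.\<close>

definition cutoff :: "real \<Rightarrow> (real \<Rightarrow> 'a::euclidean_space) \<Rightarrow> real \<Rightarrow> 'a" where
  "cutoff T u t = (if t \<in> {0..T} then u t else 0)"

lemma cutoff_L2:
  assumes "loc_square_integrable u"
  shows "cutoff T u \<in> L2"
  unfolding L2_iff
proof
  have "(\<lambda>t. if t \<in> {0..T} then u t else 0) \<in> borel_measurable lebesgue"
    using assms unfolding loc_square_integrable_def by (intro borel_measurable_if_I) auto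
  then show "cutoff T u \<in> borel_measurable (lebesgue_on {0..})"
    unfolding cutoff_def[abs_def] by (rule measurable_restrict_space1)
  have "(\<lambda>t. (norm (cutoff T u t))\<^sup>2) = (\<lambda>t. if t \<in> {0..T} then (norm (u t))\<^sup>2 else 0)"
    by (auto simp: cutoff_def)
  moreover have "{0..T} \<inter> {0..} = {0..T}" by auto
  ultimately show "(\<lambda>t. (norm (cutoff T u t))\<^sup>2) integrable_on {0..}"
    using loc_square_integrable_norm[OF assms, of T] by (simp only: integrable_restrict_Int)
qed

context full_information
begin

text \<open>The three signals are not tied by the dynamics, so a disturbance may be exchanged for
  another one that agrees with it on the horizon.\<close>

definition cost :: "real \<Rightarrow> (real \<Rightarrow> real^'n) \<Rightarrow> (real \<Rightarrow> real^'w) \<Rightarrow> (real \<Rightarrow> real^'d) \<Rightarrow> real" where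
  "cost T x w d = integral {0..T} (\<lambda>t. (norm (H *v x t))\<^sup>2 + \<eta> * (norm (d t))\<^sup>2 - w t \<bullet> (Q *v w t))"

lemma cost_integrable:
  assumes "loc_square_integrable x" "loc_square_integrable w" "loc_square_integrable d"
  shows "(\<lambda>t. (norm (H *v x t))\<^sup>2) integrable_on {0..T}" "(\<lambda>t. (norm (d t))\<^sup>2) integrable_on {0..T}"
    "(\<lambda>t. w t \<bullet> (Q *v w t)) integrable_on {0..T}"
    "(\<lambda>t. (norm (H *v x t))\<^sup>2 + \<eta> * (norm (d t))\<^sup>2 - w t \<bullet> (Q *v w t)) integrable_on {0..T}"
    "cost T x w d = integral {0..T} (\<lambda>t. (norm (H *v x t))\<^sup>2) + \<eta> * integral {0..T} (\<lambda>t. (norm (d t))\<^sup>2)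
       - integral {0..T} (\<lambda>t. w t \<bullet> (Q *v w t))"
proof -
  show 1: "(\<lambda>t. (norm (H *v x t))\<^sup>2) integrable_on {0..T}" "(\<lambda>t. (norm (d t))\<^sup>2) integrable_on {0..T}"
    by (intro loc_square_integrable_norm loc_square_integrable_linear[OF assms(1)] assms; simp)+
  show 2: "(\<lambda>t. w t \<bullet> (Q *v w t)) integrable_on {0..T}"
    by (intro loc_square_integrable_inner assms loc_square_integrable_linear[OF assms(2)]) simp
  show "(\<lambda>t. (norm (H *v x t))\<^sup>2 + \<eta> * (norm (d t))\<^sup>2 - w t \<bullet> (Q *v w t)) integrable_on {0..T}"
    by (intro integrable_diff integrable_add integrable_on_mult_right 1 2)
  show "cost T x w d = integral {0..T} (\<lambda>t. (norm (H *v x t))\<^sup>2) + \<eta> * integral {0..T} (\<lambda>t. (norm (d t))\<^sup>2)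
       - integral {0..T} (\<lambda>t. w t \<bullet> (Q *v w t))"
    unfolding cost_def using 1 2
    by (simp add: integral_diff integral_add integrable_add integrable_on_mult_right)
qed

text \<open>The Hamiltonian system of the game. A matrix \<open>P\<close> solves the Riccati
  equation exactly when the graph of \<open>P\<close> is invariant under it.\<close>

definition Ham :: "(real^'n) \<times> (real^'n) \<Rightarrow> (real^'n) \<times> (real^'n)" where
  "Ham z = (A *v fst z + G *v snd z, - (transpose H *v (H *v fst z)) - transpose A *v snd z)"

lemma linear_Ham: "linear Ham"
  by (intro linearI)
     (simp_all add: Ham_def matrix_vector_right_distrib matrix_vector_mult_scaleR algebra_simps
       del: transpose_matrix_vector)

abbreviation state :: "(real^'n) \<times> (real^'n) \<Rightarrow> real \<Rightarrow> real^'n" where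
  "state z t \<equiv> fst (flow Ham z t)"

abbreviation costate :: "(real^'n) \<times> (real^'n) \<Rightarrow> real \<Rightarrow> real^'n" where
  "costate z t \<equiv> snd (flow Ham z t)"

text \<open>\<open>wopt\<close> and \<open>dopt\<close> are the stationary points in
  \<open>w\<close> and \<open>d\<close> of the cost density plus
  \<open>2 * (p \<bullet> (A *v x + B *v d + E *v w))\<close>, where \<open>p\<close> is the
  costate: a maximum in \<open>w\<close>, a minimum in \<open>d\<close>.\<close>

definition wopt :: "(real^'n) \<times> (real^'n) \<Rightarrow> real \<Rightarrow> real^'w" where
  "wopt z t = Qi *v (transpose E *v costate z t)"

definition dopt :: "(real^'n) \<times> (real^'n) \<Rightarrow> real \<Rightarrow> real^'d" where
  "dopt z t = - (1 / \<eta>) *\<^sub>R (transpose B *v costate z t)"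

lemma flow_Ham_0: "flow Ham z 0 = z"
  by (rule flow_0[OF linear_Ham])

lemma state_deriv:
  "(state z has_vector_derivative A *v state z t + G *v costate z t) (at t)"
  using bounded_linear.has_vector_derivative[OF bounded_linear_fst flow_deriv[OF linear_Ham, of z t]]
  by (simp add: Ham_def)

lemma costate_deriv:
  "(costate z has_vector_derivative - (transpose H *v (H *v state z t)) - transpose A *v costate z t) (at t)"
  using bounded_linear.has_vector_derivative[OF bounded_linear_snd flow_deriv[OF linear_Ham, of z t]]
  by (simp add: Ham_def)

lemma state_continuous: "continuous_on S (state z)" and costate_continuous: "continuous_on S (costate z)"
  by (intro continuous_intros flow_continuous_on[OF linear_Ham])+

lemma wopt_continuous: "continuous_on S (wopt z)" and dopt_continuous: "continuous_on S (dopt z)"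
  unfolding wopt_def[abs_def] dopt_def[abs_def]
  by (intro continuous_intros bounded_linear.continuous_on[OF matrix_vector_mul_bounded_linear]
      costate_continuous)+

lemma state_eq: "A *v state z t + G *v costate z t = A *v state z t + B *v dopt z t + E *v wopt z t"
  by (simp add: G_apply wopt_def dopt_def matrix_vector_mult_scaleR linear_neg[OF matrix_vector_mul_linear]
      del: transpose_matrix_vector)

lemma state_primitive: "primitive (\<lambda>t. A *v state z t + B *v dopt z t + E *v wopt z t) (state z)"
  unfolding state_eq[symmetric]
  by (intro primitive_has_vector_derivative state_deriv continuous_intros
      bounded_linear.continuous_on[OF matrix_vector_mul_bounded_linear] state_continuous costate_continuous)

lemma costate_primitive: "primitive (\<lambda>t. - (transpose H *v (H *v state z t)) - transpose A *v costate z t) (costate z)"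
  by (intro primitive_has_vector_derivative costate_deriv continuous_intros
      bounded_linear.continuous_on[OF matrix_vector_mul_bounded_linear] state_continuous costate_continuous)

lemma opt_loc_square_integrable:
  "loc_square_integrable (state z)" "loc_square_integrable (wopt z)" "loc_square_integrable (dopt z)"
  by (intro loc_square_integrable_continuous state_continuous wopt_continuous dopt_continuous)+

text \<open>The pairing of a trajectory with the costate decreases at the rate of the first variation of the
  cost in the direction of that trajectory.\<close>

lemma costate_pairing:
  assumes x: "primitive (\<lambda>t. A *v x t + B *v d t + E *v w t) x" and T: "T \<ge> 0" and pT: "costate z T = 0"
  shows "integral {0..T} (\<lambda>t. (H *v x t) \<bullet> (H *v state z t) + \<eta> * (d t \<bullet> dopt z t) - w t \<bullet> (Q *v wopt z t))
      = x 0 \<bullet> snd z"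
    and "(\<lambda>t. (H *v x t) \<bullet> (H *v state z t) + \<eta> * (d t \<bullet> dopt z t) - w t \<bullet> (Q *v wopt z t))
      integrable_on {0..T}"
proof -
  let ?f = "\<lambda>t. (A *v x t + B *v d t + E *v w t) \<bullet> costate z t
      + x t \<bullet> (- (transpose H *v (H *v state z t)) - transpose A *v costate z t)"
  let ?g = "\<lambda>t. (H *v x t) \<bullet> (H *v state z t) + \<eta> * (d t \<bullet> dopt z t) - w t \<bullet> (Q *v wopt z t)"
  have p: "primitive ?f (\<lambda>t. x t \<bullet> costate z t)"
    by (rule primitive_inner[OF x costate_primitive])
  have eq: "?g t = - ?f t" for t
  proof -
    have "(A *v x t) \<bullet> costate z t = x t \<bullet> (transpose A *v costate z t)"
      "x t \<bullet> (transpose H *v (H *v state z t)) = (H *v x t) \<bullet> (H *v state z t)"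
      using dot_matrix_vector_transpose[of "x t" "transpose A" "costate z t"]
        dot_matrix_vector_transpose[of "x t" "transpose H" "H *v state z t"] by (simp_all del: transpose_matrix_vector)
    moreover have "\<eta> * (d t \<bullet> dopt z t) = - ((B *v d t) \<bullet> costate z t)"
      using dot_matrix_vector_transpose[of "costate z t" B "d t"] eta
      by (simp add: dopt_def inner_commute del: transpose_matrix_vector)
    moreover have "w t \<bullet> (Q *v wopt z t) = (E *v w t) \<bullet> costate z t"
      using dot_matrix_vector_transpose[of "costate z t" E "w t"]
      by (simp add: wopt_def Q_Qi_apply inner_commute del: transpose_matrix_vector)
    ultimately show ?thesis by (simp add: inner_add_left inner_diff_right del: transpose_matrix_vector)
  qed
  have fi: "?f integrable_on {0..T}"
    using primitiveD(1)[OF p] set_lebesgue_integral_eq_integral(1) by blast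
  show "?g integrable_on {0..T}" unfolding eq using fi by (rule integrable_neg)
  have "x T \<bullet> costate z T = x 0 \<bullet> costate z 0 + integral {0..T} ?f" by (rule primitiveD(2)[OF p T])
  moreover have "integral {0..T} ?g = - integral {0..T} ?f" by (simp only: eq integral_neg)
  ultimately show "integral {0..T} ?g = x 0 \<bullet> snd z" by (simp add: pT flow_Ham_0)
qed

text \<open>For a quadratic cost, the first variation in the direction of the critical trajectory
  itself is the cost, up to the factor 2 left out in the pairing.\<close>

lemma cost_opt:
  assumes "T \<ge> 0" "costate z T = 0"
  shows "cost T (state z) (wopt z) (dopt z) = fst z \<bullet> snd z"
  using costate_pairing(1)[OF state_primitive assms]
  by (simp add: cost_def power2_norm_eq_inner flow_Ham_0)

text \<open>The first variation vanishes, so only the second-order term of the quadratic cost remains.\<close>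

lemma cost_opt_add:
  assumes x: "primitive (\<lambda>t. A *v x t + B *v d t + E *v w t) x" and x0: "x 0 = fst z"
    and w: "loc_square_integrable w" and d: "loc_square_integrable d"
    and T: "T \<ge> 0" and pT: "costate z T = 0"
  shows "cost T x w d = fst z \<bullet> snd z
    + cost T (\<lambda>t. x t - state z t) (\<lambda>t. w t - wopt z t) (\<lambda>t. d t - dopt z t)"
proof -
  let ?x = "\<lambda>t. x t - state z t" and ?w = "\<lambda>t. w t - wopt z t" and ?d = "\<lambda>t. d t - dopt z t"
  let ?g = "\<lambda>t. (H *v ?x t) \<bullet> (H *v state z t) + \<eta> * (?d t \<bullet> dopt z t) - ?w t \<bullet> (Q *v wopt z t)"
  let ?c = "\<lambda>x w d t. (norm (H *v x t))\<^sup>2 + \<eta> * (norm (d t))\<^sup>2 - w t \<bullet> (Q *v w t)"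
  have p: "primitive (\<lambda>t. A *v ?x t + B *v ?d t + E *v ?w t) ?x"
    using primitive_diff[OF x state_primitive[of z]]
    by (simp add: matrix_vector_mult_diff_distrib algebra_simps)
  have l: "loc_square_integrable ?x" "loc_square_integrable ?w" "loc_square_integrable ?d"
    by (intro loc_square_integrable_diff opt_loc_square_integrable primitive_loc_square_integrable[OF x] w d)+
  have g: "integral {0..T} ?g = 0" "?g integrable_on {0..T}"
    using costate_pairing[OF p T pT] x0 by (simp_all add: flow_Ham_0)
  have i: "?c (state z) (wopt z) (dopt z) integrable_on {0..T}" "?c ?x ?w ?d integrable_on {0..T}"
    by (intro cost_integrable(4) opt_loc_square_integrable l)+
  have "?c x w d t = ?c (state z) (wopt z) (dopt z) t + ?c ?x ?w ?d t + 2 * ?g t" for t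
  proof -
    have arith: "a = a0 + a1 + 2 * a2 \<Longrightarrow> b = b0 + b1 + 2 * b2 \<Longrightarrow> c = c0 + c1 + 2 * c2 \<Longrightarrow>
        a + b - c = a0 + b0 - c0 + (a1 + b1 - c1) + 2 * (a2 + b2 - c2)"
      for a a0 a1 a2 b b0 b1 b2 c c0 c1 c2 :: real by simp
    have nd: "(norm (a + b))\<^sup>2 = (norm a)\<^sup>2 + (norm b)\<^sup>2 + 2 * (b \<bullet> a)" for a b :: "real^'k"
      by (simp add: power2_norm_eq_inner inner_add_left inner_add_right inner_commute)
    have "(norm (H *v x t))\<^sup>2 = (norm (H *v state z t))\<^sup>2 + (norm (H *v ?x t))\<^sup>2
        + 2 * ((H *v ?x t) \<bullet> (H *v state z t))"
      using nd[of "H *v state z t" "H *v ?x t"] by (simp add: matrix_vector_mult_diff_distrib)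
    moreover have "\<eta> * (norm (d t))\<^sup>2
        = \<eta> * (norm (dopt z t))\<^sup>2 + \<eta> * (norm (?d t))\<^sup>2 + 2 * (\<eta> * (?d t \<bullet> dopt z t))"
    proof -
      have "(norm (dopt z t + ?d t))\<^sup>2 = (norm (dopt z t))\<^sup>2 + (norm (?d t))\<^sup>2 + 2 * (?d t \<bullet> dopt z t)"
        by (simp only: power2_norm_eq_inner inner_add_left inner_add_right inner_commute)
      then have "(norm (d t))\<^sup>2 = (norm (dopt z t))\<^sup>2 + (norm (?d t))\<^sup>2 + 2 * (?d t \<bullet> dopt z t)" by simp
      then show ?thesis by (simp only: distrib_left mult.left_commute)
    qed
    moreover have "w t \<bullet> (Q *v w t) = wopt z t \<bullet> (Q *v wopt z t) + ?w t \<bullet> (Q *v ?w t) + 2 * (?w t \<bullet> (Q *v wopt z t))"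
      using Q_inner_commute[of "wopt z t" "w t"]
      by (simp add: matrix_vector_mult_diff_distrib inner_diff_left inner_diff_right)
    ultimately show ?thesis by (rule arith)
  qed
  then have "cost T x w d = integral {0..T} (\<lambda>t. ?c (state z) (wopt z) (dopt z) t + ?c ?x ?w ?d t + 2 * ?g t)"
    unfolding cost_def by presburger
  also have "\<dots> = cost T (state z) (wopt z) (dopt z) + cost T ?x ?w ?d + 2 * integral {0..T} ?g"
    unfolding cost_def by (subst integral_add; (subst integral_add)?; (intro integrable_add integrable_on_mult_right i g)?)
      (simp only: integral_mult_right)
  finally show ?thesis using cost_opt[OF T pT] g(1) by simp
qed

end

section \<open>Bounds on critical solutions, uniform in the horizon\<close>

lemma norm_add_sq_le_weighted:
  fixes a b :: "'a::real_inner"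
  assumes "\<kappa> > 0"
  shows "(norm (a + b))\<^sup>2 \<le> (1 + \<kappa>) * (norm a)\<^sup>2 + (1 + 1 / \<kappa>) * (norm b)\<^sup>2"
proof -
  have "0 \<le> \<kappa> * (norm (a - (1 / \<kappa>) *\<^sub>R b))\<^sup>2" using assms by simp
  also have "\<dots> = \<kappa> * (norm a)\<^sup>2 - 2 * (a \<bullet> b) + (1 / \<kappa>) * (norm b)\<^sup>2"
  proof -
    have "(norm (a - (1 / \<kappa>) *\<^sub>R b))\<^sup>2
        = (norm a)\<^sup>2 - 2 * (1 / \<kappa>) * (a \<bullet> b) + (1 / \<kappa>)\<^sup>2 * (norm b)\<^sup>2"
      unfolding power2_norm_eq_inner
      by (simp add: inner_diff_left inner_diff_right inner_commute power2_eq_square)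
    then show ?thesis using assms by (simp add: field_simps power2_eq_square)
  qed
  finally show ?thesis
    by (simp add: power2_norm_eq_inner inner_add_left inner_add_right inner_commute algebra_simps)
qed

text \<open>\<open>solvable_horizon\<close> is what \<open>solvable\<close> says about disturbances
  that stop at \<open>T\<close>: afterwards the density is nonnegative, so cutting the integrals off
  at \<open>T\<close> preserves the inequality. The margin \<epsilon> is fixed once and does not
  depend on \<open>T\<close>.\<close>

locale strictly_solvable = full_information A B E H Q Qi \<eta> q0
  for A :: "real^'n^'n" and B :: "real^'d^'n" and E :: "real^'w^'n" and H :: "real^'n^'p"
    and Q Qi :: "real^'w^'w" and \<eta> q0 :: real +
  fixes \<epsilon> :: real
  assumes A_Hurwitz: "Hurwitz A" and eps: "\<epsilon> > 0"
    and solvable_horizon: "\<And>T w. T \<ge> 0 \<Longrightarrow> loc_square_integrable w \<Longrightarrow>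
      \<exists>d x. loc_square_integrable d \<and> trajectory A B E (cutoff T w) d x \<and>
        cost T x w d \<le> - \<epsilon> * integral {0..T} (\<lambda>t. (norm (w t))\<^sup>2)"
begin

text \<open>Applied to the second-order term of \<open>cost_opt_add\<close> when two processes share
  the disturbance: deviating from the critical control alone never lowers the cost. If the density
  is not integrable, its integral is 0 by convention, so no regularity is assumed.\<close>

lemma cost_nonneg_if_no_disturbance:
  assumes "\<And>t. t \<in> {0..T} \<Longrightarrow> w t = 0"
  shows "cost T x w d \<ge> 0"
proof -
  have "cost T x w d = integral {0..T} (\<lambda>t. (norm (H *v x t))\<^sup>2 + \<eta> * (norm (d t))\<^sup>2)"
    unfolding cost_def by (rule integral_cong) (simp add: assms)
  also have "\<dots> \<ge> 0"
  proof (cases "(\<lambda>t. (norm (H *v x t))\<^sup>2 + \<eta> * (norm (d t))\<^sup>2) integrable_on {0..T}")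
    case True
    then show ?thesis using eta by (intro integral_nonneg) auto
  qed (simp add: not_integrable_integral)
  finally show ?thesis .
qed

text \<open>Against the critical disturbance, the control granted by the hypothesis is played from 0
  and the free response \<open>?h\<close> is added to meet the initial state. This control is no
  cheaper than the critical one, so the critical value \<open>fst z \<bullet> snd z\<close> lies
  below its cost; the hypothesis puts that cost below a negative multiple of the energy of the
  disturbance, up to terms in \<open>?h\<close>. The result bounds the value and, once the value is
  known to be nonnegative, the disturbance.\<close>

lemma wopt_bound:
  obtains C where "C \<ge> 0" "\<And>T z. T \<ge> 0 \<Longrightarrow> costate z T = 0 \<Longrightarrow>
    (\<epsilon> / 2) * integral {0..T} (\<lambda>t. (norm (wopt z t))\<^sup>2) + fst z \<bullet> snd z \<le> C * (norm (fst z))\<^sup>2"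
proof -
  obtain q1 where q1: "q1 \<ge> 0" "\<And>w. w \<bullet> (Q *v w) \<le> q1 * (norm w)\<^sup>2" using Q_le by blast
  obtain k where k: "k \<ge> 0" "\<And>v. (norm (H *v v))\<^sup>2 \<le> k * (norm v)\<^sup>2" using matrix_vector_norm_le by blast
  obtain K where K: "K \<ge> 0"
    "\<And>x f T. T \<ge> 0 \<Longrightarrow> loc_square_integrable f \<Longrightarrow> primitive (\<lambda>t. A *v x t + f t) x \<Longrightarrow>
       integral {0..T} (\<lambda>t. (norm (x t))\<^sup>2) \<le> K * ((norm (x 0))\<^sup>2 + integral {0..T} (\<lambda>t. (norm (f t))\<^sup>2))"
    using Hurwitz_L2_gain[OF A_Hurwitz] by blast
  \<comment> \<open>Young's inequality separates \<open>x\<close> from \<open>?h\<close> and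
    inflates the cost of \<open>x\<close> by the factor \<open>1 + \<kappa>\<close>. The surplus is
    at most \<open>\<kappa> * q1\<close> times the energy of the disturbance, and this choice keeps
    it below half of the margin \<epsilon>. The summand 1 guards against
    \<open>q1 = 0\<close>.\<close>
  define \<kappa> where "\<kappa> = \<epsilon> / (2 * (q1 + 1))"
  have kap: "\<kappa> > 0" using eps q1(1) by (simp add: \<kappa>_def)
  have kap2: "\<kappa> * q1 \<le> \<epsilon> / 2"
  proof -
    have "\<kappa> * q1 \<le> \<kappa> * (q1 + 1)" using kap by (intro mult_left_mono) auto
    also have "\<dots> = \<epsilon> / 2" using q1(1) by (simp add: \<kappa>_def field_simps)
    finally show ?thesis .
  qed
  define C where "C = (1 + 1 / \<kappa>) * (k * K)"
  have "(\<epsilon> / 2) * integral {0..T} (\<lambda>t. (norm (wopt z t))\<^sup>2) + fst z \<bullet> snd z \<le> C * (norm (fst z))\<^sup>2"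
    if T: "T \<ge> 0" and pT: "costate z T = 0" for T z
  proof -
    let ?w = "cutoff T (wopt z)" and ?h = "\<lambda>t. mexp A t *v fst z"
    note lw0 = opt_loc_square_integrable(2)[of z]
    have lw: "loc_square_integrable ?w"
      by (rule L2_imp_loc_square_integrable[OF cutoff_L2[OF lw0]])
    obtain d x where d: "loc_square_integrable d" and x: "trajectory A B E ?w d x"
      and c: "cost T x (wopt z) d \<le> - \<epsilon> * integral {0..T} (\<lambda>t. (norm (wopt z t))\<^sup>2)"
      using solvable_horizon[OF T lw0] by blast
    have px: "primitive (\<lambda>t. A *v x t + B *v d t + E *v ?w t) x" and x0: "x 0 = 0"
      using x by (auto simp: trajectory_def)
    have ph: "primitive (\<lambda>t. A *v ?h t) ?h"
      by (intro primitive_has_vector_derivative mexp_apply_deriv continuous_at_imp_continuous_on ballI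
          continuous_intros bounded_linear.continuous[OF matrix_vector_mul_bounded_linear]
          has_vector_derivative_continuous[OF mexp_apply_deriv])
    have pxh: "primitive (\<lambda>t. A *v (x t + ?h t) + B *v d t + E *v ?w t) (\<lambda>t. x t + ?h t)"
      using primitive_add[OF px ph] by (simp add: matrix_vector_right_distrib algebra_simps)
    have "cost T (\<lambda>t. x t + ?h t) ?w d = fst z \<bullet> snd z
      + cost T (\<lambda>t. x t + ?h t - state z t) (\<lambda>t. ?w t - wopt z t) (\<lambda>t. d t - dopt z t)"
      by (rule cost_opt_add[OF pxh _ lw d T pT]) (simp add: x0 mexp_0)
    moreover have "cost T (\<lambda>t. x t + ?h t - state z t) (\<lambda>t. ?w t - wopt z t) (\<lambda>t. d t - dopt z t) \<ge> 0"
      by (rule cost_nonneg_if_no_disturbance) (simp add: cutoff_def)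
    moreover have "cost T (\<lambda>t. x t + ?h t) ?w d = cost T (\<lambda>t. x t + ?h t) (wopt z) d"
      unfolding cost_def by (rule integral_cong) (simp add: cutoff_def)
    ultimately have lower: "fst z \<bullet> snd z \<le> cost T (\<lambda>t. x t + ?h t) (wopt z) d" by linarith
    have lx: "loc_square_integrable x" and lh: "loc_square_integrable ?h" and lxh: "loc_square_integrable (\<lambda>t. x t + ?h t)"
      by (intro primitive_loc_square_integrable[OF px] primitive_loc_square_integrable[OF ph]
          primitive_loc_square_integrable[OF pxh])+
    note i = cost_integrable[OF lx lw0 d, of T] and ih = cost_integrable[OF lh lw0 d, of T]
      and ixh = cost_integrable[OF lxh lw0 d, of T]
    define IH where "IH = integral {0..T} (\<lambda>t. (norm (H *v x t))\<^sup>2)"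
    define ID where "ID = integral {0..T} (\<lambda>t. (norm (d t))\<^sup>2)"
    define IQ where "IQ = integral {0..T} (\<lambda>t. wopt z t \<bullet> (Q *v wopt z t))"
    define IW where "IW = integral {0..T} (\<lambda>t. (norm (wopt z t))\<^sup>2)"
    define Ih where "Ih = integral {0..T} (\<lambda>t. (norm (H *v ?h t))\<^sup>2)"
    have "integral {0..T} (\<lambda>t. (norm (H *v (x t + ?h t)))\<^sup>2)
        \<le> integral {0..T} (\<lambda>t. (1 + \<kappa>) * (norm (H *v x t))\<^sup>2 + (1 + 1 / \<kappa>) * (norm (H *v ?h t))\<^sup>2)"
      using norm_add_sq_le_weighted[OF kap]
      by (intro integral_le ixh integrable_add integrable_on_mult_right i ih) (simp add: matrix_vector_right_distrib)
    also have "\<dots> = (1 + \<kappa>) * IH + (1 + 1 / \<kappa>) * Ih"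
      unfolding IH_def Ih_def
      by (subst integral_add; (intro integrable_on_mult_right i ih)?) (simp only: integral_mult_right)
    finally have 1: "cost T (\<lambda>t. x t + ?h t) (wopt z) d \<le> (1 + \<kappa>) * IH + (1 + 1 / \<kappa>) * Ih + \<eta> * ID - IQ"
      unfolding ixh(5) ID_def IQ_def by linarith
    have ID0: "0 \<le> \<kappa> * (\<eta> * ID)" unfolding ID_def using eta kap by (intro mult_nonneg_nonneg integral_nonneg i) auto
    have IW0: "0 \<le> IW" unfolding IW_def by (intro integral_nonneg loc_square_integrable_norm[OF lw0]) auto
    have c': "IH + \<eta> * ID \<le> IQ - \<epsilon> * IW"
      using c unfolding i(5) IH_def ID_def IQ_def IW_def by linarith
    have "(1 + \<kappa>) * (IH + \<eta> * ID) \<le> (1 + \<kappa>) * (IQ - \<epsilon> * IW)"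
      using c' kap by (intro mult_left_mono) auto
    moreover have "IQ \<le> q1 * IW"
      unfolding IQ_def IW_def integral_mult_right[symmetric]
      by (intro integral_le i integrable_on_mult_right loc_square_integrable_norm[OF lw0] q1)
    then have "\<kappa> * IQ \<le> \<kappa> * (q1 * IW)" using kap by (intro mult_left_mono) auto
    then have "\<kappa> * IQ \<le> \<epsilon> / 2 * IW"
      using mult_right_mono[OF kap2 IW0] by (simp only: mult.assoc)
    moreover have "0 \<le> \<kappa> * (\<epsilon> * IW)" using kap eps IW0 by simp
    moreover have "(1 + 1 / \<kappa>) * Ih \<le> C * (norm (fst z))\<^sup>2"
    proof -
      have "Ih \<le> k * integral {0..T} (\<lambda>t. (norm (?h t))\<^sup>2)"
        unfolding Ih_def integral_mult_right[symmetric]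
        by (intro integral_le ih integrable_on_mult_right loc_square_integrable_norm[OF lh] k)
      moreover have "integral {0..T} (\<lambda>t. (norm (?h t))\<^sup>2) \<le> K * (norm (fst z))\<^sup>2"
        using K(2)[OF T, of "\<lambda>t. 0" ?h] ph by (simp add: mexp_0 loc_square_integrable_continuous)
      ultimately have "Ih \<le> k * (K * (norm (fst z))\<^sup>2)"
        using k(1) by (meson mult_left_mono order_trans)
      then have "(1 + 1 / \<kappa>) * Ih \<le> (1 + 1 / \<kappa>) * (k * (K * (norm (fst z))\<^sup>2))"
        using kap by (intro mult_left_mono) auto
      then show ?thesis by (simp only: C_def mult.assoc)
    qed
    ultimately have "\<epsilon> / 2 * IW + fst z \<bullet> snd z \<le> C * (norm (fst z))\<^sup>2"
      using lower 1 ID0 unfolding distrib_left distrib_right right_diff_distrib by simp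
    then show ?thesis unfolding IW_def .
  qed
  moreover have "C \<ge> 0" using kap k(1) K(1) by (simp add: C_def)
  ultimately show ?thesis using that by blast
qed

text \<open>From the initial state 0 the critical value is 0, so \<open>wopt_bound\<close> forces
  zero energy on the critical disturbance. The cost, which is also 0, is then a sum of nonnegative
  terms, so \<open>H x\<close> vanishes identically. What remains of the costate equation is
  homogeneous and is solved backwards from \<open>p(T) = 0\<close>.\<close>

lemma boundary_problem_unique:
  assumes T: "T \<ge> 0" and x0: "fst z = 0" and pT: "costate z T = 0"
  shows "z = 0"
\<comment> \<open>On a degenerate interval a vanishing integral says nothing about the
  integrand.\<close>
proof (cases "T = 0")
  case True
  then show ?thesis using x0 pT by (simp add: flow_Ham_0 prod_eq_iff)
next
  case False
  then have Tpos: "0 < T" using T by simp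
  obtain C where C: "C \<ge> 0" "\<And>T z. T \<ge> 0 \<Longrightarrow> costate z T = 0 \<Longrightarrow>
    (\<epsilon> / 2) * integral {0..T} (\<lambda>t. (norm (wopt z t))\<^sup>2) + fst z \<bullet> snd z \<le> C * (norm (fst z))\<^sup>2"
    using wopt_bound by blast
  obtain q1 where q1: "q1 \<ge> 0" "\<And>w. w \<bullet> (Q *v w) \<le> q1 * (norm w)\<^sup>2" using Q_le by blast
  note i = cost_integrable[OF opt_loc_square_integrable[of z], of T]
    and iw = loc_square_integrable_norm[OF opt_loc_square_integrable(2)[of z], of T]
  have "integral {0..T} (\<lambda>t. (norm (wopt z t))\<^sup>2) \<le> 0"
    using C(2)[OF T pT] x0 eps by (simp add: mult_le_0_iff)
  then have "q1 * integral {0..T} (\<lambda>t. (norm (wopt z t))\<^sup>2) \<le> 0"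
    using q1(1) by (rule mult_nonneg_nonpos[rotated])
  moreover have "integral {0..T} (\<lambda>t. wopt z t \<bullet> (Q *v wopt z t)) \<le> q1 * integral {0..T} (\<lambda>t. (norm (wopt z t))\<^sup>2)"
    unfolding integral_mult_right[symmetric]
    by (intro integral_le i integrable_on_mult_right iw q1)
  moreover have "integral {0..T} (\<lambda>t. (norm (H *v state z t))\<^sup>2) + \<eta> * integral {0..T} (\<lambda>t. (norm (dopt z t))\<^sup>2)
      - integral {0..T} (\<lambda>t. wopt z t \<bullet> (Q *v wopt z t)) = 0"
    using cost_opt[OF T pT] i(5) x0 by simp
  moreover have "0 \<le> \<eta> * integral {0..T} (\<lambda>t. (norm (dopt z t))\<^sup>2)"
    using eta by (intro mult_nonneg_nonneg integral_nonneg i) auto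
  moreover have "0 \<le> integral {0..T} (\<lambda>t. (norm (H *v state z t))\<^sup>2)"
    by (intro integral_nonneg i) auto
  ultimately have "integral {0..T} (\<lambda>t. (norm (H *v state z t))\<^sup>2) = 0" by linarith
  moreover have "continuous_on {0..T} (\<lambda>t. (norm (H *v state z t))\<^sup>2)"
    by (intro continuous_intros bounded_linear.continuous_on[OF matrix_vector_mul_bounded_linear] state_continuous)
  ultimately have Hx: "H *v state z t = 0" if "t \<in> {0..T}" for t
    using integral_eq_0_iff[of 0 T "\<lambda>t. (norm (H *v state z t))\<^sup>2"] Tpos that by simp
  have "costate z (T - T) = 0"
  proof (rule linear_ode_unique_right[OF matrix_vector_mul_linear T, where y = "\<lambda>r. costate z (T - r)"])
    fix r assume "r \<in> {0..T}"
    then have "H *v state z (T - r) = 0" by (intro Hx) auto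
    then show "((\<lambda>r. costate z (T - r)) has_vector_derivative transpose A *v costate z (T - r)) (at r within {0..T})"
      using has_vector_derivative_at_within[OF has_vector_derivative_reflect[OF costate_deriv[of z "T - r"]]]
      by (simp del: transpose_matrix_vector)
  qed (simp add: pT)
  then show ?thesis using x0 by (simp add: flow_Ham_0 prod_eq_iff)
qed

text \<open>Existence from uniqueness: running the flow backwards from terminal data
  \<open>(v, 0)\<close> gives a linear map from \<open>v\<close> to the initial state, injective by
  \<open>boundary_problem_unique\<close> and hence onto.\<close>

lemma boundary_problem_ex1:
  assumes T: "T \<ge> 0"
  shows "\<exists>!p. costate (x, p) T = 0"
proof (rule ex_ex1I)
  let ?f = "\<lambda>v. state (v, 0) (- T)"
  have lf: "linear ?f"
    using linear_compose[OF linear_compose[OF _ flow_linear[OF linear_Ham]] linear_fst, of "\<lambda>v. (v, 0)" "- T"]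
    by (simp add: o_def linear_iff)
  have "inj ?f"
  proof (rule linear_injective_0[OF lf, THEN iffD2], intro allI impI)
    fix v assume v: "?f v = 0"
    let ?z = "flow Ham (v, 0) (- T)"
    have T0: "flow Ham ?z T = (v, 0)" by (simp add: flow_flow[OF linear_Ham] flow_Ham_0)
    then have "?z = 0" using boundary_problem_unique[OF T v] by simp
    then show "v = 0" using T0 linear_0[OF flow_linear[OF linear_Ham], of T] by (simp add: zero_prod_def)
  qed
  then obtain v where v: "x = ?f v" using linear_injective_imp_surjective[OF lf] unfolding surj_def by blast
  have "(x, costate (v, 0) (- T)) = flow Ham (v, 0) (- T)" using v by (simp add: prod_eq_iff)
  then have "costate (x, costate (v, 0) (- T)) T = 0"
    by (simp only: flow_flow[OF linear_Ham]) (simp add: flow_Ham_0)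
  then show "\<exists>p. costate (x, p) T = 0" ..
  fix p p' assume "costate (x, p) T = 0" "costate (x, p') T = 0"
  then have "costate ((x, p) - (x, p')) T = 0"
    unfolding linear_diff[OF flow_linear[OF linear_Ham]] snd_diff by simp
  then have "(x, p) - (x, p') = 0" by (rule boundary_problem_unique[OF T, rotated]) simp
  then show "p = p'" by (simp add: zero_prod_def)
qed

text \<open>The solution of the Riccati differential equation at time-to-go \<open>T\<close> with
  zero terminal value, read off from the linear boundary problem. The map inside is shown to be
  linear in \<open>costate_zero_iff\<close>, by superposition and uniqueness.\<close>

definition riccati_sol :: "real \<Rightarrow> real^'n^'n" where
  "riccati_sol T = matrix (\<lambda>x. THE p. costate (x, p) T = 0)"

lemma costate_zero_iff:
  assumes T: "T \<ge> 0"
  shows "costate (x, p) T = 0 \<longleftrightarrow> p = riccati_sol T *v x"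
proof -
  let ?f = "\<lambda>x. THE p. costate (x, p) T = 0"
  have f: "costate (x, ?f x) T = 0" for x by (rule theI'[OF boundary_problem_ex1[OF T]])
  have u: "costate (x, p) T = 0 \<Longrightarrow> p = ?f x" for x p using boundary_problem_ex1[OF T] f by blast
  note lf = flow_linear[OF linear_Ham, of T]
  have "linear ?f"
  proof (rule linearI)
    fix x y and c :: real
    have "costate ((x, ?f x) + (y, ?f y)) T = 0" unfolding linear_add[OF lf] by (simp add: f)
    then show "?f (x + y) = ?f x + ?f y" by (intro u[symmetric]) simp
    have "costate (c *\<^sub>R (x, ?f x)) T = 0" unfolding linear_cmul[OF lf] by (simp add: f)
    then show "?f (c *\<^sub>R x) = c *\<^sub>R ?f x" by (intro u[symmetric]) simp
  qed
  then have "riccati_sol T *v x = ?f x" for x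
    by (simp add: riccati_sol_def matrix_works linear_matrix_vector_mul_eq)
  then show ?thesis using f u by metis
qed

abbreviation crit :: "real \<Rightarrow> real^'n \<Rightarrow> (real^'n) \<times> (real^'n)" where
  "crit T x \<equiv> (x, riccati_sol T *v x)"

lemma costate_crit: "T \<ge> 0 \<Longrightarrow> costate (crit T x) T = 0"
  by (simp add: costate_zero_iff)

text \<open>Time invariance: the rest of a critical solution after \<open>t\<close> is critical for
  the remaining horizon.\<close>

lemma costate_crit_feedback:
  assumes "0 \<le> t" "t \<le> T"
  shows "costate (crit T x) t = riccati_sol (T - t) *v state (crit T x) t"
proof -
  have "costate (state (crit T x) t, costate (crit T x) t) (T - t) = 0"
    using costate_crit[of T x] assms by (simp add: flow_flow[OF linear_Ham])
  then show ?thesis by (rule costate_zero_iff[THEN iffD1, rotated]) (use assms in simp)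
qed

text \<open>Since \<open>G\<close> is symmetric, the Hamiltonian flow preserves the symplectic form
  \<open>?f\<close>. It vanishes at time \<open>T\<close>, where both costates are zero, hence also
  at time 0, where it measures the asymmetry.\<close>

lemma riccati_sol_symmetric:
  assumes T: "T \<ge> 0"
  shows "u \<bullet> (riccati_sol T *v v) = v \<bullet> (riccati_sol T *v u)"
proof -
  let ?u = "crit T u" and ?v = "crit T v"
  let ?f = "\<lambda>t. state ?u t \<bullet> costate ?v t - state ?v t \<bullet> costate ?u t"
  have Gs: "p \<bullet> (G *v q) = q \<bullet> (G *v p)" for p q
  proof -
    have "transpose (E ** Qi ** transpose E) = E ** Qi ** transpose E"
      by (simp add: matrix_transpose_mul Qi_sym matrix_mul_assoc)
    moreover have "transpose (B ** transpose B) = B ** transpose B"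
      by (simp add: matrix_transpose_mul)
    ultimately have "transpose G = G"
      by (simp add: G_def vec_eq_iff transpose_def)
    then show ?thesis using dot_matrix_vector_transpose[of p G q] by (simp add: inner_commute)
  qed
  have "(?f has_vector_derivative 0) (at t)" for t
  proof -
    have As: "(A *v a) \<bullet> b = a \<bullet> (transpose A *v b)" and Hs: "a \<bullet> (transpose H *v h) = (H *v a) \<bullet> h" for a b h
      using dot_matrix_vector_transpose[of a "transpose A" b] dot_matrix_vector_transpose[of a "transpose H" h]
      by (simp_all del: transpose_matrix_vector)
    have "((\<lambda>t. state z t \<bullet> costate z' t) has_vector_derivative
        (costate z t \<bullet> (G *v costate z' t)) - (H *v state z t) \<bullet> (H *v state z' t)) (at t)" for z z'
    proof -
      have "((\<lambda>t. state z t \<bullet> costate z' t) has_vector_derivative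
          state z t \<bullet> (- (transpose H *v (H *v state z' t)) - transpose A *v costate z' t)
          + (A *v state z t + G *v costate z t) \<bullet> costate z' t) (at t)"
        by (rule bounded_bilinear.has_vector_derivative[OF bounded_bilinear_inner state_deriv costate_deriv])
      moreover have "(G *v costate z t) \<bullet> costate z' t = costate z t \<bullet> (G *v costate z' t)"
        using Gs[of "costate z' t" "costate z t"] by (simp add: inner_commute)
      ultimately show ?thesis
        by (simp add: inner_diff_right inner_add_left As Hs del: transpose_matrix_vector)
    qed
    from has_vector_derivative_diff[OF this[of ?u ?v] this[of ?v ?u]] show ?thesis
      by (simp add: Gs[of "costate ?u t" "costate ?v t"] inner_commute)
  qed
  then obtain c where "?f t = c" for t
    using has_vector_derivative_zero_constant[OF convex_UNIV, of ?f] by auto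
  then have "?f 0 = ?f T" by simp
  also have "?f T = 0" using costate_crit[OF T] by simp
  finally show ?thesis by (simp add: flow_Ham_0)
qed

text \<open>The process \<open>?X\<close> meets the critical disturbance of the short horizon,
  extended by zero, with the critical control of the long horizon corrected by the hypothesis. Its
  deviation from the long critical solution has nonpositive cost, so its cost over \<open>T\<close>
  is at most the value for \<open>T\<close>. Stopping at \<open>S\<close> only lowers the cost, as
  no disturbance acts afterwards. On \<open>{0..S}\<close> it shares the disturbance of the short
  critical solution, so its cost there is at least the value for \<open>S\<close>.\<close>

lemma value_mono:
  assumes "0 \<le> S" "S \<le> T"
  shows "x \<bullet> (riccati_sol S *v x) \<le> x \<bullet> (riccati_sol T *v x)"
proof -
  have T: "T \<ge> 0" using assms by simp
  let ?y = "crit S x" and ?z = "crit T x"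
  let ?w = "\<lambda>t. cutoff S (wopt ?y) t - wopt ?z t"
  note lz = opt_loc_square_integrable[of ?z]
  have lS: "loc_square_integrable (cutoff S (wopt ?y))"
    by (intro L2_imp_loc_square_integrable cutoff_L2 opt_loc_square_integrable)
  have lw: "loc_square_integrable ?w" by (intro loc_square_integrable_diff lS lz)
  obtain d x' where d: "loc_square_integrable d" and x': "trajectory A B E (cutoff T ?w) d x'"
    and c: "cost T x' ?w d \<le> - \<epsilon> * integral {0..T} (\<lambda>t. (norm (?w t))\<^sup>2)"
    using solvable_horizon[OF T lw] by blast
  have x'0: "x' 0 = 0" and px': "primitive (\<lambda>t. A *v x' t + B *v d t + E *v cutoff T ?w t) x'"
    using x' by (auto simp: trajectory_def)
  let ?X = "\<lambda>t. state ?z t + x' t" and ?W = "\<lambda>t. wopt ?z t + cutoff T ?w t" and ?D = "\<lambda>t. dopt ?z t + d t"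
  have pX: "primitive (\<lambda>t. A *v ?X t + B *v ?D t + E *v ?W t) ?X"
    using primitive_add[OF state_primitive px'] by (simp add: matrix_vector_right_distrib algebra_simps)
  have lW: "loc_square_integrable ?W" and lD: "loc_square_integrable ?D"
    by (intro loc_square_integrable_add lz d L2_imp_loc_square_integrable[OF cutoff_L2[OF lw]])+
  have W: "?W t = cutoff S (wopt ?y) t" if "t \<in> {0..T}" for t
    using that by (simp add: cutoff_def)
  have "cost T ?X ?W ?D = x \<bullet> (riccati_sol T *v x)
      + cost T (\<lambda>t. ?X t - state ?z t) (\<lambda>t. ?W t - wopt ?z t) (\<lambda>t. ?D t - dopt ?z t)"
    using cost_opt_add[OF pX _ lW lD T costate_crit[OF T, of x]] x'0 by (simp add: flow_Ham_0)
  moreover have "cost T (\<lambda>t. ?X t - state ?z t) (\<lambda>t. ?W t - wopt ?z t) (\<lambda>t. ?D t - dopt ?z t) = cost T x' ?w d"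
    unfolding cost_def by (rule integral_cong) (simp add: cutoff_def)
  moreover have "- \<epsilon> * integral {0..T} (\<lambda>t. (norm (?w t))\<^sup>2) \<le> 0"
    using eps integral_nonneg[OF loc_square_integrable_norm[OF lw, of T]] by simp
  ultimately have upper: "cost T ?X ?W ?D \<le> x \<bullet> (riccati_sol T *v x)" using c by linarith
  let ?c = "\<lambda>t. (norm (H *v ?X t))\<^sup>2 + \<eta> * (norm (?D t))\<^sup>2 - ?W t \<bullet> (Q *v ?W t)"
  have ic: "?c integrable_on {0..R}" for R
    by (rule cost_integrable(4)[OF primitive_loc_square_integrable[OF pX] lW lD])
  have ST: "{0..S} \<inter> {0..T} = {0..S}" using assms by auto
  have "cost S ?X ?W ?D = integral {0..T} (\<lambda>t. if t \<in> {0..S} then ?c t else 0)"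
    unfolding integral_restrict_Int ST cost_def ..
  also have "\<dots> \<le> integral {0..T} ?c"
  proof (rule integral_le)
    show "(\<lambda>t. if t \<in> {0..S} then ?c t else 0) integrable_on {0..T}"
      unfolding integrable_restrict_Int ST by (rule ic)
    show "(if t \<in> {0..S} then ?c t else 0) \<le> ?c t" if "t \<in> {0..T}" for t
    proof (cases "t \<in> {0..S}")
      case False
      then have "cutoff S (wopt ?y) t = 0" by (auto simp: cutoff_def)
      then have "?W t = 0" by (simp only: W[OF that])
      then have "?c t \<ge> 0" using eta by (simp only: matrix_vector_mult_0_right inner_zero_left) simp
      then show ?thesis using False by simp
    qed simp
  qed (rule ic)
  also have "integral {0..T} ?c = cost T ?X ?W ?D" by (simp add: cost_def)
  finally have ST': "cost S ?X ?W ?D \<le> cost T ?X ?W ?D" .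
  have "cost S ?X ?W ?D = x \<bullet> (riccati_sol S *v x)
      + cost S (\<lambda>t. ?X t - state ?y t) (\<lambda>t. ?W t - wopt ?y t) (\<lambda>t. ?D t - dopt ?y t)"
    using cost_opt_add[OF pX _ lW lD assms(1) costate_crit[OF assms(1), of x]] x'0 by (simp add: flow_Ham_0)
  moreover have "cost S (\<lambda>t. ?X t - state ?y t) (\<lambda>t. ?W t - wopt ?y t) (\<lambda>t. ?D t - dopt ?y t) \<ge> 0"
  proof (rule cost_nonneg_if_no_disturbance)
    fix t assume "t \<in> {0..S}"
    then show "?W t - wopt ?y t = 0" using W[of t] assms by (simp add: cutoff_def)
  qed
  ultimately show ?thesis using ST' upper by linarith
qed

lemma value_nonneg:
  assumes "T \<ge> 0"
  shows "0 \<le> x \<bullet> (riccati_sol T *v x)"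
proof -
  have "riccati_sol 0 *v x = 0" using costate_zero_iff[of 0 x 0] by (simp add: flow_Ham_0)
  then show ?thesis using value_mono[of 0 T x] assms by simp
qed

section \<open>The limit of the finite-horizon Riccati matrices\<close>

lemma riccati_sol_tendsto:
  obtains P where "(riccati_sol \<longlongrightarrow> P) at_top" "sym_pos_semidef P"
proof -
  obtain C where C: "C \<ge> 0" "\<And>T z. T \<ge> 0 \<Longrightarrow> costate z T = 0 \<Longrightarrow>
    (\<epsilon> / 2) * integral {0..T} (\<lambda>t. (norm (wopt z t))\<^sup>2) + fst z \<bullet> snd z \<le> C * (norm (fst z))\<^sup>2"
    using wopt_bound by blast
  have bdd: "x \<bullet> (riccati_sol T *v x) \<le> C * (norm x)\<^sup>2" if T: "T \<ge> 0" for x T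
  proof -
    have "0 \<le> (\<epsilon> / 2) * integral {0..T} (\<lambda>t. (norm (wopt (crit T x) t))\<^sup>2)"
      using eps by (intro mult_nonneg_nonneg integral_nonneg loc_square_integrable_norm opt_loc_square_integrable) auto
    then show ?thesis using C(2)[OF T costate_crit[OF T, of x]] by simp
  qed
  have "\<exists>l. ((\<lambda>T. x \<bullet> (riccati_sol T *v x)) \<longlongrightarrow> l) at_top" for x
    using value_mono bdd by (intro mono_bounded_convergent_at_top[where C = "C * (norm x)\<^sup>2"]) auto
  then obtain V where V: "\<And>x. ((\<lambda>T. x \<bullet> (riccati_sol T *v x)) \<longlongrightarrow> V x) at_top" by metis
  \<comment> \<open>Monotonicity gives convergence of quadratic forms only; polarization recovers
    the entries, by symmetry of \<open>riccati_sol T\<close>.\<close>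
  define P :: "real^'n^'n" where
    "P = (\<chi> i j. (V (axis i 1 + axis j 1) - V (axis i 1) - V (axis j 1)) / 2)"
  have lim: "(riccati_sol \<longlongrightarrow> P) at_top"
  proof (intro vec_tendstoI)
    fix i j
    have entry: "M $ i $ j = axis i 1 \<bullet> (M *v axis j 1)" for M :: "real^'n^'n"
      by (simp add: matrix_vector_mul_component inner_axis inner_axis')
    have "((\<lambda>T. ((axis i 1 + axis j 1) \<bullet> (riccati_sol T *v (axis i 1 + axis j 1))
        - axis i 1 \<bullet> (riccati_sol T *v axis i 1) - axis j 1 \<bullet> (riccati_sol T *v axis j 1)) / 2)
        \<longlongrightarrow> P $ i $ j) at_top"
      unfolding P_def by (simp only: vec_lambda_beta) (intro tendsto_intros V; simp)
    then show "((\<lambda>T. riccati_sol T $ i $ j) \<longlongrightarrow> P $ i $ j) at_top"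
    proof (rule Lim_transform_eventually)
      show "\<forall>\<^sub>F T in at_top. ((axis i 1 + axis j 1) \<bullet> (riccati_sol T *v (axis i 1 + axis j 1))
          - axis i 1 \<bullet> (riccati_sol T *v axis i 1) - axis j 1 \<bullet> (riccati_sol T *v axis j 1)) / 2
          = riccati_sol T $ i $ j"
        using eventually_ge_at_top[of 0]
      proof eventually_elim
        case (elim T)
        then show ?case unfolding entry
          using riccati_sol_symmetric[of T "axis i 1" "axis j 1"]
          by (simp add: matrix_vector_right_distrib inner_add_left inner_add_right)
      qed
    qed
  qed
  have limv: "((\<lambda>T. riccati_sol T *v x) \<longlongrightarrow> P *v x) at_top" for x
    by (rule bounded_linear.tendsto[OF bounded_bilinear.bounded_linear_left[OF bounded_bilinear_matrix_vector_mult] lim])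
  have "u \<bullet> (P *v v) = v \<bullet> (P *v u)" for u v
  proof (rule tendsto_unique[OF _ tendsto_inner[OF tendsto_const limv]])
    show "((\<lambda>T. u \<bullet> (riccati_sol T *v v)) \<longlongrightarrow> v \<bullet> (P *v u)) at_top"
      by (rule Lim_transform_eventually[OF tendsto_inner[OF tendsto_const limv]])
         (rule eventually_mono[OF eventually_ge_at_top[of 0]], rule riccati_sol_symmetric)
  qed simp
  then have "u \<bullet> (transpose P *v v) = u \<bullet> (P *v v)" for u v
    using dot_matrix_vector_transpose[of u "transpose P" v] by (simp add: inner_commute)
  then have "transpose P *v v = P *v v" for v
    using vector_eq_ldot[of "transpose P *v v" "P *v v"] by blast
  then have "transpose P = P" by (simp add: matrix_eq)
  moreover have "0 \<le> x \<bullet> (P *v x)" for x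
    by (rule tendsto_lowerbound[OF tendsto_inner[OF tendsto_const limv]])
       (rule eventually_mono[OF eventually_ge_at_top[of 0]], rule value_nonneg, simp, simp)
  ultimately have "sym_pos_semidef P" by (simp add: sym_pos_semidef_def)
  with lim show ?thesis using that by blast
qed

lemma tendsto_flow_crit:
  assumes "(riccati_sol \<longlongrightarrow> P) at_top"
  shows "((\<lambda>T. flow Ham (crit T x) t) \<longlongrightarrow> flow Ham (x, P *v x) t) at_top"
proof -
  have "((\<lambda>T. riccati_sol T *v x) \<longlongrightarrow> P *v x) at_top"
    by (rule bounded_linear.tendsto[OF bounded_bilinear.bounded_linear_left[OF bounded_bilinear_matrix_vector_mult] assms])
  then have "((\<lambda>T. crit T x) \<longlongrightarrow> (x, P *v x)) at_top" by (intro tendsto_intros)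
  then show ?thesis
    by (rule bounded_linear.tendsto[OF flow_linear[OF linear_Ham, unfolded linear_conv_bounded_linear]])
qed

lemma limit_graph_invariant:
  assumes P: "(riccati_sol \<longlongrightarrow> P) at_top" and t: "t \<ge> 0"
  shows "costate (x, P *v x) t = P *v state (x, P *v x) t"
proof (rule tendsto_unique)
  show "((\<lambda>T. costate (crit T x) t) \<longlongrightarrow> costate (x, P *v x) t) at_top"
    by (intro tendsto_snd tendsto_flow_crit P)
  have "((\<lambda>T. riccati_sol (T - t)) \<longlongrightarrow> P) at_top"
  proof (rule filterlim_compose[OF P])
    show "filterlim (\<lambda>T. T - t) at_top at_top"
      unfolding filterlim_at_top eventually_at_top_linorder
    proof
      show "\<exists>N. \<forall>n\<ge>N. Z \<le> n - t" for Z by (rule exI[of _ "Z + t"]) auto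
    qed
  qed
  then have "((\<lambda>T. riccati_sol (T - t) *v state (crit T x) t) \<longlongrightarrow> P *v state (x, P *v x) t) at_top"
    by (intro bounded_bilinear.tendsto[OF bounded_bilinear_matrix_vector_mult] tendsto_fst tendsto_flow_crit P)
  then show "((\<lambda>T. costate (crit T x) t) \<longlongrightarrow> P *v state (x, P *v x) t) at_top"
    by (rule Lim_transform_eventually)
       (rule eventually_mono[OF eventually_ge_at_top[of t]], rule costate_crit_feedback[OF t, symmetric])
qed simp

text \<open>The equation is the derivative at time 0 of the invariance of the graph. Invariance is
  known for \<open>t \<ge> 0\<close> only, so the derivatives are compared from the right, within
  the unit interval.\<close>

lemma limit_riccati:
  assumes P: "(riccati_sol \<longlongrightarrow> P) at_top"
  shows "riccati P"
  unfolding riccati_iff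
proof
  fix v
  let ?z = "(v, P *v v)"
  let ?f = "\<lambda>t. costate ?z t - P *v state ?z t"
  let ?d = "(- (transpose H *v (H *v v)) - transpose A *v (P *v v)) - P *v (A *v v + G *v (P *v v))"
  have "(?f has_vector_derivative ?d) (at 0)"
    using has_vector_derivative_diff[OF costate_deriv[of ?z 0]
        bounded_linear.has_vector_derivative[OF matrix_vector_mul_bounded_linear state_deriv[of ?z 0]]]
    by (simp add: flow_Ham_0 del: transpose_matrix_vector)
  then have 1: "(?f has_vector_derivative ?d) (at 0 within cbox 0 1)" by (rule has_vector_derivative_at_within)
  have 2: "(?f has_vector_derivative 0) (at 0 within cbox 0 1)"
    by (rule has_vector_derivative_transform[where f = "\<lambda>t. 0"])
       (auto simp: limit_graph_invariant[OF P])
  have "?d = 0"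
    by (rule vector_derivative_unique_within_closed_interval[OF _ _ 1 2]) auto
  moreover have "b + c + a + e = - ((- a - b) - (c + e))" for a b c e :: "real^'n" by simp
  ultimately show "transpose A *v (P *v v) + P *v (A *v v) + transpose H *v (H *v v) + P *v (G *v (P *v v)) = 0"
    by (simp only: matrix_vector_right_distrib) simp
qed

text \<open>By the Riccati equation, a closed-loop solution paired with its image under
  \<open>P\<close> solves the Hamiltonian system at all times; uniqueness identifies it with the
  flow.\<close>

lemma limit_closed_loop:
  assumes P: "(riccati_sol \<longlongrightarrow> P) at_top"
  shows "state (x, P *v x) t = mexp (A + G ** P) t *v x"
proof -
  let ?y = "\<lambda>t. mexp (A + G ** P) t *v x"
  have r: "transpose A *v (P *v v) + P *v (A *v v) + transpose H *v (H *v v) + P *v (G *v (P *v v)) = 0" for v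
    using limit_riccati[OF P] unfolding riccati_iff by blast
  have dy: "(?y has_vector_derivative A *v ?y t + G *v (P *v ?y t)) (at t)" for t
    using mexp_apply_deriv[of "A + G ** P" x t]
    by (simp add: matrix_vector_mult_add_rdistrib matrix_vector_mul_assoc[symmetric])
  have "((\<lambda>t. (?y t, P *v ?y t)) has_vector_derivative Ham (?y t, P *v ?y t)) (at t)" for t
  proof -
    have "P *v (A *v ?y t + G *v (P *v ?y t)) = - (transpose H *v (H *v ?y t)) - transpose A *v (P *v ?y t)"
      using r[of "?y t"] by (simp add: matrix_vector_right_distrib eq_diff_eq eq_neg_iff_add_eq_0 add_ac
          del: transpose_matrix_vector)
    then have "Ham (?y t, P *v ?y t)
        = (A *v ?y t + G *v (P *v ?y t), P *v (A *v ?y t + G *v (P *v ?y t)))"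
      by (simp only: Ham_def fst_conv snd_conv)
    then show ?thesis
      using has_vector_derivative_Pair[OF dy bounded_linear.has_vector_derivative[OF matrix_vector_mul_bounded_linear[of P] dy]]
      by (simp only:)
  qed
  from flow_unique[OF linear_Ham, where y = "\<lambda>t. (?y t, P *v ?y t)" and t = t, OF this]
  have "(?y t, P *v ?y t) = flow Ham (x, P *v x) t" by (simp add: mexp_0)
  then show ?thesis by (metis fst_conv)
qed

text \<open>Critical trajectories are driven through the Hurwitz matrix \<open>A\<close> by the
  critical control and disturbance, both of bounded energy, so their square integrals are bounded
  independently of \<open>T\<close>. On a fixed window the bound passes to the limit, where the
  trajectory is that of the closed loop.\<close>

lemma limit_stabilizing:
  assumes P: "(riccati_sol \<longlongrightarrow> P) at_top"
  shows "Hurwitz (A + G ** P)"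
proof -
  obtain C where C: "C \<ge> 0" "\<And>T z. T \<ge> 0 \<Longrightarrow> costate z T = 0 \<Longrightarrow>
    (\<epsilon> / 2) * integral {0..T} (\<lambda>t. (norm (wopt z t))\<^sup>2) + fst z \<bullet> snd z \<le> C * (norm (fst z))\<^sup>2"
    using wopt_bound by blast
  obtain q1 where q1: "q1 \<ge> 0" "\<And>w. w \<bullet> (Q *v w) \<le> q1 * (norm w)\<^sup>2" using Q_le by blast
  obtain kB where kB: "kB \<ge> 0" "\<And>v. (norm (B *v v))\<^sup>2 \<le> kB * (norm v)\<^sup>2" using matrix_vector_norm_le by blast
  obtain kE where kE: "kE \<ge> 0" "\<And>v. (norm (E *v v))\<^sup>2 \<le> kE * (norm v)\<^sup>2" using matrix_vector_norm_le by blast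
  obtain K where K: "K \<ge> 0"
    "\<And>x f T. T \<ge> 0 \<Longrightarrow> loc_square_integrable f \<Longrightarrow> primitive (\<lambda>t. A *v x t + f t) x \<Longrightarrow>
       integral {0..T} (\<lambda>t. (norm (x t))\<^sup>2) \<le> K * ((norm (x 0))\<^sup>2 + integral {0..T} (\<lambda>t. (norm (f t))\<^sup>2))"
    using Hurwitz_L2_gain[OF A_Hurwitz] by blast
  \<comment> \<open>Energy bounds relative to the initial state: \<open>c1\<close> for the critical
    disturbance, from \<open>wopt_bound\<close> and nonnegativity of the value; \<open>c2\<close>
    for the control, from the formula for the critical cost; \<open>K'\<close> for the state, from
    the gain of \<open>A\<close>.\<close>
  define c1 where "c1 = 2 * C / \<epsilon>"
  define c2 where "c2 = (C + q1 * c1) / \<eta>"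
  define K' where "K' = K * (1 + (2 * kB * c2 + 2 * kE * c1))"
  have fin: "integral {0..T} (\<lambda>t. (norm (state (crit T x) t))\<^sup>2) \<le> K' * (norm x)\<^sup>2" if T: "T \<ge> 0" for T x
  proof -
    let ?z = "crit T x"
    let ?f = "\<lambda>t. B *v dopt ?z t + E *v wopt ?z t"
    note l = opt_loc_square_integrable[of ?z]
    note pT = costate_crit[OF T, of x]
    note iw = loc_square_integrable_norm[OF l(2), of T] and id = loc_square_integrable_norm[OF l(3), of T]
    have lf: "loc_square_integrable ?f"
      by (intro loc_square_integrable_add loc_square_integrable_linear[OF l(2)] loc_square_integrable_linear[OF l(3)]) auto
    have V: "0 \<le> x \<bullet> (riccati_sol T *v x)" by (rule value_nonneg[OF T])
    have w: "integral {0..T} (\<lambda>t. (norm (wopt ?z t))\<^sup>2) \<le> c1 * (norm x)\<^sup>2"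
      using C(2)[OF T pT] V eps by (simp add: c1_def field_simps)
    have VC: "x \<bullet> (riccati_sol T *v x) \<le> C * (norm x)\<^sup>2"
    proof -
      have "0 \<le> (\<epsilon> / 2) * integral {0..T} (\<lambda>t. (norm (wopt ?z t))\<^sup>2)"
        using eps by (intro mult_nonneg_nonneg integral_nonneg iw) auto
      then show ?thesis using C(2)[OF T pT] by simp
    qed
    have d: "integral {0..T} (\<lambda>t. (norm (dopt ?z t))\<^sup>2) \<le> c2 * (norm x)\<^sup>2"
    proof -
      note i = cost_integrable[OF l, of T]
      have "integral {0..T} (\<lambda>t. wopt ?z t \<bullet> (Q *v wopt ?z t)) \<le> q1 * integral {0..T} (\<lambda>t. (norm (wopt ?z t))\<^sup>2)"
        unfolding integral_mult_right[symmetric]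
        by (intro integral_le i integrable_on_mult_right iw q1)
      also have "\<dots> \<le> q1 * (c1 * (norm x)\<^sup>2)" by (intro mult_left_mono w q1)
      finally have "\<eta> * integral {0..T} (\<lambda>t. (norm (dopt ?z t))\<^sup>2) \<le> C * (norm x)\<^sup>2 + q1 * (c1 * (norm x)\<^sup>2)"
        using cost_opt[OF T pT] i(5) VC integral_nonneg[OF i(1)] by simp
      then show ?thesis using eta by (simp add: c2_def field_simps)
    qed
    have "integral {0..T} (\<lambda>t. (norm (?f t))\<^sup>2)
        \<le> integral {0..T} (\<lambda>t. 2 * kB * (norm (dopt ?z t))\<^sup>2 + 2 * kE * (norm (wopt ?z t))\<^sup>2)"
    proof (rule integral_le)
      show "(norm (?f t))\<^sup>2 \<le> 2 * kB * (norm (dopt ?z t))\<^sup>2 + 2 * kE * (norm (wopt ?z t))\<^sup>2" for t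
        using norm_add_sq_le[of "B *v dopt ?z t" "E *v wopt ?z t"] kB(2)[of "dopt ?z t"] kE(2)[of "wopt ?z t"]
        by linarith
    qed (intro loc_square_integrable_norm[OF lf] integrable_add integrable_on_mult_right iw id)+
    also have "\<dots> = 2 * kB * integral {0..T} (\<lambda>t. (norm (dopt ?z t))\<^sup>2) + 2 * kE * integral {0..T} (\<lambda>t. (norm (wopt ?z t))\<^sup>2)"
      by (subst integral_add; (intro integrable_on_mult_right iw id)?) (simp only: integral_mult_right)
    also have "\<dots> \<le> 2 * kB * (c2 * (norm x)\<^sup>2) + 2 * kE * (c1 * (norm x)\<^sup>2)"
      using kB(1) kE(1) by (intro add_mono mult_left_mono d w) auto
    finally have "integral {0..T} (\<lambda>t. (norm (?f t))\<^sup>2) \<le> (2 * kB * c2 + 2 * kE * c1) * (norm x)\<^sup>2"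
      by (simp add: algebra_simps)
    then have "K * ((norm x)\<^sup>2 + integral {0..T} (\<lambda>t. (norm (?f t))\<^sup>2))
        \<le> K * ((norm x)\<^sup>2 + (2 * kB * c2 + 2 * kE * c1) * (norm x)\<^sup>2)"
      using K(1) by (intro mult_left_mono) auto
    moreover have "integral {0..T} (\<lambda>t. (norm (state ?z t))\<^sup>2)
        \<le> K * ((norm x)\<^sup>2 + integral {0..T} (\<lambda>t. (norm (?f t))\<^sup>2))"
      using K(2)[OF T lf, of "state ?z"] state_primitive[of ?z] by (simp add: flow_Ham_0 add.assoc)
    ultimately show ?thesis by (simp add: K'_def algebra_simps)
  qed
  show ?thesis
  proof (rule Hurwitz_if_square_integrable)
    fix v and \<tau> :: real assume tau: "0 \<le> \<tau>"
    \<comment> \<open>With the window fixed, this is continuous in the initial point, which moves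
      with \<open>T\<close> from \<open>crit T v\<close> to \<open>(v, P *v v)\<close>. Joint
      continuity of the flow in point and time comes from expanding the point in a basis.\<close>
    let ?N = "\<lambda>z. integral (cbox 0 \<tau>) (\<lambda>t. (norm (state z t))\<^sup>2)"
    have rep: "flow Ham z t = (\<Sum>b\<in>Basis. (z \<bullet> b) *\<^sub>R flow Ham b t)" for z t
    proof -
      have "flow Ham z t = flow Ham (\<Sum>b\<in>Basis. (z \<bullet> b) *\<^sub>R b) t" by (simp only: euclidean_representation)
      then show ?thesis
        by (simp only: linear_sum[OF flow_linear[OF linear_Ham]] linear_cmul[OF flow_linear[OF linear_Ham]])
    qed
    have "continuous_on UNIV ?N"
    proof (rule integral_continuous_on_param)
      have "(\<lambda>(z, t). flow Ham z t) = (\<lambda>p. \<Sum>b\<in>Basis. (fst p \<bullet> b) *\<^sub>R flow Ham b (snd p))"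
        unfolding split_beta by (rule ext, rule rep)
      moreover have "continuous_on (UNIV \<times> cbox 0 \<tau>) (\<lambda>p. \<Sum>b\<in>Basis. (fst p \<bullet> b) *\<^sub>R flow Ham b (snd p))"
        by (intro continuous_intros continuous_on_compose2[OF flow_continuous_on[OF linear_Ham, of UNIV]]) auto
      ultimately have "continuous_on (UNIV \<times> cbox 0 \<tau>) (\<lambda>(z, t). flow Ham z t)" by simp
      then show "continuous_on (UNIV \<times> cbox 0 \<tau>) (\<lambda>(z, t). (norm (state z t))\<^sup>2)"
        unfolding split_beta by (intro continuous_intros)
    qed
    then have "isCont ?N (v, P *v v)" by (simp add: continuous_on_eq_continuous_at)
    moreover have "((\<lambda>T. crit T v) \<longlongrightarrow> (v, P *v v)) at_top"
      by (intro tendsto_intros bounded_linear.tendsto[OF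
            bounded_bilinear.bounded_linear_left[OF bounded_bilinear_matrix_vector_mult] P])
    ultimately have lim: "((\<lambda>T. ?N (crit T v)) \<longlongrightarrow> ?N (v, P *v v)) at_top"
      by (rule isCont_tendsto_compose)
    have "?N (v, P *v v) \<le> K' * (norm v)\<^sup>2"
    proof (rule tendsto_upperbound[OF lim])
      show "\<forall>\<^sub>F T in at_top. ?N (crit T v) \<le> K' * (norm v)\<^sup>2"
        using eventually_ge_at_top[of \<tau>]
      proof eventually_elim
        case (elim T)
        have "?N (crit T v) \<le> integral {0..T} (\<lambda>t. (norm (state (crit T v) t))\<^sup>2)"
          using elim by (intro integral_subset_le) (auto intro!: integrable_continuous_real continuous_intros state_continuous)
        also have "\<dots> \<le> K' * (norm v)\<^sup>2" using elim tau by (intro fin) auto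
        finally show ?case .
      qed
    qed simp
    then show "integral {0..\<tau>} (\<lambda>t. (norm (mexp (A + G ** P) t *v v))\<^sup>2) \<le> K' * (norm v)\<^sup>2"
      by (simp add: limit_closed_loop[OF P])
  qed
qed

end

lemma (in full_information) riccati_if_solvable:
  assumes "Hurwitz A" "solvable A B E H Q \<eta>"
  obtains P where "sym_pos_semidef P" "riccati P" "Hurwitz (A + G ** P)"
proof -
  obtain \<epsilon> where e: "\<epsilon> > 0" "\<And>w. w \<in> L2 \<Longrightarrow> \<exists>d\<in>L2. \<exists>x. trajectory A B E w d x \<and> (\<lambda>t. H *v x t) \<in> L2 \<and>
     L2_norm_sq (\<lambda>t. H *v x t) + \<eta> * L2_norm_sq d
       \<le> integral {0..} (\<lambda>t. w t \<bullet> (Q *v w t)) - \<epsilon> * L2_norm_sq w"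
    using assms(2) unfolding solvable_def by blast
  interpret strictly_solvable A B E H Q Qi \<eta> q0 \<epsilon>
  proof unfold_locales
    fix T :: real and w :: "real \<Rightarrow> real^'w" assume T: "T \<ge> 0" and w: "loc_square_integrable w"
    let ?w = "cutoff T w"
    have w2: "?w \<in> L2" by (rule cutoff_L2[OF w])
    obtain d x where d: "d \<in> L2" and x: "trajectory A B E ?w d x" and Hx: "(\<lambda>t. H *v x t) \<in> L2"
      and le: "L2_norm_sq (\<lambda>t. H *v x t) + \<eta> * L2_norm_sq d
       \<le> integral {0..} (\<lambda>t. ?w t \<bullet> (Q *v ?w t)) - \<epsilon> * L2_norm_sq ?w"
      using e(2)[OF w2] by blast
    have T0: "{0..T} \<inter> {0..} = {0..T}" by auto
    have "(\<lambda>t. ?w t \<bullet> (Q *v ?w t)) = (\<lambda>t. if t \<in> {0..T} then w t \<bullet> (Q *v w t) else 0)"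
      "(\<lambda>t. (norm (?w t))\<^sup>2) = (\<lambda>t. if t \<in> {0..T} then (norm (w t))\<^sup>2 else 0)"
      by (auto simp: cutoff_def)
    then have 1: "integral {0..} (\<lambda>t. ?w t \<bullet> (Q *v ?w t)) = integral {0..T} (\<lambda>t. w t \<bullet> (Q *v w t))"
      "L2_norm_sq ?w = integral {0..T} (\<lambda>t. (norm (w t))\<^sup>2)"
      by (simp_all only: L2_norm_sq_eq_integral[OF w2] integral_restrict_Int T0)
    have lx: "loc_square_integrable x" using x primitive_loc_square_integrable unfolding trajectory_def by blast
    have ld: "loc_square_integrable d" by (rule L2_imp_loc_square_integrable[OF d])
    have 2: "integral {0..T} (\<lambda>t. (norm (H *v x t))\<^sup>2) \<le> L2_norm_sq (\<lambda>t. H *v x t)"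
      "integral {0..T} (\<lambda>t. (norm (d t))\<^sup>2) \<le> L2_norm_sq d"
      using Hx d unfolding L2_norm_sq_eq_integral[OF Hx] L2_norm_sq_eq_integral[OF d] L2_iff
      by (auto intro: integral_Icc_le_halfline)
    have "cost T x w d \<le> - \<epsilon> * integral {0..T} (\<lambda>t. (norm (w t))\<^sup>2)"
    proof -
      have "\<eta> * integral {0..T} (\<lambda>t. (norm (d t))\<^sup>2) \<le> \<eta> * L2_norm_sq d"
        using 2(2) eta by (intro mult_left_mono) auto
      then show ?thesis
        unfolding cost_integrable(5)[OF lx w ld] using le 2(1) unfolding 1 by linarith
    qed
    with ld x show "\<exists>d x. loc_square_integrable d \<and> trajectory A B E ?w d x \<and>
        cost T x w d \<le> - \<epsilon> * integral {0..T} (\<lambda>t. (norm (w t))\<^sup>2)" by blast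
  qed (use assms e in auto)
  obtain P where "(riccati_sol \<longlongrightarrow> P) at_top" "sym_pos_semidef P" using riccati_sol_tendsto by blast
  then show ?thesis using that limit_riccati limit_stabilizing by blast
qed

section \<open>Block structure\<close>

definition upper :: "'x^('a::finite + 'b::finite) \<Rightarrow> 'x^'a" where
  "upper v = (\<chi> i. v $ Inl i)"

definition lower :: "'x^('a::finite + 'b::finite) \<Rightarrow> 'x^'b" where
  "lower v = (\<chi> i. v $ Inr i)"

lemma stack_Inl [simp]: "stack u v $ Inl i = u $ i"
  and stack_Inr [simp]: "stack u v $ Inr j = v $ j"
  by (simp_all add: stack_def)

lemma upper_stack [simp]: "upper (stack u v) = u" and lower_stack [simp]: "lower (stack u v) = v"
  by (simp_all add: upper_def lower_def vec_eq_iff)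

lemma stack_upper_lower [simp]: "stack (upper v) (lower v) = v"
proof (rule vec_eq_iff[THEN iffD2], rule allI)
  show "stack (upper v) (lower v) $ i = v $ i" for i
    by (cases i) (simp_all add: upper_def lower_def)
qed

lemma stack_eq_iff: "stack u v = stack u' v' \<longleftrightarrow> u = u' \<and> v = v'"
  by (metis upper_stack lower_stack)

lemma stack_zero [simp]: "stack (0 :: 'x::zero^'a::finite) (0 :: 'x^'b::finite) = 0"
  by (simp add: vec_eq_iff stack_def split: sum.split)

lemma hcat_zero [simp]: "hcat (0 :: 'x::zero^'a::finite^'r::finite) (0 :: 'x^'b::finite^'r) = 0"
  by (simp add: vec_eq_iff hcat_def stack_def split: sum.split)

lemma minus_matrix_vector_mult: "(- M) *v v = - (M *v v)" for M :: "real^'a^'b"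
  by (simp add: vec_eq_iff matrix_vector_mult_def sum_negf)

lemma sum_UNIV_Plus:
  "(\<Sum>i\<in>UNIV. f i) = (\<Sum>i\<in>UNIV. f (Inl i)) + (\<Sum>j\<in>UNIV. f (Inr j))"
  for f :: "'a::finite + 'b::finite \<Rightarrow> 'c::comm_monoid_add"
  by (simp add: UNIV_Plus_UNIV[symmetric] sum.Plus o_def del: UNIV_Plus_UNIV)

lemma hcat_mult_stack: "hcat M N *v stack u v = M *v u + N *v v"
  by (simp add: vec_eq_iff matrix_vector_mult_def hcat_def sum_UNIV_Plus)

lemma vcat_mult: "vcat M N *v x = stack (M *v x) (N *v x)"
proof (rule vec_eq_iff[THEN iffD2], rule allI)
  show "(vcat M N *v x) $ i = stack (M *v x) (N *v x) $ i" for i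
    by (cases i) (simp_all add: vcat_def matrix_vector_mult_def)
qed

lemma map_matrix_hcat: "map_matrix f (hcat M N) = hcat (map_matrix f M) (map_matrix f N)"
  by (simp add: vec_eq_iff map_matrix_def hcat_def stack_def split: sum.split)

lemma map_matrix_vcat: "map_matrix f (vcat M N) = vcat (map_matrix f M) (map_matrix f N)"
  by (simp add: vec_eq_iff map_matrix_def vcat_def stack_def split: sum.split)

lemma transpose_vcat: "transpose (vcat M N) = hcat (transpose M) (transpose N)"
  by (simp add: vec_eq_iff transpose_def hcat_def vcat_def stack_def split: sum.split)

lemma mat_mult_vec: "mat k *v v = k *\<^sub>R v" for v :: "real^'n"
  by (simp add: vec_eq_iff matrix_vector_mult_def mat_def if_distrib[of "\<lambda>x. x * _"] cong: if_cong)

lemma inner_stack: "stack u v \<bullet> stack u' v' = u \<bullet> u' + v \<bullet> v'" for u u' :: "real^'a" and v v' :: "real^'b"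
  by (simp add: inner_vec_def sum_UNIV_Plus)

lemma norm_stack: "(norm (stack u v))\<^sup>2 = (norm u)\<^sup>2 + (norm v)\<^sup>2" for u :: "real^'a" and v :: "real^'b"
  by (simp add: power2_norm_eq_inner inner_stack)

lemma stack_add: "stack u v + stack u' v' = stack (u + u') (v + v')" for u u' :: "real^'a" and v v' :: "real^'b"
  by (simp add: vec_eq_iff stack_def split: sum.split)

lemma bounded_linear_stack:
  "bounded_linear (\<lambda>u. stack u (0 :: real^'b) :: real^('a + 'b))"
  "bounded_linear (\<lambda>v. stack (0 :: real^'a) v :: real^('a + 'b))"
  unfolding linear_conv_bounded_linear[symmetric]
  by (auto intro!: linearI simp: vec_eq_iff stack_def split: sum.split)

lemma bounded_linear_upper: "bounded_linear (upper :: real^('a::finite + 'b::finite) \<Rightarrow> real^'a)"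
  and bounded_linear_lower: "bounded_linear (lower :: real^('a::finite + 'b::finite) \<Rightarrow> real^'b)"
  unfolding linear_conv_bounded_linear[symmetric]
  by (auto intro!: linearI simp: vec_eq_iff upper_def lower_def)

lemma primitive_stack:
  fixes x :: "real \<Rightarrow> real^'a" and y :: "real \<Rightarrow> real^'b"
  assumes "primitive f x" "primitive g y"
  shows "primitive (\<lambda>t. stack (f t) (g t)) (\<lambda>t. stack (x t) (y t))"
  using primitive_add[OF primitive_linear[OF assms(1) bounded_linear_stack(1)]
      primitive_linear[OF assms(2) bounded_linear_stack(2)]]
  by (simp add: stack_add)

lemma L2_if_norm_le:
  assumes "v \<in> borel_measurable (lebesgue_on {0..})" "g integrable_on {0..}" "\<And>t. (norm (v t))\<^sup>2 \<le> g t"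
  shows "v \<in> L2"
  unfolding L2_iff
proof
  have [measurable]: "v \<in> borel_measurable (lebesgue_on {0..})" by fact
  show "(\<lambda>t. (norm (v t))\<^sup>2) integrable_on {0..}"
    by (rule measurable_bounded_by_integrable_imp_integrable[OF _ assms(2)]) (use assms(3) in auto)
qed fact

lemma L2_linear:
  assumes u: "u \<in> L2" and h: "bounded_linear h"
  shows "(\<lambda>t. h (u t)) \<in> L2"
proof -
  obtain K where K: "\<And>x. norm (h x) \<le> norm x * K" using bounded_linear.bounded[OF h] by blast
  show ?thesis
  proof (rule L2_if_norm_le)
    show "(\<lambda>t. h (u t)) \<in> borel_measurable (lebesgue_on {0..})"
      using u unfolding L2_iff
      by (intro measurable_compose[OF _ borel_measurable_continuous_onI[OF linear_continuous_on[OF h]]]) auto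
    show "(\<lambda>t. K\<^sup>2 * (norm (u t))\<^sup>2) integrable_on {0..}"
      using u unfolding L2_iff by (intro integrable_on_mult_right) auto
    show "(norm (h (u t)))\<^sup>2 \<le> K\<^sup>2 * (norm (u t))\<^sup>2" for t
      using power_mono[OF K[of "u t"] norm_ge_zero, of 2] by (simp add: power_mult_distrib mult.commute)
  qed
qed

lemma L2_add:
  assumes "u \<in> L2" "v \<in> L2"
  shows "(\<lambda>t. u t + v t) \<in> L2"
proof (rule L2_if_norm_le)
  show "(\<lambda>t. u t + v t) \<in> borel_measurable (lebesgue_on {0..})"
    using assms unfolding L2_iff by (intro borel_measurable_add) auto
  show "(\<lambda>t. 2 * (norm (u t))\<^sup>2 + 2 * (norm (v t))\<^sup>2) integrable_on {0..}"
    using assms unfolding L2_iff by (intro integrable_add integrable_on_mult_right) auto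
qed (rule norm_add_sq_le)

lemma L2_stack:
  fixes u :: "real \<Rightarrow> real^'a" and v :: "real \<Rightarrow> real^'b"
  assumes "u \<in> L2" "v \<in> L2"
  shows "(\<lambda>t. stack (u t) (v t)) \<in> L2"
  using L2_add[OF L2_linear[OF assms(1) bounded_linear_stack(1)] L2_linear[OF assms(2) bounded_linear_stack(2)]]
  by (simp add: stack_add)

lemma L2_norm_sq_stack:
  fixes u :: "real \<Rightarrow> real^'a" and v :: "real \<Rightarrow> real^'b"
  assumes "u \<in> L2" "v \<in> L2"
  shows "L2_norm_sq (\<lambda>t. stack (u t) (v t)) = L2_norm_sq u + L2_norm_sq v"
  using assms unfolding L2_norm_sq_eq_integral[OF L2_stack[OF assms]] L2_norm_sq_eq_integral[OF assms(1)]
    L2_norm_sq_eq_integral[OF assms(2)] norm_stack L2_iff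
  by (intro integral_add) auto

text \<open>Outputs are determined for nonnegative times only, so signals can be compared only
  there.\<close>

lemma L2_cong:
  assumes "\<And>t. t \<ge> 0 \<Longrightarrow> u t = v t"
  shows "u \<in> L2 \<longleftrightarrow> v \<in> L2" "L2_norm_sq u = L2_norm_sq v"
proof -
  have "set_integrable lebesgue {0..} (\<lambda>t. (norm (u t))\<^sup>2) = set_integrable lebesgue {0..} (\<lambda>t. (norm (v t))\<^sup>2)"
    by (rule set_integrable_cong) (auto simp: assms)
  moreover have "(\<lambda>x. indicator {0..} x *\<^sub>R u x) = (\<lambda>x. indicator {0..} x *\<^sub>R v x)"
    using assms by (auto simp: indicator_def of_bool_def)
  ultimately show "u \<in> L2 \<longleftrightarrow> v \<in> L2" by (simp add: L2_def set_borel_measurable_def)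
  show "L2_norm_sq u = L2_norm_sq v"
    unfolding L2_norm_sq_def by (rule set_lebesgue_integral_cong) (auto simp: assms)
qed

section \<open>State trajectories\<close>

lemma is_state_trajectory_iff:
  "is_state_trajectory S 0 0 u d x \<longleftrightarrow>
     x 0 = 0 \<and> primitive (\<lambda>t. mat_A S *v x t + (mat_B S *v u t + mat_E S *v d t)) x"
proof -
  let ?f = "\<lambda>s. mat_A S *v x s + mat_B S *v u s + mat_E S *v d s"
  have "(x t = 0 + (LINT s:{0..t}|lebesgue. ?f s)) \<longleftrightarrow> x t = integral {0..t} ?f"
    if "?f absolutely_integrable_on {0..t}" for t
    using set_lebesgue_integral_eq_integral(2)[OF that] by simp
  then have "is_state_trajectory S 0 0 u d x
      \<longleftrightarrow> (\<forall>t\<ge>0. ?f absolutely_integrable_on {0..t} \<and> x t = integral {0..t} ?f)"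
    unfolding is_state_trajectory_def by blast
  also have "\<dots> \<longleftrightarrow> x 0 = 0 \<and> primitive ?f x"
  proof
    assume *: "\<forall>t\<ge>0. ?f absolutely_integrable_on {0..t} \<and> x t = integral {0..t} ?f"
    \<comment> \<open>The initial condition is hidden in the integral equation at time 0.\<close>
    then have "x 0 = integral {0..0} ?f" by blast
    then have "x 0 = 0" by simp
    with * show "x 0 = 0 \<and> primitive ?f x" unfolding primitive_def by simp
  qed (unfold primitive_def, simp)
  finally show ?thesis by (simp add: add.assoc)
qed

lemma state_at_eq:
  assumes "is_state_trajectory S 0 0 u d x" "t \<ge> 0"
  shows "state_at S 0 0 u d t = x t"
  unfolding state_at_def
proof (rule the_equality)
  fix v assume "\<exists>y. is_state_trajectory S 0 0 u d y \<and> v = y t"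
  then obtain y where "is_state_trajectory S 0 0 u d y" "v = y t" by blast
  then show "v = x t"
    using linear_ode_primitive_unique[of "mat_A S" y "\<lambda>t. mat_B S *v u t + mat_E S *v d t" x t] assms
    unfolding is_state_trajectory_iff by simp
qed (use assms in blast)

lemma is_state_trajectory_exists:
  assumes "u \<in> L2" "d \<in> L2"
  obtains x where "is_state_trajectory S 0 0 u d x"
proof -
  have "(\<lambda>t. mat_B S *v u t + mat_E S *v d t) absolutely_integrable_on {0..T}" for T
    by (intro loc_square_integrable_imp_absolutely_integrable L2_imp_loc_square_integrable L2_add
        L2_linear[OF assms(1)] L2_linear[OF assms(2)]) auto
  then show ?thesis
    using linear_ode_primitive_exists[of "\<lambda>t. mat_B S *v u t + mat_E S *v d t" 0 "mat_A S"] that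
    unfolding is_state_trajectory_iff by blast
qed

section \<open>Similarity as a full information problem\<close>

text \<open>The nonzero row block of \<open>joint_C\<close>. Because \<open>joint_C\<close> and
  \<open>joint_D\<close> occupy different row blocks and \<open>weight_R\<close> is block diagonal,
  state and control are penalized without cross term.\<close>

definition joint_H :: "('n1::finite, 'm::finite, 'q1::finite, 'p::finite) lti_system \<Rightarrow>
    ('n2::finite, 'm, 'q2::finite, 'p) lti_system \<Rightarrow> real^('n1 + 'n2)^'p" where
  "joint_H S1 S2 = hcat (mat_C S1) (- mat_C S2)"

lemma joint_A_mult: "joint_A S1 S2 *v stack x1 x2 = stack (mat_A S1 *v x1) (mat_A S2 *v x2)"
  by (simp add: joint_A_def vcat_mult hcat_mult_stack)

lemma joint_B_mult: "joint_B S1 S2 *v d = stack 0 (mat_E S2 *v d)"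
  by (simp add: joint_B_def vcat_mult)

lemma joint_E_mult: "joint_E S1 S2 *v stack u1 (stack u2 d1)
    = stack (mat_B S1 *v u1 + mat_E S1 *v d1) (mat_B S2 *v u2)"
  by (simp add: joint_E_def vcat_mult hcat_mult_stack)

lemma joint_H_mult: "joint_H S1 S2 *v stack x1 x2 = mat_C S1 *v x1 - mat_C S2 *v x2"
  by (simp add: joint_H_def hcat_mult_stack minus_matrix_vector_mult)

lemma weight_Q_mult: "weight_Q \<gamma> \<delta> \<mu> *v stack u1 (stack u2 d1)
    = stack ((\<gamma> + \<delta>) *\<^sub>R u1 - \<gamma> *\<^sub>R u2) (stack ((\<gamma> + \<delta>) *\<^sub>R u2 - \<gamma> *\<^sub>R u1) (\<mu> *\<^sub>R d1))"
  by (simp add: weight_Q_def vcat_mult hcat_mult_stack mat_mult_vec)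

text \<open>Identifies \<open>weight_Q\<close> as the density of the right-hand side of the
  similarity inequality, before the margin and the term in \<open>d2\<close> are subtracted.\<close>

lemma weight_Q_form: "stack u1 (stack u2 d1) \<bullet> (weight_Q \<gamma> \<delta> \<mu> *v stack u1 (stack u2 d1))
    = \<gamma> * (norm (u1 - u2))\<^sup>2 + \<delta> * (norm (stack u1 u2))\<^sup>2 + \<mu> * (norm d1)\<^sup>2"
  unfolding weight_Q_mult norm_stack power2_norm_eq_inner inner_stack
  by (simp add: inner_diff_left inner_diff_right inner_commute algebra_simps)

lemma weight_Q_ge:
  fixes w :: "real^('m::finite + 'm + 'q1::finite)"
  assumes "\<gamma> > 0"
  shows "min \<delta> \<mu> * (norm w)\<^sup>2 \<le> w \<bullet> (weight_Q \<gamma> \<delta> \<mu> *v w)"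
proof -
  obtain u1 u2 :: "real^'m" and d1 :: "real^'q1" where w: "w = stack u1 (stack u2 d1)"
    by (metis stack_upper_lower)
  have "min \<delta> \<mu> * (norm (stack u1 u2))\<^sup>2 \<le> \<delta> * (norm (stack u1 u2))\<^sup>2"
    "min \<delta> \<mu> * (norm d1)\<^sup>2 \<le> \<mu> * (norm d1)\<^sup>2" "0 \<le> \<gamma> * (norm (u1 - u2))\<^sup>2"
    using assms by (auto intro!: mult_right_mono)
  moreover have "(norm w)\<^sup>2 = (norm (stack u1 u2))\<^sup>2 + (norm d1)\<^sup>2"
    by (simp add: w norm_stack)
  ultimately show ?thesis unfolding w weight_Q_form by (simp add: distrib_left)
qed

lemma weight_Q_symmetric: "transpose (weight_Q \<gamma> \<delta> \<mu>) = weight_Q \<gamma> \<delta> \<mu>"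
  by (simp add: vec_eq_iff weight_Q_def transpose_def hcat_def vcat_def stack_def mat_def split: sum.split)

lemma matrix_inv_right:
  fixes M :: "real^'n^'n"
  assumes "\<And>v. M *v v = 0 \<Longrightarrow> v = 0"
  shows "M ** matrix_inv M = mat 1" "matrix_inv M ** M = mat 1"
proof -
  have "invertible M"
    using assms unfolding invertible_left_inverse matrix_left_invertible_ker by blast
  then have "\<exists>N. M ** N = mat 1 \<and> N ** M = mat 1" by (simp add: invertible_def)
  from someI_ex[OF this] show "M ** matrix_inv M = mat 1" "matrix_inv M ** M = mat 1"
    by (simp_all add: matrix_inv_def)
qed

lemma matrix_inv_mat:
  fixes \<eta> :: real
  assumes "\<eta> \<noteq> 0"
  shows "matrix_inv (mat \<eta> :: real^'n^'n) = mat (1 / \<eta>)"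
proof -
  have "(mat \<eta> :: real^'n^'n) ** matrix_inv (mat \<eta>) = mat 1"
    by (rule matrix_inv_right(1)) (use assms in \<open>simp add: mat_mult_vec\<close>)
  then have "\<eta> *\<^sub>R (matrix_inv (mat \<eta> :: real^'n^'n) *v v) = v" for v
    by (metis mat_mult_vec matrix_vector_mul_assoc matrix_vector_mul_lid)
  from arg_cong[OF this, of "\<lambda>v. (1 / \<eta>) *\<^sub>R v"]
  have "matrix_inv (mat \<eta> :: real^'n^'n) *v v = mat (1 / \<eta>) *v v" for v
    using assms by (simp add: mat_mult_vec)
  then show ?thesis by (simp add: matrix_eq)
qed

lemma joint_D_weight: "transpose (joint_D :: real^'q2^('p::finite + 'q2::finite)) ** weight_R \<eta> ** joint_D = mat \<eta>"
proof -
  have "(transpose (joint_D :: real^'q2^('p::finite + 'q2::finite)) ** weight_R \<eta> ** joint_D) *v v = mat \<eta> *v v" for v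
    by (simp add: matrix_vector_mul_assoc[symmetric] joint_D_def weight_R_def vcat_mult transpose_vcat
        hcat_mult_stack mat_mult_vec transpose_mat del: transpose_matrix_vector)
  then show ?thesis by (simp add: matrix_eq)
qed

lemma joint_C_weight:
  "transpose (joint_C S1 S2) ** weight_R \<eta> ** joint_C S1 S2 = transpose (joint_H S1 S2) ** joint_H S1 S2"
proof -
  have "(transpose (joint_C S1 S2) ** weight_R \<eta> ** joint_C S1 S2) *v v
      = (transpose (joint_H S1 S2) ** joint_H S1 S2) *v v" for v
    by (simp add: matrix_vector_mul_assoc[symmetric] joint_C_def joint_H_def weight_R_def vcat_mult transpose_vcat
        hcat_mult_stack mat_mult_vec del: transpose_matrix_vector)
  then show ?thesis by (simp add: matrix_eq)
qed

text \<open>Any nonzero block of an eigenvector of a block diagonal matrix is an eigenvector of the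
  corresponding block.\<close>

lemma joint_A_Hurwitz:
  assumes "zero_asymp_stable S1" "zero_asymp_stable S2"
  shows "Hurwitz (joint_A S1 S2)"
proof -
  have "z \<in> spec (mat_A S1) \<union> spec (mat_A S2)" if "z \<in> spec (joint_A S1 S2)" for z
  proof -
    from that obtain v where v: "v \<noteq> 0" "map_matrix complex_of_real (joint_A S1 S2) *v v = z *s v"
      by (auto simp: spec_def)
    let ?u = "upper v" and ?l = "lower v"
    have m0: "map_matrix complex_of_real 0 = 0" by (simp add: vec_eq_iff map_matrix_def)
    have "map_matrix complex_of_real (joint_A S1 S2) *v stack ?u ?l
        = stack (map_matrix complex_of_real (mat_A S1) *v ?u) (map_matrix complex_of_real (mat_A S2) *v ?l)"
      by (simp add: joint_A_def map_matrix_vcat map_matrix_hcat vcat_mult hcat_mult_stack m0 del: stack_upper_lower)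
    moreover have "z *s stack ?u ?l = stack (z *s ?u) (z *s ?l)"
      by (simp add: vec_eq_iff stack_def split: sum.split del: stack_upper_lower)
    ultimately have "map_matrix complex_of_real (mat_A S1) *v ?u = z *s ?u"
      "map_matrix complex_of_real (mat_A S2) *v ?l = z *s ?l"
      using v(2) by (metis stack_upper_lower stack_eq_iff)+
    moreover have "?u \<noteq> 0 \<or> ?l \<noteq> 0"
    proof (rule ccontr)
      assume "\<not> (?u \<noteq> 0 \<or> ?l \<noteq> 0)"
      then have "v = stack 0 0" by (metis stack_upper_lower)
      also have "\<dots> = 0" by simp
      finally show False using v(1) by simp
    qed
    ultimately show ?thesis unfolding spec_def by blast
  qed
  then show ?thesis using assms unfolding zero_asymp_stable_def Hurwitz_def by blast
qed


lemma weight_Q_full_information: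
  assumes "\<gamma> > 0" "\<delta> > 0" "\<mu> > 0" "\<eta> > 0"
  shows "full_information (weight_Q \<gamma> \<delta> \<mu>) (matrix_inv (weight_Q \<gamma> \<delta> \<mu>)) \<eta> (min \<delta> \<mu>)"
proof unfold_locales
  let ?Q = "weight_Q \<gamma> \<delta> \<mu> :: real^('a + 'a + 'b)^('a + 'a + 'b)"
  have ker: "w = 0" if "?Q *v w = 0" for w
  proof -
    have "min \<delta> \<mu> * (norm w)\<^sup>2 \<le> 0" using weight_Q_ge[OF assms(1), of \<delta> \<mu> w] that by simp
    then show ?thesis using assms by (auto simp: mult_le_0_iff min_le_iff_disj)
  qed
  note inv = matrix_inv_right[OF ker]
  show "transpose ?Q = ?Q" by (rule weight_Q_symmetric)
  show "?Q ** matrix_inv ?Q = mat 1" by (rule inv(1))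
  have "transpose (matrix_inv ?Q) = transpose (matrix_inv ?Q) ** (?Q ** matrix_inv ?Q)"
    by (simp add: inv(1))
  also have "\<dots> = transpose (?Q ** matrix_inv ?Q) ** matrix_inv ?Q"
    by (simp add: matrix_transpose_mul weight_Q_symmetric matrix_mul_assoc)
  finally show "transpose (matrix_inv ?Q) = matrix_inv ?Q" by (simp add: inv(1) transpose_mat)
qed (use assms weight_Q_ge in auto)

lemma trajectory_stack_iff:
  "trajectory (joint_A S1 S2) (joint_B S1 S2) (joint_E S1 S2)
      (\<lambda>t. stack (u1 t) (stack (u2 t) (d1 t))) d (\<lambda>t. stack (x1 t) (x2 t))
    \<longleftrightarrow> is_state_trajectory S1 0 0 u1 d1 x1 \<and> is_state_trajectory S2 0 0 u2 d x2"
  (is "?L \<longleftrightarrow> ?R")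
proof -
  let ?f1 = "\<lambda>t. mat_A S1 *v x1 t + (mat_B S1 *v u1 t + mat_E S1 *v d1 t)"
  let ?f2 = "\<lambda>t. mat_A S2 *v x2 t + (mat_B S2 *v u2 t + mat_E S2 *v d t)"
  have "primitive (\<lambda>t. stack (?f1 t) (?f2 t)) (\<lambda>t. stack (x1 t) (x2 t)) \<longleftrightarrow> primitive ?f1 x1 \<and> primitive ?f2 x2"
    using primitive_stack[of ?f1 x1 ?f2 x2]
      primitive_linear[OF _ bounded_linear_upper, of "\<lambda>t. stack (?f1 t) (?f2 t)" "\<lambda>t. stack (x1 t) (x2 t)"]
      primitive_linear[OF _ bounded_linear_lower, of "\<lambda>t. stack (?f1 t) (?f2 t)" "\<lambda>t. stack (x1 t) (x2 t)"]
    by auto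
  moreover have "stack (x1 0) (x2 0) = 0 \<longleftrightarrow> x1 0 = 0 \<and> x2 0 = 0"
    using stack_eq_iff[of "x1 0" "x2 0" 0 0] by simp
  moreover have "joint_A S1 S2 *v stack (x1 t) (x2 t) + joint_B S1 S2 *v d t
      + joint_E S1 S2 *v stack (u1 t) (stack (u2 t) (d1 t)) = stack (?f1 t) (?f2 t)" for t
    by (simp add: joint_A_mult joint_B_mult joint_E_mult stack_add add_ac)
  ultimately show ?thesis
    unfolding trajectory_def is_state_trajectory_iff by auto
qed


text \<open>The disturbance is \<open>w = [u1; u2; d1]\<close> and the control is \<open>d2\<close>.
  Subtracting \<epsilon> from both \<delta> and \<mu> amounts to subtracting \<epsilon> times the
  energy of the whole \<open>w\<close>, so the constants \<epsilon>, \<eta> and \<mu> are the same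
  on both sides.\<close>

lemma similar_iff_solvable:
  fixes S1 :: "('n1::finite, 'm::finite, 'q1::finite, 'p::finite) lti_system"
    and S2 :: "('n2::finite, 'm, 'q2::finite, 'p) lti_system"
  assumes "\<gamma> > 0" "\<delta> > 0"
  shows "similar \<gamma> \<delta> S1 S2 \<longleftrightarrow> (\<exists>\<eta>>0. \<exists>\<mu>>0.
    solvable (joint_A S1 S2) (joint_B S1 S2) (joint_E S1 S2) (joint_H S1 S2) (weight_Q \<gamma> \<delta> \<mu>) \<eta>)"
proof -
  let ?H = "joint_H S1 S2"
  let ?tr = "trajectory (joint_A S1 S2) (joint_B S1 S2) (joint_E S1 S2)"
  let ?e = "\<lambda>u1 u2 d1 d2 t. output_at S1 0 0 u1 d1 t - output_at S2 0 0 u2 d2 t"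
  let ?w = "\<lambda>u1 u2 d1 t. stack (u1 t) (stack (u2 t) (d1 t))"
  let ?bound = "\<lambda>\<epsilon> \<eta> \<mu> u1 u2 d1 d2. \<gamma> * L2_norm_sq (\<lambda>t. u1 t - u2 t)
      + (\<delta> - \<epsilon>) * L2_norm_sq (\<lambda>t. stack (u1 t) (u2 t)) + (\<mu> - \<epsilon>) * L2_norm_sq d1 - \<eta> * L2_norm_sq d2"
  let ?game = "\<lambda>\<epsilon> \<eta> \<mu> w d x. ?tr w d x \<and> (\<lambda>t. ?H *v x t) \<in> L2 \<and>
      L2_norm_sq (\<lambda>t. ?H *v x t) + \<eta> * L2_norm_sq d
        \<le> integral {0..} (\<lambda>t. w t \<bullet> (weight_Q \<gamma> \<delta> \<mu> *v w t)) - \<epsilon> * L2_norm_sq w"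
  \<comment> \<open>For given inputs the trajectory is unique on the half-line, so asking for some
    trajectory of the game is the same as evaluating \<open>output_at\<close>.\<close>
  have key: "(\<exists>x. ?game \<epsilon> \<eta> \<mu> (?w u1 u2 d1) d2 x) \<longleftrightarrow>
      ?e u1 u2 d1 d2 \<in> L2 \<and> L2_norm_sq (?e u1 u2 d1 d2) \<le> ?bound \<epsilon> \<eta> \<mu> u1 u2 d1 d2"
    if L2: "u1 \<in> L2" "u2 \<in> L2" "d1 \<in> L2" "d2 \<in> L2"
    for \<epsilon> \<eta> \<mu> and u1 u2 :: "real \<Rightarrow> real^'m" and d1 :: "real \<Rightarrow> real^'q1" and d2 :: "real \<Rightarrow> real^'q2"
  proof -
    have diff: "(\<lambda>t. u1 t - u2 t) \<in> L2"
      using L2_add[OF L2(1) L2_linear[OF L2(2) bounded_linear_minus[OF bounded_linear_ident]]] by simp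
    have u: "(\<lambda>t. stack (u1 t) (u2 t)) \<in> L2" by (rule L2_stack[OF L2(1,2)])
    have "integral {0..} (\<lambda>t. ?w u1 u2 d1 t \<bullet> (weight_Q \<gamma> \<delta> \<mu> *v ?w u1 u2 d1 t))
        = \<gamma> * L2_norm_sq (\<lambda>t. u1 t - u2 t) + \<delta> * L2_norm_sq (\<lambda>t. stack (u1 t) (u2 t)) + \<mu> * L2_norm_sq d1"
      using diff u L2(3) unfolding weight_Q_form
      by (simp add: L2_norm_sq_eq_integral L2_iff integral_add integrable_add integrable_on_mult_right)
    moreover have "L2_norm_sq (?w u1 u2 d1) = L2_norm_sq (\<lambda>t. stack (u1 t) (u2 t)) + L2_norm_sq d1"
      using L2_norm_sq_stack[OF L2(1) L2_stack[OF L2(2,3)]] L2_norm_sq_stack[OF L2(2,3)]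
        L2_norm_sq_stack[OF L2(1,2)] by simp
    ultimately have rhs: "integral {0..} (\<lambda>t. ?w u1 u2 d1 t \<bullet> (weight_Q \<gamma> \<delta> \<mu> *v ?w u1 u2 d1 t))
        - \<epsilon> * L2_norm_sq (?w u1 u2 d1) - \<eta> * L2_norm_sq d2 = ?bound \<epsilon> \<eta> \<mu> u1 u2 d1 d2"
      by (simp add: algebra_simps)
    have out: "?e u1 u2 d1 d2 t = ?H *v stack (x1 t) (x2 t)"
      if "is_state_trajectory S1 0 0 u1 d1 x1" "is_state_trajectory S2 0 0 u2 d2 x2" "t \<ge> 0" for x1 x2 t
      using that by (simp add: output_at_def state_at_eq joint_H_mult)
    show ?thesis
    proof
      assume "\<exists>x. ?game \<epsilon> \<eta> \<mu> (?w u1 u2 d1) d2 x"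
      then obtain x where x: "?game \<epsilon> \<eta> \<mu> (?w u1 u2 d1) d2 x" by blast
      let ?x1 = "\<lambda>t. upper (x t)" and ?x2 = "\<lambda>t. lower (x t)"
      have "is_state_trajectory S1 0 0 u1 d1 ?x1" "is_state_trajectory S2 0 0 u2 d2 ?x2"
        using trajectory_stack_iff[of S1 S2 u1 u2 d1 d2 ?x1 ?x2] x by simp_all
      from out[OF this] have "?e u1 u2 d1 d2 t = ?H *v x t" if "t \<ge> 0" for t using that by simp
      from L2_cong[of "?e u1 u2 d1 d2", OF this] x rhs
      show "?e u1 u2 d1 d2 \<in> L2 \<and> L2_norm_sq (?e u1 u2 d1 d2) \<le> ?bound \<epsilon> \<eta> \<mu> u1 u2 d1 d2" by simp
    next
      assume e: "?e u1 u2 d1 d2 \<in> L2 \<and> L2_norm_sq (?e u1 u2 d1 d2) \<le> ?bound \<epsilon> \<eta> \<mu> u1 u2 d1 d2"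
      obtain x1 where x1: "is_state_trajectory S1 0 0 u1 d1 x1" using is_state_trajectory_exists[OF L2(1,3)] by blast
      obtain x2 where x2: "is_state_trajectory S2 0 0 u2 d2 x2" using is_state_trajectory_exists[OF L2(2,4)] by blast
      from L2_cong[of "?e u1 u2 d1 d2", OF out[OF x1 x2]] e rhs trajectory_stack_iff[of S1 S2 u1 u2 d1 d2 x1 x2] x1 x2
      have "?game \<epsilon> \<eta> \<mu> (?w u1 u2 d1) d2 (\<lambda>t. stack (x1 t) (x2 t))" by simp
      then show "\<exists>x. ?game \<epsilon> \<eta> \<mu> (?w u1 u2 d1) d2 x"
        by (rule exI[where x = "\<lambda>t. stack (x1 t) (x2 t)"])
    qed
  qed
  have all_w: "(\<forall>w\<in>L2. P w) \<longleftrightarrow> (\<forall>u1\<in>L2. \<forall>u2\<in>L2. \<forall>d1\<in>L2. P (?w u1 u2 d1))"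
    for P :: "(real \<Rightarrow> real^('m + 'm + 'q1)) \<Rightarrow> bool"
  proof
    assume R: "\<forall>u1\<in>L2. \<forall>u2\<in>L2. \<forall>d1\<in>L2. P (?w u1 u2 d1)"
    show "\<forall>w\<in>L2. P w"
    proof
      fix w :: "real \<Rightarrow> real^('m + 'm + 'q1)" assume w: "w \<in> L2"
      note l = L2_linear[OF w bounded_linear_lower]
      show "P w"
        using R[rule_format, OF L2_linear[OF w bounded_linear_upper] L2_linear[OF l bounded_linear_upper]
          L2_linear[OF l bounded_linear_lower]] by simp
    qed
  next
    assume L: "\<forall>w\<in>L2. P w"
    show "\<forall>u1\<in>L2. \<forall>u2\<in>L2. \<forall>d1\<in>L2. P (?w u1 u2 d1)"
      by (intro ballI bspec[OF L] L2_stack)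
  qed
  have "similar \<gamma> \<delta> S1 S2 \<longleftrightarrow> (\<exists>\<epsilon>>0. \<exists>\<eta>>0. \<exists>\<mu>>0. \<forall>u1\<in>L2. \<forall>u2\<in>L2. \<forall>d1\<in>L2. \<exists>d2\<in>L2.
      \<exists>x. ?game \<epsilon> \<eta> \<mu> (?w u1 u2 d1) d2 x)"
    unfolding similar_def Let_def
    by (intro ex_cong1 conj_cong refl ball_cong bex_cong) (simp only: key)
  also have "\<dots> \<longleftrightarrow> (\<exists>\<epsilon>>0. \<exists>\<eta>>0. \<exists>\<mu>>0. \<forall>w\<in>L2. \<exists>d2\<in>L2. \<exists>x. ?game \<epsilon> \<eta> \<mu> w d2 x)"
    unfolding all_w ..
  finally show ?thesis unfolding solvable_def by blast
qed

theorem theorem1: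
  fixes S1 :: "('n1::finite, 'm::finite, 'q1::finite, 'p::finite) lti_system"
    and S2 :: "('n2::finite, 'm, 'q2::finite, 'p) lti_system"
    and \<gamma> \<delta> :: real
  assumes "zero_asymp_stable S1" and "zero_asymp_stable S2"
    and "\<gamma> > 0" and "\<delta> > 0"
  shows "similar \<gamma> \<delta> S1 S2 \<longleftrightarrow>
    (\<exists>\<eta>>0. \<exists>\<mu>>0.
      let A = joint_A S1 S2;
          B = joint_B S1 S2;
          E = joint_E S1 S2;
          C = joint_C S1 S2;
          D = (joint_D :: real^'q2^('p + 'q2));
          Q = (weight_Q \<gamma> \<delta> \<mu> :: real^('m + 'm + 'q1)^('m + 'm + 'q1));
          R = (weight_R \<eta> :: real^('p + 'q2)^('p + 'q2))
      in \<exists>P :: real^('n1 + 'n2)^('n1 + 'n2).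
           sym_pos_semidef P \<and>
           0 = transpose A ** P + P ** A + transpose C ** R ** C
               + P ** E ** matrix_inv Q ** transpose E ** P
               - P ** B ** matrix_inv (transpose D ** R ** D) ** transpose B ** P \<and>
           spec (A - B ** matrix_inv (transpose D ** R ** D) ** transpose B ** P
                   + E ** matrix_inv Q ** transpose E ** P) \<subseteq> open_left_half_plane)"
  unfolding similar_iff_solvable[OF assms(3,4)] Let_def
\<comment> \<open>The equivalence holds for each fixed pair \<eta>, \<mu>, so it can be proved under
  the quantifiers.\<close>
proof (intro ex_cong1 conj_cong refl)
  fix \<eta> \<mu> :: real assume eta: "\<eta> > 0" and mu: "\<mu> > 0"
  let ?A = "joint_A S1 S2" and ?B = "joint_B S1 S2" and ?E = "joint_E S1 S2" and ?H = "joint_H S1 S2"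
    and ?C = "joint_C S1 S2" and ?D = "joint_D :: real^'q2^('p + 'q2)"
    and ?Q = "weight_Q \<gamma> \<delta> \<mu> :: real^('m + 'm + 'q1)^('m + 'm + 'q1)"
    and ?R = "weight_R \<eta> :: real^('p + 'q2)^('p + 'q2)"
  interpret full_information ?A ?B ?E ?H ?Q "matrix_inv ?Q" \<eta> "min \<delta> \<mu>"
    by (rule weight_Q_full_information[OF assms(3,4) mu eta])
  have inv: "matrix_inv (transpose ?D ** ?R ** ?D) = mat (1 / \<eta>)"
    using eta by (simp add: joint_D_weight matrix_inv_mat)
  have mm: "(mat k :: real^'q2^'q2) ** X = k *\<^sub>R X" for k and X :: "real^('n1 + 'n2)^'q2"
  proof -
    have "(mat k ** X) *v v = (k *\<^sub>R X) *v v" for v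
      by (simp add: matrix_vector_mul_assoc[symmetric] mat_mult_vec scaleR_matrix_vector_assoc[symmetric])
    then show ?thesis by (simp add: matrix_eq)
  qed
  have ric: "0 = transpose ?A ** P + P ** ?A + transpose ?C ** ?R ** ?C
               + P ** ?E ** matrix_inv ?Q ** transpose ?E ** P
               - P ** ?B ** matrix_inv (transpose ?D ** ?R ** ?D) ** transpose ?B ** P \<longleftrightarrow> riccati P" for P
  proof -
    have "P ** G ** P = P ** ?E ** matrix_inv ?Q ** transpose ?E ** P
        - P ** ?B ** mat (1 / \<eta>) ** transpose ?B ** P"
      unfolding matrix_eq
      by (simp add: matrix_vector_mul_assoc[symmetric] matrix_vector_mult_diff_rdistrib G_apply mat_mult_vec
          matrix_vector_mult_diff_distrib matrix_vector_mult_scaleR del: transpose_matrix_vector)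
    moreover have "0 = Z + X - Y \<longleftrightarrow> Z + (X - Y) = 0" for X Y Z :: "real^('n1 + 'n2)^('n1 + 'n2)"
      by (metis add_diff_eq)
    ultimately show ?thesis unfolding riccati_def inv joint_C_weight by (simp only:)
  qed
  have clp: "?A - ?B ** matrix_inv (transpose ?D ** ?R ** ?D) ** transpose ?B ** P
      + ?E ** matrix_inv ?Q ** transpose ?E ** P = ?A + G ** P" for P
    unfolding matrix_eq inv
    by (simp add: matrix_vector_mul_assoc[symmetric] matrix_vector_mult_diff_rdistrib matrix_vector_mult_add_rdistrib
        G_apply mat_mult_vec matrix_vector_mult_scaleR del: transpose_matrix_vector)
  show "solvable ?A ?B ?E ?H ?Q \<eta> \<longleftrightarrow> (\<exists>P. sym_pos_semidef P \<and>
           0 = transpose ?A ** P + P ** ?A + transpose ?C ** ?R ** ?C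
               + P ** ?E ** matrix_inv ?Q ** transpose ?E ** P
               - P ** ?B ** matrix_inv (transpose ?D ** ?R ** ?D) ** transpose ?B ** P \<and>
           spec (?A - ?B ** matrix_inv (transpose ?D ** ?R ** ?D) ** transpose ?B ** P
                   + ?E ** matrix_inv ?Q ** transpose ?E ** P) \<subseteq> open_left_half_plane)"
    unfolding ric clp Hurwitz_def[symmetric]
    using riccati_if_solvable[OF joint_A_Hurwitz[OF assms(1,2)]] solvable_if_riccati by blast
qed

end
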